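(* Let $Q\neq 0$ be real, $0<a<1$, and let $V(z)$ belong to the class $\mathfrak M^Q_{\kappa_0}$ with $a=\frac{1-\kappa_0}{1+\kappa_0}$, i.e. $$V(z)=Q+\int_{\mathbb R}\left(\frac{1}{\lambda-z}-\frac{\lambda}{1+\lambda^2}\right)d\mu(\lambda),\qquad \int_{\mathbb R}\frac{d\mu(\lambda)}{1+\lambda^2}=a,$$ where $\mu$ is an infinite Borel measure on $\mathbb R$. Then $V(z)$ can be realized as the impedance function $V_\Theta(z)$ of a minimal L-system $\Theta$ (with one-dimensional input-output space $\mathbb C$ and $J=1$) whose main operator $T$ has von Neumann parameter $\kappa$ ($0<\kappa<1$) given by $$\kappa=\frac{\left(b-2Q^2-\sqrt{b^2+4Q^2}\right)^2-a\left(b-\sqrt{b^2+4Q^2}\right)^2+4Q^2a(a-1)}{\left(b-2Q^2-\sqrt{b^2+4Q^2}\right)^2+a\left(b-\sqrt{b^2+4Q^2}\right)^2+4Q^2a(a+1)},\qquad b=Q^2+a^2-1.$$ Moreover, the quasi-kernel $\hat A$ of $\mathrm{Re}\,\mathbb A$ of the realizing L-system $\Theta$ has the unimodular von Neumann parameter $$U=\frac{(a+Qi)(1-\kappa^2)-1-\kappa^2}{2\kappa}.$$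
   Context: Rigged space: for a closed densely defined symmetric operator $\dot A$ with deficiency indices $(1,1)$ in a complex Hilbert space $\mathcal H$, let $\mathcal H_+=\mathrm{Dom}(\dot A^* )$ with $(f,g)_+=(f,g)+(\dot A^*f,\dot A^*g)$, and let $\mathcal H_+\subset\mathcal H\subset\mathcal H_-$ be the associated rigged Hilbert space ($\mathcal H_-$ is the dual of $\mathcal H_+$ with respect to the pairing extending the inner product of $\mathcal H$). $[X,Y]$ denotes bounded linear operators $X\to Y$. If $\mathbb A\in[\mathcal H_+,\mathcal H_-]$ then $\mathbb A^*\in[\mathcal H_+,\mathcal H_-]$; $\mathrm{Re}\,\mathbb A=(\mathbb A+\mathbb A^* )/2$, $\mathrm{Im}\,\mathbb A=(\mathbb A-\mathbb A^* )/2i$. The quasi-kernel $\hat A$ of $\mathrm{Re}\,\mathbb A$ is its restriction to $\{f\in\mathcal H_+:\mathrm{Re}\,\mathbb A f\in\mathcal H\}$. L-system: let $T$ be a non-symmetric operator with $\dot A\subset T\subset\dot A^*$, $\rho(T)\ne\emptyset$, $\mathrm{Dom}(\dot A)=\mathrm{Dom}(T)\cap\mathrm{Dom}(T^* )$. A $( * )$-extension of $T$ is $\mathbb A\in[\mathcal H_+,\mathcal H_-]$ with $\dot A\subset T\subset\mathbb A$, $\dot A\subset T^*\subset\mathbb A^*$ such that the quasi-kernel $\hat A$ of $\mathrm{Re}\,\mathbb A$ is self-adjoint in $\mathcal H$. An L-system with one-dimensional input-output is $\Theta=\begin{pmatrix}\mathbb A&K&1\\ \mathcal H_+\subset\mathcal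 H\subset\mathcal H_-&&\mathbb C\end{pmatrix}$ where $\mathbb A$ (state-space operator) is a $( * )$-extension of such a $T$ (main operator), $K\in[\mathbb C,\mathcal H_-]$, $\mathrm{Im}\,\mathbb A=KK^*$, $\mathrm{Ran}(K)=\mathrm{Ran}(\mathrm{Im}\,\mathbb A)$. It is minimal if $\dot A$ is prime (no nontrivial reducing subspace on which $\dot A$ induces a self-adjoint operator). Its impedance function is $V_\Theta(z)=K^*(\mathrm{Re}\,\mathbb A-zI)^{-1}K$, $z\in\rho(\hat A)$. Parameters: for normalized $g_\pm\in\mathrm{Ker}(\dot A^*\mp iI)$, the von Neumann parameter $\kappa$ of $T$ is defined by $g_+-\kappa g_-\in\mathrm{Dom}(T)$, $|\kappa|<1$; the vectors $g_\pm$ are chosen (changing the phase of $g_-$) so that $0\le\kappa<1$. The parameter $U$ ($|U|=1$) of $\hat A$ is defined, with respect to the same pair $g_\pm$, by $g_++Ug_-\in\mathrm{Dom}(\hat A)$, i.e. $\mathrm{Dom}(\hat A)=\mathrm{Dom}(\dot A)\dot+\mathrm{span}\{g_++Ug_-\}$. "Realized" means $V=V_\Theta$ on $\mathbb C_\pm$ ($V$ extended by $V(\bar z)=\overline{V(z)}$), for a suitable choice of rigged space and deficiency vectors. *)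

theory Defs
  imports "HOL-Analysis.Analysis" "HOL-Algebra.Module"
begin

section \<open>Complex Hilbert spaces with explicit carriers\<close>

text \<open>The complex field as a record, so that complex vector spaces are modules over it. Carriers are
  explicit because the theory needs several inner products on subsets of one space, and because
  existence of a suitable Hilbert space has to be expressible inside a formula. The fields
  \<open>mult\<close> and \<open>one\<close> that a module record inherits from rings play no role.\<close>

definition complex_field :: "complex ring" where
  "complex_field = \<lparr>carrier = UNIV, mult = (*), one = 1, zero = 0, add = (+)\<rparr>"

record 'a inner_space = "(complex, 'a) module" +
  ip :: "'a \<Rightarrow> 'a \<Rightarrow> complex"

definition hnorm :: "'a inner_space \<Rightarrow> 'a \<Rightarrow> real" where
  "hnorm H x = sqrt (Re (ip H x x))"

definition hdist :: "'a inner_space \<Rightarrow> 'a \<Rightarrow> 'a \<Rightarrow> real" where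
  "hdist H x y = hnorm H (x \<ominus>\<^bsub>H\<^esub> y)"

definition htop :: "'a inner_space \<Rightarrow> 'a topology" where
  "htop H = Metric_space.mtopology (carrier H) (hdist H)"

text \<open>The inner product is linear in the first and antilinear in the second argument.\<close>

locale complex_hilbert_space = module complex_field H
  for H :: "'a inner_space" (structure) +
  assumes ip_add: "\<lbrakk>x \<in> carrier H; y \<in> carrier H; z \<in> carrier H\<rbrakk>
      \<Longrightarrow> ip H (x \<oplus> y) z = ip H x z + ip H y z"
    and ip_smult: "\<lbrakk>x \<in> carrier H; y \<in> carrier H\<rbrakk> \<Longrightarrow> ip H (c \<odot> x) y = c * ip H x y"
    and ip_cnj: "\<lbrakk>x \<in> carrier H; y \<in> carrier H\<rbrakk> \<Longrightarrow> ip H y x = cnj (ip H x y)"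
    and ip_nonneg: "x \<in> carrier H \<Longrightarrow> 0 \<le> Re (ip H x x)"
    and ip_definite: "\<lbrakk>x \<in> carrier H; ip H x x = 0\<rbrakk> \<Longrightarrow> x = \<zero>"
    and complete: "Metric_space.mcomplete (carrier H) (hdist H)"

section \<open>Unbounded operators, represented by their graphs\<close>

type_synonym 'a operator = "('a \<times> 'a) set"

definition linear_operator :: "'a inner_space \<Rightarrow> 'a operator \<Rightarrow> bool" where
  "linear_operator H A \<longleftrightarrow>
     A \<subseteq> carrier H \<times> carrier H \<and> single_valued A \<and> (\<zero>\<^bsub>H\<^esub>, \<zero>\<^bsub>H\<^esub>) \<in> A \<and>
     (\<forall>(f, f') \<in> A. \<forall>(g, g') \<in> A. (f \<oplus>\<^bsub>H\<^esub> g, f' \<oplus>\<^bsub>H\<^esub> g') \<in> A) \<and>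
     (\<forall>c. \<forall>(f, f') \<in> A. (c \<odot>\<^bsub>H\<^esub> f, c \<odot>\<^bsub>H\<^esub> f') \<in> A)"

definition op_apply :: "'a operator \<Rightarrow> 'a \<Rightarrow> 'a" where
  "op_apply A f = (THE g. (f, g) \<in> A)"

definition densely_defined :: "'a inner_space \<Rightarrow> 'a operator \<Rightarrow> bool" where
  "densely_defined H A \<longleftrightarrow> htop H closure_of Domain A = carrier H"

definition closed_operator :: "'a inner_space \<Rightarrow> 'a operator \<Rightarrow> bool" where
  "closed_operator H A \<longleftrightarrow> closedin (prod_topology (htop H) (htop H)) A"

text \<open>The adjoint is a (single-valued) operator only for densely defined \<open>A\<close>.\<close>

definition adjoint_op :: "'a inner_space \<Rightarrow> 'a operator \<Rightarrow> 'a operator" where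
  "adjoint_op H A = {(g, h). g \<in> carrier H \<and> h \<in> carrier H \<and> (\<forall>(f, f') \<in> A. ip H f' g = ip H f h)}"

definition symmetric_op :: "'a inner_space \<Rightarrow> 'a operator \<Rightarrow> bool" where
  "symmetric_op H A \<longleftrightarrow> A \<subseteq> adjoint_op H A"

definition self_adjoint_op :: "'a inner_space \<Rightarrow> 'a operator \<Rightarrow> bool" where
  "self_adjoint_op H A \<longleftrightarrow> linear_operator H A \<and> densely_defined H A \<and> A = adjoint_op H A"

definition resolvent_set :: "'a inner_space \<Rightarrow> 'a operator \<Rightarrow> complex set" where
  "resolvent_set H A = {z.
     (\<forall>h \<in> carrier H. \<exists>!f. \<exists>g. (f, g) \<in> A \<and> g \<ominus>\<^bsub>H\<^esub> z \<odot>\<^bsub>H\<^esub> f = h) \<and>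
     (\<exists>C. \<forall>(f, g) \<in> A. hnorm H f \<le> C * hnorm H (g \<ominus>\<^bsub>H\<^esub> z \<odot>\<^bsub>H\<^esub> f))}"

text \<open>\<open>defect_space H A z\<close> is the kernel of \<open>A* - z I\<close>.\<close>

definition defect_space :: "'a inner_space \<Rightarrow> 'a operator \<Rightarrow> complex \<Rightarrow> 'a set" where
  "defect_space H A z = {f. (f, z \<odot>\<^bsub>H\<^esub> f) \<in> adjoint_op H A}"

definition one_dimensional :: "'a inner_space \<Rightarrow> 'a set \<Rightarrow> bool" where
  "one_dimensional H N \<longleftrightarrow> (\<exists>g \<in> carrier H. g \<noteq> \<zero>\<^bsub>H\<^esub> \<and> N = range (\<lambda>c. c \<odot>\<^bsub>H\<^esub> g))"

definition deficiency_indices_1_1 :: "'a inner_space \<Rightarrow> 'a operator \<Rightarrow> bool" where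
  "deficiency_indices_1_1 H A \<longleftrightarrow>
     one_dimensional H (defect_space H A \<i>) \<and> one_dimensional H (defect_space H A (- \<i>))"

definition closed_subspace :: "'a inner_space \<Rightarrow> 'a set \<Rightarrow> bool" where
  "closed_subspace H M \<longleftrightarrow> submodule M complex_field H \<and> closedin (htop H) M"

definition orth_compl :: "'a inner_space \<Rightarrow> 'a set \<Rightarrow> 'a set" where
  "orth_compl H M = {v \<in> carrier H. \<forall>u \<in> M. ip H v u = 0}"

text \<open>\<open>M\<close> reduces \<open>A\<close>: the orthogonal decomposition along \<open>M\<close> preserves the domain and \<open>A\<close>
  acts componentwise.\<close>

definition reducing_subspace :: "'a inner_space \<Rightarrow> 'a operator \<Rightarrow> 'a set \<Rightarrow> bool" where
  "reducing_subspace H A M \<longleftrightarrow> closed_subspace H M \<and>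
     (\<forall>(f, g) \<in> A. \<exists>(u, u') \<in> A \<inter> M \<times> M. \<exists>(v, v') \<in> A \<inter> orth_compl H M \<times> orth_compl H M.
        f = u \<oplus>\<^bsub>H\<^esub> v \<and> g = u' \<oplus>\<^bsub>H\<^esub> v')"

definition prime_op :: "'a inner_space \<Rightarrow> 'a operator \<Rightarrow> bool" where
  "prime_op H A \<longleftrightarrow>
     \<not> (\<exists>M. reducing_subspace H A M \<and> M \<noteq> {\<zero>\<^bsub>H\<^esub>} \<and>
           self_adjoint_op (H\<lparr>carrier := M\<rparr>) (A \<inter> M \<times> M))"

section \<open>The rigged Hilbert space\<close>

definition plus_space :: "'a inner_space \<Rightarrow> 'a operator \<Rightarrow> 'a inner_space" where
  "plus_space H A = H\<lparr>carrier := Domain (adjoint_op H A),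
     ip := (\<lambda>f g. ip H f g + ip H (op_apply (adjoint_op H A) f) (op_apply (adjoint_op H A) g))\<rparr>"

text \<open>The space \<open>H_-\<close> consists of the bounded antilinear functionals on \<open>P = H_+\<close>; the pairing
  \<open>(\<phi>, f)\<close> of \<open>\<phi>\<close> in \<open>H_-\<close> with \<open>f\<close> in \<open>H_+\<close> is \<open>\<phi> f\<close>, and \<open>(f, \<phi>)\<close> is its conjugate. Functionals are
  extensional, so that equality of functions is equality in \<open>H_-\<close>. A vector \<open>h\<close> of \<open>H\<close> is identified
  with the functional \<open>f \<mapsto> (h, f)\<close>, so that the pairing extends the inner product of \<open>H\<close>.\<close>

definition minus_space :: "'a inner_space \<Rightarrow> ('a \<Rightarrow> complex) set" where
  "minus_space P = {\<phi> \<in> extensional (carrier P).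
     (\<forall>f \<in> carrier P. \<forall>g \<in> carrier P. \<phi> (f \<oplus>\<^bsub>P\<^esub> g) = \<phi> f + \<phi> g) \<and>
     (\<forall>c. \<forall>f \<in> carrier P. \<phi> (c \<odot>\<^bsub>P\<^esub> f) = cnj c * \<phi> f) \<and>
     (\<exists>C. \<forall>f \<in> carrier P. cmod (\<phi> f) \<le> C * hnorm P f)}"

definition minus_norm :: "'a inner_space \<Rightarrow> ('a \<Rightarrow> complex) \<Rightarrow> real" where
  "minus_norm P \<phi> = (SUP f \<in> {f \<in> carrier P. hnorm P f \<le> 1}. cmod (\<phi> f))"

definition embed_minus :: "'a inner_space \<Rightarrow> 'a inner_space \<Rightarrow> 'a \<Rightarrow> ('a \<Rightarrow> complex)" where
  "embed_minus H P h = (\<lambda>f \<in> carrier P. ip H h f)"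

definition bounded_plus_minus :: "'a inner_space \<Rightarrow> ('a \<Rightarrow> 'a \<Rightarrow> complex) \<Rightarrow> bool" where
  "bounded_plus_minus P S \<longleftrightarrow>
     (\<forall>f \<in> carrier P. S f \<in> minus_space P) \<and>
     (\<forall>f \<in> carrier P. \<forall>g \<in> carrier P. \<forall>h \<in> carrier P. S (f \<oplus>\<^bsub>P\<^esub> g) h = S f h + S g h) \<and>
     (\<forall>c. \<forall>f \<in> carrier P. \<forall>h \<in> carrier P. S (c \<odot>\<^bsub>P\<^esub> f) h = c * S f h) \<and>
     (\<exists>C. \<forall>f \<in> carrier P. minus_norm P (S f) \<le> C * hnorm P f)"

text \<open>The adjoint in \<open>[H_+, H_-]\<close>, determined by \<open>(S f, g) = (f, S* g)\<close>.\<close>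

definition adj_pm :: "'a inner_space \<Rightarrow> ('a \<Rightarrow> 'a \<Rightarrow> complex) \<Rightarrow> ('a \<Rightarrow> 'a \<Rightarrow> complex)" where
  "adj_pm P S = (\<lambda>g. \<lambda>f \<in> carrier P. cnj (S f g))"

definition Re_pm :: "'a inner_space \<Rightarrow> ('a \<Rightarrow> 'a \<Rightarrow> complex) \<Rightarrow> ('a \<Rightarrow> 'a \<Rightarrow> complex)" where
  "Re_pm P S = (\<lambda>f. \<lambda>g \<in> carrier P. (S f g + adj_pm P S f g) / 2)"

definition Im_pm :: "'a inner_space \<Rightarrow> ('a \<Rightarrow> 'a \<Rightarrow> complex) \<Rightarrow> ('a \<Rightarrow> 'a \<Rightarrow> complex)" where
  "Im_pm P S = (\<lambda>f. \<lambda>g \<in> carrier P. (S f g - adj_pm P S f g) / (2 * \<i>))"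

definition quasi_kernel ::
  "'a inner_space \<Rightarrow> 'a inner_space \<Rightarrow> ('a \<Rightarrow> 'a \<Rightarrow> complex) \<Rightarrow> 'a operator" where
  "quasi_kernel H P S =
     {(f, h). f \<in> carrier P \<and> h \<in> carrier H \<and> Re_pm P S f = embed_minus H P h}"

definition extended_by ::
  "'a inner_space \<Rightarrow> 'a inner_space \<Rightarrow> 'a operator \<Rightarrow> ('a \<Rightarrow> 'a \<Rightarrow> complex) \<Rightarrow> bool" where
  "extended_by H P T S \<longleftrightarrow> (\<forall>(f, h) \<in> T. f \<in> carrier P \<and> S f = embed_minus H P h)"

section \<open>L-systems with one-dimensional input-output space and \<open>J = 1\<close>\<close>

definition admissible_symmetric :: "'a inner_space \<Rightarrow> 'a operator \<Rightarrow> bool" where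
  "admissible_symmetric H A \<longleftrightarrow>
     linear_operator H A \<and> closed_operator H A \<and> densely_defined H A \<and> symmetric_op H A \<and>
     deficiency_indices_1_1 H A"

definition admissible_main :: "'a inner_space \<Rightarrow> 'a operator \<Rightarrow> 'a operator \<Rightarrow> bool" where
  "admissible_main H A T \<longleftrightarrow>
     linear_operator H T \<and> \<not> symmetric_op H T \<and> A \<subseteq> T \<and> T \<subseteq> adjoint_op H A \<and>
     resolvent_set H T \<noteq> {} \<and> Domain A = Domain T \<inter> Domain (adjoint_op H T)"

definition star_extension ::
  "'a inner_space \<Rightarrow> 'a operator \<Rightarrow> 'a operator \<Rightarrow> ('a \<Rightarrow> 'a \<Rightarrow> complex) \<Rightarrow> bool" where
  "star_extension H A T S \<longleftrightarrow>
     (let P = plus_space H A in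
        bounded_plus_minus P S \<and>
        A \<subseteq> T \<and> extended_by H P T S \<and>
        A \<subseteq> adjoint_op H T \<and> extended_by H P (adjoint_op H T) (adj_pm P S) \<and>
        self_adjoint_op H (quasi_kernel H P S))"

definition bounded_channel :: "'a inner_space \<Rightarrow> (complex \<Rightarrow> 'a \<Rightarrow> complex) \<Rightarrow> bool" where
  "bounded_channel P K \<longleftrightarrow>
     (\<forall>c. K c \<in> minus_space P) \<and>
     (\<forall>c d. \<forall>f \<in> carrier P. K (c + d) f = K c f + K d f) \<and>
     (\<forall>c d. \<forall>f \<in> carrier P. K (c * d) f = c * K d f) \<and>
     (\<exists>C. \<forall>c. minus_norm P (K c) \<le> C * cmod c)"

text \<open>The adjoint of \<open>K\<close> maps \<open>H_+\<close> to the complex numbers and is determined by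
  \<open>(K c, f) = c * cnj (K* f)\<close>.\<close>

definition channel_adj :: "(complex \<Rightarrow> 'a \<Rightarrow> complex) \<Rightarrow> 'a \<Rightarrow> complex" where
  "channel_adj K f = cnj (K 1 f)"

locale L_system = complex_hilbert_space H
  for H :: "'a inner_space" (structure) +
  fixes A :: "'a operator" and T :: "'a operator"
    and S :: "'a \<Rightarrow> 'a \<Rightarrow> complex" and K :: "complex \<Rightarrow> 'a \<Rightarrow> complex"
  assumes symmetric_part: "admissible_symmetric H A"
    and main_op: "admissible_main H A T"
    and state_op: "star_extension H A T S"
    and channel: "bounded_channel (plus_space H A) K"
    and Im_state_op: "\<forall>f \<in> carrier (plus_space H A). Im_pm (plus_space H A) S f = K (channel_adj K f)"
    and ran_channel: "range K = Im_pm (plus_space H A) S ` carrier (plus_space H A)"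

locale minimal_L_system = L_system +
  assumes prime: "prime_op H A"

text \<open>\<open>f\<close> solves \<open>(Re S - z I) f = K 1\<close>, an equation in \<open>H_-\<close>.\<close>

definition solves_at :: "'a inner_space \<Rightarrow> 'a operator \<Rightarrow> ('a \<Rightarrow> 'a \<Rightarrow> complex) \<Rightarrow>
    (complex \<Rightarrow> 'a \<Rightarrow> complex) \<Rightarrow> complex \<Rightarrow> 'a \<Rightarrow> bool" where
  "solves_at H A S K z f \<longleftrightarrow>
     (let P = plus_space H A in
        f \<in> carrier P \<and> (\<lambda>g \<in> carrier P. Re_pm P S f g - z * embed_minus H P f g) = K 1)"

definition impedance :: "'a inner_space \<Rightarrow> 'a operator \<Rightarrow> ('a \<Rightarrow> 'a \<Rightarrow> complex) \<Rightarrow>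
    (complex \<Rightarrow> 'a \<Rightarrow> complex) \<Rightarrow> complex \<Rightarrow> complex" where
  "impedance H A S K z = channel_adj K (THE f. solves_at H A S K z f)"

text \<open>The first two conjuncts say that the impedance function is meaningful at \<open>z\<close>: \<open>z\<close> is a regular
  point of the quasi-kernel and \<open>(Re S - z I)\<close> inverse is defined on the range of \<open>K\<close>.\<close>

definition realized_by :: "(complex \<Rightarrow> complex) \<Rightarrow> 'a inner_space \<Rightarrow> 'a operator \<Rightarrow>
    ('a \<Rightarrow> 'a \<Rightarrow> complex) \<Rightarrow> (complex \<Rightarrow> 'a \<Rightarrow> complex) \<Rightarrow> bool" where
  "realized_by V H A S K \<longleftrightarrow>
     (\<forall>z. Im z \<noteq> 0 \<longrightarrow>
        z \<in> resolvent_set H (quasi_kernel H (plus_space H A) S) \<and>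
        (\<exists>!f. solves_at H A S K z f) \<and>
        V z = impedance H A S K z)"

section \<open>Von Neumann parameters\<close>

definition deficiency_vectors :: "'a inner_space \<Rightarrow> 'a operator \<Rightarrow> 'a \<Rightarrow> 'a \<Rightarrow> bool" where
  "deficiency_vectors H A gp gm \<longleftrightarrow>
     gp \<in> defect_space H A \<i> \<and> gm \<in> defect_space H A (- \<i>) \<and> hnorm H gp = 1 \<and> hnorm H gm = 1"

definition main_parameter ::
  "'a inner_space \<Rightarrow> 'a operator \<Rightarrow> 'a \<Rightarrow> 'a \<Rightarrow> complex \<Rightarrow> bool" where
  "main_parameter H T gp gm \<kappa> \<longleftrightarrow> cmod \<kappa> < 1 \<and> gp \<ominus>\<^bsub>H\<^esub> \<kappa> \<odot>\<^bsub>H\<^esub> gm \<in> Domain T"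

definition selfadjoint_parameter ::
  "'a inner_space \<Rightarrow> 'a operator \<Rightarrow> 'a operator \<Rightarrow> 'a \<Rightarrow> 'a \<Rightarrow> complex \<Rightarrow> bool" where
  "selfadjoint_parameter H A B gp gm U \<longleftrightarrow> cmod U = 1 \<and>
     Domain B = {f \<oplus>\<^bsub>H\<^esub> c \<odot>\<^bsub>H\<^esub> (gp \<oplus>\<^bsub>H\<^esub> U \<odot>\<^bsub>H\<^esub> gm) | f c. f \<in> Domain A}"

section \<open>The class of functions to be realized\<close>

text \<open>Functions are described on both open half-planes; the integral representation on the upper
  half-plane is compatible with the extension \<open>V (cnj z) = cnj (V z)\<close>.\<close>

definition class_M :: "real \<Rightarrow> real \<Rightarrow> (complex \<Rightarrow> complex) set" where
  "class_M Q \<kappa> = {V. \<exists>\<mu> :: real measure.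
     sets \<mu> = sets borel \<and> emeasure \<mu> UNIV = \<infinity> \<and>
     has_bochner_integral \<mu> (\<lambda>t. 1 / (1 + t\<^sup>2)) ((1 - \<kappa>) / (1 + \<kappa>)) \<and>
     (\<forall>z. Im z \<noteq> 0 \<longrightarrow>
        V z = of_real Q + (\<integral>t. (1 / (of_real t - z) - of_real (t / (1 + t\<^sup>2))) \<partial>\<mu>))}"

end

theory Submission
  imports Defs
begin

text \<open>The state space is \<open>L\<^sup>2(\<mu>)\<close>. Its elements \<open>f\<close> for which \<open>t f(t) - c\<close> is square-integrable for
  some constant \<open>c = \<gamma> f\<close> form \<open>H_+\<close>, with \<open>A* f = t f - c\<close>; the constant is unique because \<open>\<mu>\<close> is
  infinite. With the regularised integral \<open>\<delta> f = \<integral> (f - c t / (1 + t\<^sup>2)) d\<mu>\<close> one has the Green identity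
  \<open>(A* f, h) - (f, A* h) = \<delta> f cnj (\<gamma> h) - \<gamma> f cnj (\<delta> h)\<close>, the symmetric operator is given by
  \<open>\<gamma> = \<delta> = 0\<close>, and \<open>\<gamma> = 0\<close> is multiplication by \<open>t\<close>. Put \<open>\<chi> = \<delta> + Q \<gamma>\<close>. The state-space operator
  \<open>A* + (\<gamma> + \<i> \<chi>) \<chi>*\<close> has real part \<open>A* + \<gamma> \<chi>*\<close>, imaginary part \<open>\<chi> \<chi>*\<close>, quasi-kernel \<open>\<gamma> = 0\<close> and main
  operator \<open>\<gamma> + \<i> \<chi> = 0\<close>. Since \<open>1 / (t - z)\<close> solves \<open>(A* - z) f = 0\<close>, \<open>\<gamma> f = 1\<close>, the impedance function
  is \<open>\<chi>(1 / (t - z)) = Q + \<integral> (1 / (t - z) - t / (1 + t\<^sup>2)) d\<mu>\<close>. Evaluating the boundary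
  conditions on \<open>1 / (t \<mp> \<i>)\<close>, where \<open>\<delta> = \<plusminus> \<i> a\<close>, yields \<open>\<kappa> e^(\<i> \<theta>) = (1 + \<i> Q - a) / (1 + \<i> Q + a)\<close> and
  \<open>U = - e^(- \<i> \<theta>)\<close>; the phase \<open>\<theta>\<close> is absorbed in \<open>g_-\<close>.\<close>

section \<open>Hilbert spaces with carriers\<close>

text \<open>By the Green identity the form \<open>(A* f, h) + \<gamma> f cnj (\<chi> h)\<close> is
  Hermitian, and that identity does not change when the real multiple \<open>Q \<gamma>\<close> is
  added to \<open>\<delta>\<close>. This shift is how \<open>Q\<close> enters: it moves the
  impedance function by a constant and leaves the quasi-kernel alone. A functional made of a vector
  of \<open>H\<close> and a multiple of \<open>\<chi>*\<close> lies in \<open>H\<close> exactly when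
  the multiple vanishes, which is how the quasi-kernel and the main operator are read off. All of
  this needs only an abstract boundary triple, so analysis is confined to three points: the adjoint
  is no larger than claimed, the domain of the symmetric operator is dense although it is cut out by
  an integral condition, and a reducing subspace with a self-adjoint part is trivial. The stated
  \<open>\<kappa>\<close> is the modulus of \<open>(1 + \<i> Q - a) / (1 + \<i> Q + a)\<close> in
  disguise: \<open>b^2 + 4 Q^2\<close> is the product of \<open>(1 - a)^2 + Q^2\<close> and
  \<open>(1 + a)^2 + Q^2\<close>, and the long fraction collapses to the root of that product
  divided by the second factor.\<close>

lemma complex_field_simps [simp]:
  "carrier complex_field = UNIV" "x \<otimes>\<^bsub>complex_field\<^esub> y = x * y" "\<one>\<^bsub>complex_field\<^esub> = 1"
  "\<zero>\<^bsub>complex_field\<^esub> = 0" "x \<oplus>\<^bsub>complex_field\<^esub> y = x + y"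
  by (simp_all add: complex_field_def)

lemma cring_complex_field: "cring complex_field"
proof (rule cringI)
  show "abelian_group complex_field"
    by (rule abelian_groupI) (auto simp: algebra_simps intro: exI[of _ "- x" for x])
  show "Group.comm_monoid complex_field"
    by (rule comm_monoidI) (auto simp: algebra_simps)
qed (auto simp: algebra_simps)

text \<open>\<^locale>\<open>complex_hilbert_space\<close> without completeness, which for \<open>L\<^sup>2\<close> can only be stated
  usefully once the distance is known to be a metric.\<close>

locale pre_hilbert_space = module complex_field H
  for H :: "'a inner_space" (structure) +
  assumes ip_add: "\<lbrakk>x \<in> carrier H; y \<in> carrier H; z \<in> carrier H\<rbrakk>
      \<Longrightarrow> ip H (x \<oplus> y) z = ip H x z + ip H y z"
    and ip_smult: "\<lbrakk>x \<in> carrier H; y \<in> carrier H\<rbrakk> \<Longrightarrow> ip H (c \<odot> x) y = c * ip H x y"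
    and ip_cnj: "\<lbrakk>x \<in> carrier H; y \<in> carrier H\<rbrakk> \<Longrightarrow> ip H y x = cnj (ip H x y)"
    and ip_nonneg: "x \<in> carrier H \<Longrightarrow> 0 \<le> Re (ip H x x)"
    and ip_definite: "\<lbrakk>x \<in> carrier H; ip H x x = 0\<rbrakk> \<Longrightarrow> x = \<zero>"

sublocale complex_hilbert_space \<subseteq> pre_hilbert_space H
  by unfold_locales (fact ip_add ip_smult ip_cnj ip_nonneg ip_definite)+

context pre_hilbert_space
begin

lemma smult_carrier [simp]: "x \<in> carrier H \<Longrightarrow> c \<odot> x \<in> carrier H"
  using smult_closed[of c x] by simp

lemma ip_zero_left [simp]: "x \<in> carrier H \<Longrightarrow> ip H \<zero> x = 0"
  using ip_add[of \<zero> \<zero> x] by simp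

lemma ip_minus: "x \<in> carrier H \<Longrightarrow> y \<in> carrier H \<Longrightarrow> ip H (\<ominus> x) y = - ip H x y"
  using ip_add[of x "\<ominus> x" y] by (simp add: r_neg eq_neg_iff_add_eq_0 add.commute)

lemma ip_diff: "\<lbrakk>x \<in> carrier H; y \<in> carrier H; z \<in> carrier H\<rbrakk> \<Longrightarrow> ip H (x \<ominus> y) z = ip H x z - ip H y z"
  by (simp add: a_minus_def ip_add ip_minus)

lemma ip_add_right: "\<lbrakk>x \<in> carrier H; y \<in> carrier H; z \<in> carrier H\<rbrakk> \<Longrightarrow> ip H z (x \<oplus> y) = ip H z x + ip H z y"
  by (metis add.m_closed complex_cnj_add ip_add ip_cnj)

lemma ip_smult_right: "\<lbrakk>x \<in> carrier H; y \<in> carrier H\<rbrakk> \<Longrightarrow> ip H x (c \<odot> y) = cnj c * ip H x y"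
  by (metis smult_carrier complex_cnj_mult ip_smult ip_cnj)

lemma ip_zero_right [simp]: "x \<in> carrier H \<Longrightarrow> ip H x \<zero> = 0"
  by (metis complex_cnj_zero ip_cnj ip_zero_left zero_closed)

lemma ip_minus_right: "x \<in> carrier H \<Longrightarrow> y \<in> carrier H \<Longrightarrow> ip H x (\<ominus> y) = - ip H x y"
  using ip_add_right[of y "\<ominus> y" x] by (simp add: r_neg eq_neg_iff_add_eq_0 add.commute)

lemma ip_diff_right: "\<lbrakk>x \<in> carrier H; y \<in> carrier H; z \<in> carrier H\<rbrakk> \<Longrightarrow> ip H z (x \<ominus> y) = ip H z x - ip H z y"
  by (simp add: a_minus_def ip_add_right ip_minus_right)

lemmas ip_simps = ip_add ip_smult ip_minus ip_diff ip_add_right ip_smult_right ip_minus_right ip_diff_right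

lemma minus_eq_zero_iff:
  assumes "x \<in> carrier H" "y \<in> carrier H"
  shows "x \<ominus> y = \<zero> \<longleftrightarrow> x = y"
proof
  assume 0: "x \<ominus> y = \<zero>"
  have "x = (x \<ominus> y) \<oplus> y"
    using assms by (simp add: a_minus_def a_assoc l_neg)
  then show "x = y" using 0 assms by simp
qed (use assms in \<open>simp add: a_minus_def r_neg\<close>)

text \<open>Testing against all vectors turns a vector identity into a scalar one, which
  \<open>ip_simps\<close> and ring normalisation settle. Most vector identities below are proved
  this way.\<close>

lemma ip_ext:
  assumes "x \<in> carrier H" "y \<in> carrier H" "\<And>z. z \<in> carrier H \<Longrightarrow> ip H x z = ip H y z"
  shows "x = y"
proof -
  have "ip H (x \<ominus> y) (x \<ominus> y) = 0"
    using assms by (simp add: ip_diff)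
  then have "x \<ominus> y = \<zero>"
    using assms by (intro ip_definite) auto
  then show ?thesis
    using assms minus_eq_zero_iff by blast
qed

lemma ip_self: "x \<in> carrier H \<Longrightarrow> ip H x x = of_real ((hnorm H x)\<^sup>2)"
  using ip_cnj[of x x] ip_nonneg[of x]
  by (simp add: hnorm_def complex_eq_iff)

lemma hnorm_nonneg [simp]: "x \<in> carrier H \<Longrightarrow> 0 \<le> hnorm H x"
  by (simp add: hnorm_def ip_nonneg)

lemma hnorm_eq_0_iff: "x \<in> carrier H \<Longrightarrow> hnorm H x = 0 \<longleftrightarrow> x = \<zero>"
  using ip_self[of x] ip_definite[of x] by (auto simp: hnorm_def)

lemma hnorm_zero [simp]: "hnorm H \<zero> = 0"
  by (simp add: hnorm_def)

lemma hnorm_smult: "x \<in> carrier H \<Longrightarrow> hnorm H (c \<odot> x) = cmod c * hnorm H x"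
proof -
  assume x: "x \<in> carrier H"
  have sq: "complex_of_real ((hnorm H z)\<^sup>2) = ip H z z" if "z \<in> carrier H" for z
    using ip_self[OF that] by simp
  have "complex_of_real ((hnorm H (c \<odot> x))\<^sup>2) = (c * cnj c) * ip H x x"
    using x by (simp only: sq smult_carrier ip_simps mult_ac)
  also have "\<dots> = of_real ((cmod c * hnorm H x)\<^sup>2)"
    using x by (simp only: sq[symmetric] complex_norm_square[symmetric] power_mult_distrib of_real_mult)
  finally have "(hnorm H (c \<odot> x))\<^sup>2 = (cmod c * hnorm H x)\<^sup>2"
    using of_real_eq_iff by blast
  then show ?thesis
    using x by (simp add: power2_eq_iff_nonneg)
qed

lemma Cauchy_Schwarz:
  assumes x: "x \<in> carrier H" and y: "y \<in> carrier H"
  shows "cmod (ip H x y) \<le> hnorm H x * hnorm H y"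
proof (cases "hnorm H y = 0")
  case True
  then show ?thesis using assms by (simp add: hnorm_eq_0_iff)
next
  case False
  define r where "r = (hnorm H y)\<^sup>2"
  have r: "r > 0" using False by (simp add: r_def)
  define p where "p = ip H x y"
  have yy: "ip H y y = of_real r" using y by (simp add: ip_self r_def)
  have yx: "ip H y x = cnj p" using x y ip_cnj unfolding p_def by blast
  \<comment> \<open>The vector is \<open>r\<close> times the component of \<open>x\<close>
    orthogonal to \<open>y\<close>; scaling by \<open>r\<close> avoids a division.\<close>
  have "0 \<le> Re (ip H (of_real r \<odot> x \<ominus> p \<odot> y) (of_real r \<odot> x \<ominus> p \<odot> y))"
    using x y by (intro ip_nonneg) auto
  also have "ip H (of_real r \<odot> x \<ominus> p \<odot> y) (of_real r \<odot> x \<ominus> p \<odot> y)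
      = of_real r * (of_real r * of_real ((hnorm H x)\<^sup>2) - p * cnj p)"
    using x y by (simp add: ip_simps yy yx p_def[symmetric] ip_self[OF x] algebra_simps)
  also have "\<dots> = of_real (r * (r * (hnorm H x)\<^sup>2 - (cmod p)\<^sup>2))"
    by (simp add: complex_norm_square[symmetric])
  finally have "(cmod p)\<^sup>2 \<le> (hnorm H x * hnorm H y)\<^sup>2"
    using r by (simp add: zero_le_mult_iff r_def power_mult_distrib mult_ac)
  then show ?thesis
    using x y unfolding p_def by (meson hnorm_nonneg mult_nonneg_nonneg power2_le_imp_le)
qed

lemma hnorm_add_sq:
  assumes "x \<in> carrier H" "y \<in> carrier H"
  shows "(hnorm H (x \<oplus> y))\<^sup>2 = (hnorm H x)\<^sup>2 + 2 * Re (ip H x y) + (hnorm H y)\<^sup>2"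
proof -
  have sq: "(hnorm H z)\<^sup>2 = Re (ip H z z)" if "z \<in> carrier H" for z
    using ip_self[OF that] by simp
  have "Re (ip H y x) = Re (ip H x y)"
    using assms ip_cnj[of x y] by simp
  then show ?thesis
    using assms by (simp add: sq ip_simps)
qed

lemma hnorm_triangle:
  assumes "x \<in> carrier H" "y \<in> carrier H"
  shows "hnorm H (x \<oplus> y) \<le> hnorm H x + hnorm H y"
proof (rule power2_le_imp_le)
  have "Re (ip H x y) \<le> hnorm H x * hnorm H y"
    using Cauchy_Schwarz[OF assms] complex_Re_le_cmod order_trans by blast
  then show "(hnorm H (x \<oplus> y))\<^sup>2 \<le> (hnorm H x + hnorm H y)\<^sup>2"
    using assms by (simp add: hnorm_add_sq power2_sum)
qed (use assms in simp)

lemma minus_eq_smult: "x \<in> carrier H \<Longrightarrow> \<ominus> x = (-1) \<odot> x"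
  by (rule ip_ext) (simp_all add: ip_simps)

lemma hdist_triangle:
  assumes "x \<in> carrier H" "y \<in> carrier H" "z \<in> carrier H"
  shows "hdist H x z \<le> hdist H x y + hdist H y z"
proof -
  have "x \<ominus> z = (x \<ominus> y) \<oplus> (y \<ominus> z)"
    using assms by (intro ip_ext) (simp_all add: ip_simps)
  then show ?thesis
    using assms by (simp add: hdist_def hnorm_triangle)
qed

lemma hdist_eq_0_iff: "x \<in> carrier H \<Longrightarrow> y \<in> carrier H \<Longrightarrow> hdist H x y = 0 \<longleftrightarrow> x = y"
  by (simp add: hdist_def hnorm_eq_0_iff minus_eq_zero_iff)

end

text \<open>The library facts about \<open>Metric_space.mtopology\<close> need a distance that is symmetric and
  nonnegative on the whole type, which \<^const>\<open>hdist\<close> is not automatically off the carrier.\<close>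

locale hilbert_metric_space = complex_hilbert_space H + Metric_space "carrier H" "hdist H"
  for H :: "'a inner_space" (structure)
begin

lemma htop_eq: "htop H = mtopology"
  by (simp add: htop_def)

lemma dense_approx:
  assumes "htop H closure_of D = carrier H" "x \<in> carrier H" "0 < e"
  shows "\<exists>y \<in> D. y \<in> carrier H \<and> hdist H x y < e"
  using assms by (auto simp: htop_eq metric_closure_of)

lemma dense_orth_zero:
  assumes D: "htop H closure_of D = carrier H" and x: "x \<in> carrier H"
    and orth: "\<And>y. y \<in> D \<Longrightarrow> y \<in> carrier H \<Longrightarrow> ip H x y = 0"
  shows "x = \<zero>"
proof (rule ccontr)
  assume "x \<noteq> \<zero>"
  then have pos: "hnorm H x > 0"
    using x hnorm_eq_0_iff[of x] hnorm_nonneg[of x] by linarith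
  then obtain y where y: "y \<in> D" "y \<in> carrier H" "hdist H x y < hnorm H x"
    using dense_approx[OF D x] by blast
  have "(hnorm H x)\<^sup>2 = cmod (ip H x (x \<ominus> y))"
    using x y orth[of y] by (simp add: ip_simps ip_self norm_power)
  also have "\<dots> \<le> hnorm H x * hnorm H (x \<ominus> y)"
    using x y by (intro Cauchy_Schwarz) auto
  also have "\<dots> < hnorm H x * hnorm H x"
    using y pos by (simp add: hdist_def)
  finally show False by (simp add: power2_eq_square)
qed

lemma continuous_map_ip:
  assumes x: "x \<in> carrier H"
  shows "continuous_map (htop H) euclidean (ip H x)"
proof -
  have "\<exists>d>0. \<forall>z. z \<in> carrier H \<and> hdist H y z < d \<longrightarrow> dist (ip H x y) (ip H x z) < e"
    if y: "y \<in> carrier H" and e: "e > 0" for y e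
  proof (intro exI conjI allI impI)
    \<comment> \<open>The summand 1 covers the case \<open>x = 0\<close>.\<close>
    show "e / (hnorm H x + 1) > 0"
      using x e by (simp add: add_nonneg_pos)
    fix z assume z: "z \<in> carrier H \<and> hdist H y z < e / (hnorm H x + 1)"
    have "dist (ip H x y) (ip H x z) = cmod (ip H x (y \<ominus> z))"
      using x y z by (simp add: ip_simps dist_norm)
    also have "\<dots> \<le> hnorm H x * hdist H y z"
      using x y z unfolding hdist_def by (intro Cauchy_Schwarz) auto
    also have "\<dots> \<le> (hnorm H x + 1) * hdist H y z"
      using y z by (intro mult_right_mono) (auto simp: hdist_def)
    also have "\<dots> < e"
      using z x hnorm_nonneg[OF x] by (simp add: field_simps add_nonneg_pos)
    finally show "dist (ip H x y) (ip H x z) < e" .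
  qed
  then have "continuous_map mtopology Met_TC.mtopology (ip H x)"
    by (subst metric_continuous_map) (auto simp: Met_TC.Metric_space_axioms)
  then show ?thesis
    by (simp add: htop_eq)
qed

lemma topspace_htop [simp]: "topspace (htop H) = carrier H"
  by (simp add: htop_eq)

text \<open>Each pair in \<open>X\<close> contributes the set where two continuous functions on the
  product agree, and the adjoint is the intersection of these closed sets.\<close>

lemma closed_adjoint:
  assumes "X \<subseteq> carrier H \<times> carrier H"
  shows "closed_operator H (adjoint_op H X)"
proof -
  let ?P = "prod_topology (htop H) (htop H)"
  let ?F = "\<lambda>p. {q \<in> topspace ?P. (ip H (snd p) \<circ> fst) q = (ip H (fst p) \<circ> snd) q}"
  have "closedin ?P (?F p)" if "p \<in> X" for p
  proof -
    have "snd p \<in> carrier H" "fst p \<in> carrier H"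
      using that assms by auto
    then show ?thesis
      by (intro closedin_continuous_maps_eq[OF Hausdorff_space_euclidean]
          continuous_map_compose[OF _ continuous_map_ip] continuous_map_fst continuous_map_snd)
  qed
  \<comment> \<open>The whole space joins the family so that the intersection is not an empty one
    when \<open>X\<close> is empty.\<close>
  then have "closedin ?P (\<Inter> (insert (topspace ?P) (?F ` X)))"
    using closedin_topspace[of ?P] by (intro closedin_Inter) blast+
  also have "\<Inter> (insert (topspace ?P) (?F ` X)) = adjoint_op H X"
    by (fastforce simp: adjoint_op_def)
  finally show ?thesis
    by (simp add: closed_operator_def)
qed

lemma orth_compl_carrier: "v \<in> orth_compl H M \<Longrightarrow> v \<in> carrier H"
  by (simp add: orth_compl_def)

lemma closed_subspaceD:
  assumes "closed_subspace H M"
  shows "M \<subseteq> carrier H" "\<zero> \<in> M" "\<lbrakk>x \<in> M; y \<in> M\<rbrakk> \<Longrightarrow> x \<oplus> y \<in> M" "x \<in> M \<Longrightarrow> c \<odot> x \<in> M"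
    "\<lbrakk>x \<in> M; y \<in> M\<rbrakk> \<Longrightarrow> x \<ominus> y \<in> M"
proof -
  interpret M: submodule M complex_field H
    using assms by (simp add: closed_subspace_def)
  show "M \<subseteq> carrier H" "\<zero> \<in> M" "\<lbrakk>x \<in> M; y \<in> M\<rbrakk> \<Longrightarrow> x \<oplus> y \<in> M" "x \<in> M \<Longrightarrow> c \<odot> x \<in> M"
    using M.subset M.one_closed M.m_closed M.smult_closed[of c x] by auto
  show "\<lbrakk>x \<in> M; y \<in> M\<rbrakk> \<Longrightarrow> x \<ominus> y \<in> M"
    using M.m_inv_closed[of y] M.m_closed by (simp add: a_minus_def a_inv_def)
qed

text \<open>The orthogonal sum of \<open>M\<close> and its complement is closed, so it suffices that it is dense.\<close>

lemma orthogonal_decomposition: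
  assumes M: "closed_subspace H M" and D: "htop H closure_of D = carrier H"
    and split: "\<And>f. f \<in> D \<Longrightarrow> \<exists>u\<in>M. \<exists>v\<in>orth_compl H M. f = u \<oplus> v"
    and w: "w \<in> carrier H"
  obtains u where "u \<in> M" "w \<ominus> u \<in> orth_compl H M"
proof -
  note MD = closed_subspaceD[OF M]
  have "\<forall>n. \<exists>f. f \<in> D \<and> f \<in> carrier H \<and> hdist H w f < inverse (Suc n)"
    using dense_approx[OF D w, of "inverse (Suc n)" for n] by auto
  then obtain f where f: "\<And>n. f n \<in> D" "\<And>n. f n \<in> carrier H" "\<And>n. hdist H w (f n) < inverse (Suc n)"
    by metis
  obtain u v where uv: "\<And>n. u n \<in> M" "\<And>n. v n \<in> orth_compl H M" "\<And>n. f n = u n \<oplus> v n"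
    using split[OF f(1)] by metis
  have uc: "u n \<in> carrier H" and vc: "v n \<in> carrier H" for n
    using uv MD(1) orth_compl_carrier by blast+
  have flim: "(\<lambda>n. hdist H (f n) w) \<longlonglongrightarrow> 0"
  proof (rule tendsto_sandwich[OF _ _ tendsto_const LIMSEQ_inverse_real_of_nat])
    show "\<forall>\<^sub>F n in sequentially. hdist H (f n) w \<le> inverse (real (Suc n))"
      using f(3) by (intro always_eventually) (metis commute less_imp_le)
  qed simp
  then have "limitin mtopology f w sequentially"
    using w f(2) by (simp add: limitin_metric_dist_null)
  then have fC: "MCauchy f"
    using f(2) by (intro convergent_imp_MCauchy) auto
  \<comment> \<open>Pythagoras: the components in \<open>M\<close> are no further apart than the
    vectors themselves, so \<open>u\<close> inherits the Cauchy property from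
    \<open>f\<close>.\<close>
  have le: "hdist H (u n) (u m) \<le> hdist H (f n) (f m)" for n m
  proof (rule power2_le_imp_le)
    have "ip H (v n) (u k) = 0" for n k
      using uv by (simp add: orth_compl_def)
    then have "ip H (u k) (v n) = 0" for n k
      using uc vc ip_cnj[of "v n" "u k"] by simp
    then have "ip H (u n \<ominus> u m) (v n \<ominus> v m) = 0"
      using uc vc by (simp add: ip_simps)
    moreover have "f n \<ominus> f m = (u n \<ominus> u m) \<oplus> (v n \<ominus> v m)"
      using uc vc by (intro ip_ext) (simp_all add: uv(3) ip_simps)
    ultimately show "(hdist H (u n) (u m))\<^sup>2 \<le> (hdist H (f n) (f m))\<^sup>2"
      using uc vc by (simp add: hdist_def hnorm_add_sq)
  qed simp
  have "MCauchy u"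
    using fC le uc unfolding MCauchy_def by (auto intro: le_less_trans) (meson le le_less_trans)
  then obtain y where y: "limitin mtopology u y sequentially"
    using complete unfolding mcomplete_def by blast
  then have yM: "y \<in> M"
    using M uv(1) unfolding closed_subspace_def htop_eq metric_closedin_iff_sequentially_closed
    by (meson image_subsetI)
  then have yc: "y \<in> carrier H" using MD(1) by blast
  have ulim: "(\<lambda>n. hdist H (u n) y) \<longlonglongrightarrow> 0"
    using y by (simp add: limitin_metric_dist_null)
  have "ip H (w \<ominus> y) m = 0" if m: "m \<in> M" for m
  proof -
    have mc: "m \<in> carrier H" using m MD(1) by blast
    \<comment> \<open>As \<open>v n\<close> is orthogonal to \<open>m\<close>, only the errors of
      \<open>f n\<close> against \<open>w\<close> and of \<open>u n\<close> against \<open>y\<close>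
      remain, and both tend to 0.\<close>
    have "cmod (ip H (w \<ominus> y) m) \<le> (hdist H (f n) w + hdist H (u n) y) * hnorm H m" for n
    proof -
      have "ip H (v n) m = 0"
        using uv(2) m by (simp add: orth_compl_def)
      then have "ip H (w \<ominus> y) m = ip H (u n \<ominus> y) m - ip H (f n \<ominus> w) m"
        using w yc uc vc f(2) mc by (simp add: uv(3) ip_simps)
      also have "cmod \<dots> \<le> hdist H (u n) y * hnorm H m + hdist H (f n) w * hnorm H m"
        using w yc uc f(2) mc unfolding hdist_def
        by (intro order_trans[OF norm_triangle_ineq4] add_mono Cauchy_Schwarz) auto
      finally show ?thesis by (simp add: algebra_simps)
    qed
    moreover have "(\<lambda>n. (hdist H (f n) w + hdist H (u n) y) * hnorm H m) \<longlonglongrightarrow> (0 + 0) * hnorm H m"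
      by (intro tendsto_intros flim ulim)
    ultimately have "cmod (ip H (w \<ominus> y) m) \<le> (0 + 0) * hnorm H m"
      by (intro LIMSEQ_le_const) auto
    then show ?thesis by simp
  qed
  then show ?thesis
    using that[OF yM] w yc by (simp add: orth_compl_def)
qed

end

section \<open>Boundary triples and L-systems\<close>

lemma adjoint_opD: "(g, h) \<in> adjoint_op H X \<Longrightarrow> (f, f') \<in> X \<Longrightarrow> ip H f' g = ip H f h"
  by (auto simp: adjoint_op_def)

lemma adjoint_op_carrier: "(g, h) \<in> adjoint_op H X \<Longrightarrow> g \<in> carrier H \<and> h \<in> carrier H"
  by (simp add: adjoint_op_def)

lemma adjoint_opI:
  "\<lbrakk>g \<in> carrier H; h \<in> carrier H; \<And>f f'. (f, f') \<in> X \<Longrightarrow> ip H f' g = ip H f h\<rbrakk> \<Longrightarrow> (g, h) \<in> adjoint_op H X"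
  by (auto simp: adjoint_op_def)

text \<open>The classical boundary triple of a symmetric operator with one-dimensional boundary
  space. Everything about the state-space operator and the channel is derived from these properties;
  bounds refer to the graph norm, that is the norm of \<open>H_+\<close>.\<close>

locale boundary_triple = hilbert_metric_space H
  for H :: "'a inner_space" (structure) +
  fixes A :: "'a operator" and \<gamma> \<delta> :: "'a \<Rightarrow> complex"
  assumes linear: "linear_operator H A"
    and dense: "densely_defined H A"
    and \<gamma>_add: "\<lbrakk>f \<in> Domain (adjoint_op H A); g \<in> Domain (adjoint_op H A)\<rbrakk> \<Longrightarrow> \<gamma> (f \<oplus> g) = \<gamma> f + \<gamma> g"
    and \<delta>_add: "\<lbrakk>f \<in> Domain (adjoint_op H A); g \<in> Domain (adjoint_op H A)\<rbrakk> \<Longrightarrow> \<delta> (f \<oplus> g) = \<delta> f + \<delta> g"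
    and \<gamma>_smult: "f \<in> Domain (adjoint_op H A) \<Longrightarrow> \<gamma> (c \<odot> f) = c * \<gamma> f"
    and \<delta>_smult: "f \<in> Domain (adjoint_op H A) \<Longrightarrow> \<delta> (c \<odot> f) = c * \<delta> f"
    and green: "\<lbrakk>(f, f') \<in> adjoint_op H A; (g, g') \<in> adjoint_op H A\<rbrakk> \<Longrightarrow>
      ip H f' g - ip H f g' = \<delta> f * cnj (\<gamma> g) - \<gamma> f * cnj (\<delta> g)"
    and surj: "\<exists>f \<in> Domain (adjoint_op H A). \<gamma> f = p \<and> \<delta> f = q"
    and kernel: "A = {(f, f') \<in> adjoint_op H A. \<gamma> f = 0 \<and> \<delta> f = 0}"
    and \<gamma>_bounded: "\<exists>C. \<forall>f \<in> Domain (adjoint_op H A). cmod (\<gamma> f) \<le> C * hnorm (plus_space H A) f"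
    and \<delta>_bounded: "\<exists>C. \<forall>f \<in> Domain (adjoint_op H A). cmod (\<delta> f) \<le> C * hnorm (plus_space H A) f"
begin

abbreviation Amax where "Amax \<equiv> adjoint_op H A"

definition D where "D = Domain Amax"

lemma dom_Amax [simp]: "Domain Amax = D"
  by (simp add: D_def)

lemmas \<gamma>add = \<gamma>_add[folded D_def] and \<delta>add = \<delta>_add[folded D_def]
  and \<gamma>smult = \<gamma>_smult[folded D_def] and \<delta>smult = \<delta>_smult[folded D_def]
  and surjD = surj[folded D_def]

abbreviation P where "P \<equiv> plus_space H A"

abbreviation ast :: "'a \<Rightarrow> 'a" where "ast \<equiv> op_apply Amax"

lemma Amax_carrier: "(f, f') \<in> Amax \<Longrightarrow> f \<in> carrier H \<and> f' \<in> carrier H"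
  by (simp add: adjoint_op_def)

lemma dom_carrier: "f \<in> D \<Longrightarrow> f \<in> carrier H"
  using Amax_carrier by (auto simp: D_def simp del: dom_Amax)

lemma A_carrier: "(f, f') \<in> A \<Longrightarrow> f \<in> carrier H \<and> f' \<in> carrier H"
  using linear by (auto simp: linear_operator_def)

lemma A_sub: "A \<subseteq> Amax"
  by (subst kernel) blast

lemma orth_zero:
  assumes "x \<in> carrier H" "\<And>y. y \<in> Domain A \<Longrightarrow> ip H x y = 0"
  shows "x = \<zero>"
  using dense_orth_zero[of "Domain A" x] dense assms by (simp add: densely_defined_def)

lemma orth_eq:
  assumes "x \<in> carrier H" "x' \<in> carrier H" "\<And>y. y \<in> Domain A \<Longrightarrow> ip H x y = ip H x' y"
  shows "x = x'"
proof -
  have "x \<ominus> x' = \<zero>"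
  proof (rule orth_zero)
    fix y assume "y \<in> Domain A"
    then have "y \<in> carrier H" "ip H x y = ip H x' y"
      using assms A_carrier by blast+
    then show "ip H (x \<ominus> x') y = 0"
      using assms by (simp add: ip_simps)
  qed (use assms in simp)
  then show ?thesis using assms minus_eq_zero_iff by blast
qed

lemma Amax_unique:
  assumes "(f, g) \<in> Amax" "(f, h) \<in> Amax"
  shows "g = h"
proof (rule orth_eq)
  fix y assume "y \<in> Domain A"
  then obtain y' where y: "(y, y') \<in> A" by blast
  have "ip H y g = ip H y h"
    using adjoint_opD[OF assms(1) y] adjoint_opD[OF assms(2) y] by simp
  then show "ip H g y = ip H h y"
    using assms y A_carrier[OF y] Amax_carrier[OF assms(1)] Amax_carrier[OF assms(2)]
      ip_cnj[of y g] ip_cnj[of y h] by simp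
qed (use assms Amax_carrier in blast)+

lemma ast_eq: "(f, g) \<in> Amax \<Longrightarrow> ast f = g"
  unfolding op_apply_def using Amax_unique by blast

lemma ast_Amax: "f \<in> D \<Longrightarrow> (f, ast f) \<in> Amax"
  using ast_eq by (auto simp: D_def simp del: dom_Amax)

lemma ast_carrier [simp]: "f \<in> D \<Longrightarrow> ast f \<in> carrier H"
  using ast_Amax Amax_carrier by blast

lemma Amax_iff: "(f, g) \<in> Amax \<longleftrightarrow> f \<in> D \<and> g = ast f"
  using ast_Amax ast_eq by (auto simp: D_def simp del: dom_Amax)

lemma A_iff: "(f, g) \<in> A \<longleftrightarrow> f \<in> D \<and> g = ast f \<and> \<gamma> f = 0 \<and> \<delta> f = 0"
  by (subst kernel) (auto simp: Amax_iff)

lemma Amax_add: "(f, f') \<in> Amax \<Longrightarrow> (g, g') \<in> Amax \<Longrightarrow> (f \<oplus> g, f' \<oplus> g') \<in> Amax"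
  using A_carrier Amax_carrier by (auto intro!: adjoint_opI simp: adjoint_opD ip_simps)

lemma Amax_smult: "(f, f') \<in> Amax \<Longrightarrow> (c \<odot> f, c \<odot> f') \<in> Amax"
  using A_carrier Amax_carrier by (auto intro!: adjoint_opI simp: adjoint_opD ip_simps)

lemma dom_add [simp]: "f \<in> D \<Longrightarrow> g \<in> D \<Longrightarrow> f \<oplus> g \<in> D"
  and ast_add: "f \<in> D \<Longrightarrow> g \<in> D \<Longrightarrow> ast (f \<oplus> g) = ast f \<oplus> ast g"
  using Amax_add[OF ast_Amax ast_Amax, of f g] ast_eq by (auto simp: D_def simp del: dom_Amax)

lemma dom_smult [simp]: "f \<in> D \<Longrightarrow> c \<odot> f \<in> D"
  and ast_smult: "f \<in> D \<Longrightarrow> ast (c \<odot> f) = c \<odot> ast f"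
  using Amax_smult[OF ast_Amax, of f c] ast_eq by (auto simp: D_def simp del: dom_Amax)

lemma dom_diff [simp]: "f \<in> D \<Longrightarrow> g \<in> D \<Longrightarrow> f \<ominus> g \<in> D"
  by (simp add: a_minus_def minus_eq_smult dom_carrier)

lemma ast_diff: "f \<in> D \<Longrightarrow> g \<in> D \<Longrightarrow> ast (f \<ominus> g) = ast f \<ominus> ast g"
  by (simp add: a_minus_def minus_eq_smult dom_carrier ast_add ast_smult)

lemma \<gamma>_diff: "f \<in> D \<Longrightarrow> g \<in> D \<Longrightarrow> \<gamma> (f \<ominus> g) = \<gamma> f - \<gamma> g"
  by (simp add: a_minus_def minus_eq_smult dom_carrier \<gamma>add \<gamma>smult)

lemma \<delta>_diff: "f \<in> D \<Longrightarrow> g \<in> D \<Longrightarrow> \<delta> (f \<ominus> g) = \<delta> f - \<delta> g"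
  by (simp add: a_minus_def minus_eq_smult dom_carrier \<delta>add \<delta>smult)

lemma green':
  "f \<in> D \<Longrightarrow> g \<in> D \<Longrightarrow>
    ip H (ast f) g - ip H f (ast g) = \<delta> f * cnj (\<gamma> g) - \<gamma> f * cnj (\<delta> g)"
  using green ast_Amax by blast

lemma dom_zero [simp]: "\<zero> \<in> D"
proof -
  obtain f where f: "f \<in> D" using surjD by blast
  then have "0 \<odot> f = \<zero>"
    by (intro ip_ext) (simp_all add: dom_carrier ip_simps)
  then show ?thesis using dom_smult[OF f, of 0] by simp
qed

lemma boundary_zero [simp]: "\<gamma> \<zero> = 0" "\<delta> \<zero> = 0"
  using \<gamma>add[of \<zero> \<zero>] \<delta>add[of \<zero> \<zero>] by simp_all

lemma ast_zero: "ast \<zero> = \<zero>"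
  using ast_add[of \<zero> \<zero>] ast_carrier[of \<zero>] by simp

lemma dom_A: "Domain A = {f \<in> D. \<gamma> f = 0 \<and> \<delta> f = 0}"
  by (auto simp: A_iff)

text \<open>One family contains the quasi-kernel (\<open>p = 1\<close>, \<open>q = 0\<close>), the
  main operator and its adjoint, so that linearity, density, adjoints and regular points are treated
  once for all three.\<close>

definition extension :: "complex \<Rightarrow> complex \<Rightarrow> 'a operator" where
  "extension p q = {(f, f') \<in> Amax. p * \<gamma> f + q * \<delta> f = 0}"

lemma extension_iff:
  "(f, g) \<in> extension p q \<longleftrightarrow> f \<in> D \<and> g = ast f \<and> p * \<gamma> f + q * \<delta> f = 0"
  by (auto simp: extension_def Amax_iff)

lemma A_sub_extension: "A \<subseteq> extension p q"
  by (auto simp: extension_iff A_iff)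

lemma extension_sub: "extension p q \<subseteq> Amax"
  by (auto simp: extension_def)

lemma linear_extension: "linear_operator H (extension p q)"
  unfolding linear_operator_def
proof (intro conjI)
  show "single_valued (extension p q)"
    by (auto simp: single_valued_def extension_iff)
  show "extension p q \<subseteq> carrier H \<times> carrier H"
    by (auto simp: extension_iff dom_carrier)
  show "(\<zero>, \<zero>) \<in> extension p q"
    by (simp add: extension_iff ast_zero)
  have "p * \<gamma> (f \<oplus> g) + q * \<delta> (f \<oplus> g) = (p * \<gamma> f + q * \<delta> f) + (p * \<gamma> g + q * \<delta> g)"
    if "f \<in> D" "g \<in> D" for f g
    using that by (simp add: \<gamma>add \<delta>add algebra_simps)
  then show "\<forall>(f, f')\<in>extension p q. \<forall>(g, g')\<in>extension p q. (f \<oplus> g, f' \<oplus> g') \<in> extension p q"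
    by (auto simp: extension_iff ast_add)
  have "p * \<gamma> (c \<odot> f) + q * \<delta> (c \<odot> f) = c * (p * \<gamma> f + q * \<delta> f)"
    if "f \<in> D" for f c
    using that by (simp add: \<gamma>smult \<delta>smult algebra_simps)
  then show "\<forall>c. \<forall>(f, f')\<in>extension p q. (c \<odot> f, c \<odot> f') \<in> extension p q"
    by (auto simp: extension_iff ast_smult)
qed

lemma adjoint_extension_sub: "adjoint_op H (extension p q) \<subseteq> Amax"
  using A_sub_extension[of p q] by (auto intro!: adjoint_opI dest: adjoint_opD adjoint_op_carrier)

text \<open>The admissible boundary values form the line spanned by \<open>(q, -p)\<close>. The
  Green form is nondegenerate on pairs of boundary values, so the annihilator of a line is again a
  line, given by the conjugate condition.\<close>

lemma adjoint_extension:
  assumes "p \<noteq> 0 \<or> q \<noteq> 0"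
  shows "adjoint_op H (extension p q) = extension (cnj p) (cnj q)"
proof (intro equalityI subrelI)
  fix g g' assume g: "(g, g') \<in> adjoint_op H (extension p q)"
  then have gm: "g \<in> D" "g' = ast g"
    using adjoint_extension_sub Amax_iff by blast+
  \<comment> \<open>These boundary values span the solutions of the condition, so testing with this
    single \<open>f\<close> suffices.\<close>
  obtain f where f: "f \<in> D" "\<gamma> f = q" "\<delta> f = - p"
    using surjD by blast
  have "(f, ast f) \<in> extension p q"
    using f by (simp add: extension_iff)
  then have "ip H (ast f) g = ip H f (ast g)"
    using adjoint_opD[OF g] gm by blast
  then have "cnj (cnj p * \<gamma> g + cnj q * \<delta> g) = cnj 0"
    using green'[OF f(1) gm(1)] f by (simp add: algebra_simps)
  then show "(g, g') \<in> extension (cnj p) (cnj q)"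
    using gm unfolding extension_iff complex_cnj_cancel_iff by blast
next
  fix g g' assume g: "(g, g') \<in> extension (cnj p) (cnj q)"
  then have gm: "g \<in> D" "g' = ast g" and "cnj (cnj p * \<gamma> g + cnj q * \<delta> g) = cnj 0"
    unfolding extension_iff complex_cnj_cancel_iff by auto
  then have eq: "p * cnj (\<gamma> g) + q * cnj (\<delta> g) = 0" by simp
  have "ip H (ast f) g = ip H f (ast g)" if f: "f \<in> D" "p * \<gamma> f + q * \<delta> f = 0" for f
  proof -
    \<comment> \<open>Both \<open>p\<close> and \<open>q\<close> times the Green form are
      combinations of the two boundary conditions; one of the factors can be cancelled.\<close>
    have "p * (\<delta> f * cnj (\<gamma> g) - \<gamma> f * cnj (\<delta> g)) = \<delta> f * (p * cnj (\<gamma> g) + q * cnj (\<delta> g)) - cnj (\<delta> g) * (p * \<gamma> f + q * \<delta> f)"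
      "q * (\<delta> f * cnj (\<gamma> g) - \<gamma> f * cnj (\<delta> g)) = cnj (\<gamma> g) * (p * \<gamma> f + q * \<delta> f) - \<gamma> f * (p * cnj (\<gamma> g) + q * cnj (\<delta> g))"
      by (simp_all add: algebra_simps)
    then have "\<delta> f * cnj (\<gamma> g) - \<gamma> f * cnj (\<delta> g) = 0"
      using eq f assms by auto
    then show ?thesis
      using green'[OF f(1) gm(1)] by simp
  qed
  then show "(g, g') \<in> adjoint_op H (extension p q)"
    using gm dom_carrier by (auto intro!: adjoint_opI simp: extension_iff)
qed

text \<open>Serves to show that \<open>A\<close> is closed, since every adjoint is.\<close>

lemma A_eq_adjoint: "A = adjoint_op H Amax"
proof (intro equalityI subrelI)
  fix g g' assume g: "(g, g') \<in> adjoint_op H Amax"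
  then have gm: "(g, g') \<in> Amax"
    using A_sub by (auto intro!: adjoint_opI dest: adjoint_opD adjoint_op_carrier)
  have eq: "\<delta> f * cnj (\<gamma> g) - \<gamma> f * cnj (\<delta> g) = 0" if "f \<in> D" for f
    using green'[OF that, of g] adjoint_opD[OF g ast_Amax[OF that]] gm by (simp add: Amax_iff)
  \<comment> \<open>Test vectors with boundary values \<open>(0, 1)\<close> and
    \<open>(1, 0)\<close> isolate the two boundary values of \<open>g\<close>.\<close>
  have "\<gamma> g = 0" "\<delta> g = 0"
    using surjD[of 0 1] surjD[of 1 0] eq by force+
  then show "(g, g') \<in> A"
    using gm by (simp add: A_iff Amax_iff)
next
  fix g g' assume "(g, g') \<in> A"
  then have g: "g \<in> D" "g' = ast g" "\<gamma> g = 0" "\<delta> g = 0"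
    by (auto simp: A_iff)
  have "ip H (ast f) g = ip H f (ast g)" if "f \<in> D" for f
    using green'[OF that g(1)] g by simp
  then show "(g, g') \<in> adjoint_op H Amax"
    using g dom_carrier by (auto intro!: adjoint_opI simp: Amax_iff)
qed

lemma dense_extension: "densely_defined H (extension p q)"
proof -
  have "htop H closure_of Domain A \<subseteq> htop H closure_of Domain (extension p q)"
    using A_sub_extension by (intro closure_of_mono) blast
  then show ?thesis
    using dense closure_of_subset_topspace[of "htop H" "Domain (extension p q)"]
    unfolding densely_defined_def by simp
qed

lemma self_adjoint_extension: "self_adjoint_op H (extension 1 0)"
  using linear_extension dense_extension adjoint_extension[of 1 0]
  by (simp add: self_adjoint_op_def)

section \<open>The graph norm on \<open>H_+\<close>\<close>

lemma P_carrier [simp]: "carrier P = D"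
  and P_add [simp]: "add P = add H"
  and P_smult [simp]: "smult P = smult H"
  by (simp_all add: plus_space_def)

lemma P_norm: "hnorm P f = sqrt (Re (ip H f f) + Re (ip H (ast f) (ast f)))"
  by (simp add: plus_space_def hnorm_def)

lemma P_norm_nonneg: "f \<in> D \<Longrightarrow> 0 \<le> hnorm P f"
  by (simp add: P_norm ip_nonneg dom_carrier)

lemma hnorm_le_P: "f \<in> D \<Longrightarrow> hnorm H f \<le> hnorm P f"
  by (simp add: P_norm) (simp add: hnorm_def ip_nonneg dom_carrier)

lemma hnorm_ast_le_P: "f \<in> D \<Longrightarrow> hnorm H (ast f) \<le> hnorm P f"
  by (simp add: P_norm) (simp add: hnorm_def ip_nonneg dom_carrier)

end

section \<open>The state-space operator, its real and imaginary parts, and the channel\<close>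

context boundary_triple
begin

definition chi :: "real \<Rightarrow> 'a \<Rightarrow> complex" where
  "chi Q f = \<delta> f + of_real Q * \<gamma> f"

text \<open>Every functional in \<open>H_-\<close> that the construction meets is the sum of a vector of \<open>H\<close> and a
  multiple of \<open>cnj \<circ> chi Q\<close>, and it determines both.\<close>

definition func :: "real \<Rightarrow> 'a \<Rightarrow> complex \<Rightarrow> 'a \<Rightarrow> complex" where
  "func Q v a = (\<lambda>h \<in> D. ip H v h + a * cnj (chi Q h))"

definition state :: "real \<Rightarrow> 'a \<Rightarrow> 'a \<Rightarrow> complex" where
  "state Q f = func Q (ast f) (\<gamma> f + \<i> * chi Q f)"

definition chan :: "real \<Rightarrow> complex \<Rightarrow> 'a \<Rightarrow> complex" where
  "chan Q c = func Q \<zero> c"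

abbreviation main :: "real \<Rightarrow> 'a operator" where
  "main Q \<equiv> extension (1 + \<i> * of_real Q) \<i>"

lemma chi_add: "f \<in> D \<Longrightarrow> g \<in> D \<Longrightarrow> chi Q (f \<oplus> g) = chi Q f + chi Q g"
  by (simp add: chi_def \<gamma>add \<delta>add algebra_simps)

lemma chi_smult: "f \<in> D \<Longrightarrow> chi Q (c \<odot> f) = c * chi Q f"
  by (simp add: chi_def \<gamma>smult \<delta>smult algebra_simps)

lemma chi_surj: "\<exists>f \<in> D. \<gamma> f = p \<and> chi Q f = q"
  using surjD[of p "q - of_real Q * p"] by (auto simp: chi_def)

lemma boundary_bounded:
  obtains C where "C \<ge> 0" "\<And>f. f \<in> D \<Longrightarrow> cmod (\<gamma> f) \<le> C * hnorm P f"
    "\<And>f. f \<in> D \<Longrightarrow> cmod (\<delta> f) \<le> C * hnorm P f" "\<And>f. f \<in> D \<Longrightarrow> cmod (chi Q f) \<le> C * hnorm P f"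
proof -
  obtain C1 C2 where C: "\<And>f. f \<in> D \<Longrightarrow> cmod (\<gamma> f) \<le> C1 * hnorm P f"
    "\<And>f. f \<in> D \<Longrightarrow> cmod (\<delta> f) \<le> C2 * hnorm P f"
    using \<gamma>_bounded \<delta>_bounded unfolding dom_Amax by blast
  define C where "C = \<bar>C2\<bar> + (\<bar>Q\<bar> + 1) * \<bar>C1\<bar>"
  have C': "cmod (\<gamma> f) \<le> \<bar>C1\<bar> * hnorm P f" "cmod (\<delta> f) \<le> \<bar>C2\<bar> * hnorm P f" if "f \<in> D" for f
    using C[OF that] P_norm_nonneg[OF that] by (meson abs_ge_self mult_right_mono order_trans)+
  show ?thesis
  proof (rule that[of C])
    show "C \<ge> 0" by (simp add: C_def)
    fix f assume f: "f \<in> D"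
    have "\<bar>C1\<bar> \<le> C" "\<bar>C2\<bar> \<le> C"
      by (simp_all add: C_def algebra_simps)
    then show "cmod (\<gamma> f) \<le> C * hnorm P f" "cmod (\<delta> f) \<le> C * hnorm P f"
      using C'[OF f] P_norm_nonneg[OF f] by (meson mult_right_mono order_trans)+
    have "cmod (chi Q f) \<le> cmod (\<delta> f) + \<bar>Q\<bar> * cmod (\<gamma> f)"
      unfolding chi_def by (rule order_trans[OF norm_triangle_ineq]) (simp add: norm_mult)
    also have "\<dots> \<le> \<bar>C2\<bar> * hnorm P f + \<bar>Q\<bar> * (\<bar>C1\<bar> * hnorm P f)"
      using C'[OF f] by (intro add_mono mult_left_mono) auto
    also have "\<dots> \<le> C * hnorm P f"
      using P_norm_nonneg[OF f] by (simp add: C_def algebra_simps)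
    finally show "cmod (chi Q f) \<le> C * hnorm P f" .
  qed
qed

lemma func_bound:
  obtains C where "C \<ge> 0"
    "\<And>v a h. \<lbrakk>v \<in> carrier H; h \<in> D\<rbrakk> \<Longrightarrow> cmod (func Q v a h) \<le> (hnorm H v + cmod a * C) * hnorm P h"
proof -
  obtain C where C: "C \<ge> 0" "\<And>f. f \<in> D \<Longrightarrow> cmod (chi Q f) \<le> C * hnorm P f"
    using boundary_bounded[of Q] by metis
  show ?thesis
  proof (rule that[OF C(1)])
    fix v a h assume v: "v \<in> carrier H" and h: "h \<in> D"
    have "cmod (func Q v a h) \<le> cmod (ip H v h) + cmod a * cmod (chi Q h)"
      unfolding func_def using h by (simp add: order_trans[OF norm_triangle_ineq] norm_mult)
    also have "\<dots> \<le> hnorm H v * hnorm P h + cmod a * (C * hnorm P h)"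
      using C h v by (intro add_mono mult_left_mono order_trans[OF Cauchy_Schwarz] hnorm_le_P) (auto simp: dom_carrier)
    finally show "cmod (func Q v a h) \<le> (hnorm H v + cmod a * C) * hnorm P h"
      by (simp add: algebra_simps)
  qed
qed

lemma func_minus_space: "v \<in> carrier H \<Longrightarrow> func Q v a \<in> minus_space P"
proof -
  assume v: "v \<in> carrier H"
  obtain C where "\<And>h. h \<in> D \<Longrightarrow> cmod (func Q v a h) \<le> (hnorm H v + cmod a * C) * hnorm P h"
    using func_bound v by metis
  then have "\<exists>C. \<forall>f \<in> carrier P. cmod (func Q v a f) \<le> C * hnorm P f"
    by auto
  moreover have "func Q v a \<in> extensional D"
    by (simp add: func_def)
  moreover have "func Q v a (f \<oplus> g) = func Q v a f + func Q v a g" if "f \<in> D" "g \<in> D" for f g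
    using that v by (simp add: func_def ip_simps dom_carrier chi_add algebra_simps)
  moreover have "func Q v a (c \<odot> f) = cnj c * func Q v a f" if "f \<in> D" for f c
    using that v by (simp add: func_def ip_simps dom_carrier chi_smult algebra_simps)
  ultimately show ?thesis
    unfolding minus_space_def by simp
qed

lemma func_norm:
  obtains C where "C \<ge> 0" "\<And>v a. v \<in> carrier H \<Longrightarrow> minus_norm P (func Q v a) \<le> hnorm H v + cmod a * C"
proof -
  obtain C where C: "C \<ge> 0"
    "\<And>v a h. \<lbrakk>v \<in> carrier H; h \<in> D\<rbrakk> \<Longrightarrow> cmod (func Q v a h) \<le> (hnorm H v + cmod a * C) * hnorm P h"
    using func_bound by metis
  show ?thesis
  proof (rule that[OF C(1)])
    fix v a assume v: "v \<in> carrier H"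
    have zero: "hnorm P \<zero> = 0"
      by (simp add: P_norm ast_zero)
    show "minus_norm P (func Q v a) \<le> hnorm H v + cmod a * C"
      unfolding minus_norm_def
    proof (rule cSUP_least)
      show "{f \<in> carrier P. hnorm P f \<le> 1} \<noteq> {}"
        using zero by (auto intro!: exI[of _ \<zero>])
      fix h assume "h \<in> {f \<in> carrier P. hnorm P f \<le> 1}"
      then have h: "h \<in> D" "hnorm P h \<le> 1" by auto
      have "0 \<le> hnorm H v + cmod a * C"
        using v C(1) by simp
      then have "(hnorm H v + cmod a * C) * hnorm P h \<le> (hnorm H v + cmod a * C) * 1"
        using h by (intro mult_left_mono) auto
      then show "cmod (func Q v a h) \<le> hnorm H v + cmod a * C"
        using C(2)[OF v h(1), of a] by simp
    qed
  qed
qed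

text \<open>On the dense set \<open>Domain A\<close> the boundary term vanishes, which determines
  the vector; a point where \<open>chi Q\<close> is 1 then determines the coefficient. This
  uniqueness lets equations in \<open>H_-\<close> be compared componentwise.\<close>

lemma func_eq_iff:
  assumes "v \<in> carrier H" "w \<in> carrier H"
  shows "func Q v a = func Q w b \<longleftrightarrow> v = w \<and> a = b"
proof
  assume eq: "func Q v a = func Q w b"
  have "ip H v y = ip H w y" if "y \<in> Domain A" for y
    using that fun_cong[OF eq, of y] by (auto simp: func_def dom_A chi_def)
  then have vw: "v = w"
    using assms by (intro orth_eq)
  obtain y where "y \<in> D" "chi Q y = 1"
    using chi_surj by blast
  then show "v = w \<and> a = b"
    using vw fun_cong[OF eq, of y] by (simp add: func_def)
qed simp

lemma embed_eq_func: "embed_minus H P h = func Q h 0"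
  by (simp add: embed_minus_def func_def)

text \<open>Green's identity moves \<open>A*\<close> to the other argument. The resulting boundary
  terms combine with \<open>cnj (\<gamma> h) * chi Q f\<close> into
  \<open>\<gamma> f * cnj (chi Q h)\<close> because \<open>Q\<close> is real, and only the sign of
  the imaginary term flips.\<close>

lemma adj_state: "f \<in> D \<Longrightarrow> adj_pm P (state Q) f = func Q (ast f) (\<gamma> f - \<i> * chi Q f)"
proof -
  assume f: "f \<in> D"
  have "cnj (state Q h f) = func Q (ast f) (\<gamma> f - \<i> * chi Q f) h" if h: "h \<in> D" for h
  proof -
    have "ip H f (ast h) = cnj (ip H (ast h) f)"
      using f h ip_cnj dom_carrier ast_carrier by blast
    then have "cnj (ip H (ast h) f) = ip H (ast f) h - (\<delta> f * cnj (\<gamma> h) - \<gamma> f * cnj (\<delta> h))"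
      using green'[OF f h] by (simp add: algebra_simps)
    then show ?thesis
      using f h by (simp add: state_def func_def chi_def algebra_simps)
  qed
  then show ?thesis
    by (auto simp: adj_pm_def func_def)
qed

lemma Re_state: "f \<in> D \<Longrightarrow> Re_pm P (state Q) f = func Q (ast f) (\<gamma> f)"
  unfolding Re_pm_def by (subst adj_state) (auto simp: state_def func_def field_simps)

lemma Im_state: "f \<in> D \<Longrightarrow> Im_pm P (state Q) f = func Q \<zero> (chi Q f)"
  unfolding Im_pm_def by (subst adj_state) (auto simp: state_def func_def field_simps dom_carrier)

text \<open>The real part sends \<open>f\<close> to a functional with coefficient
  \<open>\<gamma> f\<close>, and vectors of \<open>H\<close> are the functionals with coefficient
  0.\<close>

lemma quasi_kernel_state: "quasi_kernel H P (state Q) = extension 1 0"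
  by (auto simp: quasi_kernel_def Re_state embed_eq_func[of _ Q] func_eq_iff extension_iff)

lemma adjoint_main: "adjoint_op H (main Q) = extension (1 - \<i> * of_real Q) (- \<i>)"
  by (subst adjoint_extension) auto

lemma state_linear:
  "f \<in> D \<Longrightarrow> g \<in> D \<Longrightarrow> h \<in> D \<Longrightarrow> state Q (f \<oplus> g) h = state Q f h + state Q g h"
  "f \<in> D \<Longrightarrow> h \<in> D \<Longrightarrow> state Q (c \<odot> f) h = c * state Q f h"
  by (simp_all add: state_def func_def ast_add ast_smult ip_simps dom_carrier \<gamma>add \<gamma>smult
      chi_add chi_smult algebra_simps)

lemma bounded_state: "bounded_plus_minus P (state Q)"
proof -
  obtain C1 where C1: "C1 \<ge> 0" "\<And>v a. v \<in> carrier H \<Longrightarrow> minus_norm P (func Q v a) \<le> hnorm H v + cmod a * C1"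
    using func_norm by metis
  obtain C2 where C2: "C2 \<ge> 0" "\<And>f. f \<in> D \<Longrightarrow> cmod (\<gamma> f) \<le> C2 * hnorm P f"
    "\<And>f. f \<in> D \<Longrightarrow> cmod (chi Q f) \<le> C2 * hnorm P f"
    using boundary_bounded[of Q] by metis
  have "minus_norm P (state Q f) \<le> (1 + 2 * C2 * C1) * hnorm P f" if f: "f \<in> D" for f
  proof -
    have "minus_norm P (state Q f) \<le> hnorm H (ast f) + cmod (\<gamma> f + \<i> * chi Q f) * C1"
      unfolding state_def using f by (intro C1(2)) simp
    also have "\<dots> \<le> hnorm P f + (C2 * hnorm P f + C2 * hnorm P f) * C1"
      using C1(1) C2(2,3)[OF f] hnorm_ast_le_P[OF f]
      by (intro add_mono mult_right_mono order_trans[OF norm_triangle_ineq]) (auto simp: norm_mult)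
    finally show ?thesis by (simp add: algebra_simps)
  qed
  then show ?thesis
    unfolding bounded_plus_minus_def using state_linear func_minus_space
    by (auto simp: state_def intro!: exI[of _ "1 + 2 * C2 * C1"])
qed

lemma star_extension_state: "star_extension H A (main Q) (state Q)"
  unfolding star_extension_def Let_def
proof (intro conjI)
  show "A \<subseteq> adjoint_op H (main Q)"
    unfolding adjoint_main by (rule A_sub_extension)
  show "extended_by H P (main Q) (state Q)"
    by (auto simp: extended_by_def embed_eq_func[of _ Q] extension_iff state_def func_eq_iff chi_def algebra_simps)
  show "extended_by H P (adjoint_op H (main Q)) (adj_pm P (state Q))"
    unfolding adjoint_main
    by (auto simp: extended_by_def embed_eq_func[of _ Q] extension_iff adj_state func_eq_iff chi_def algebra_simps)
  show "self_adjoint_op H (quasi_kernel H P (state Q))"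
    by (simp add: quasi_kernel_state self_adjoint_extension)
qed (simp_all add: bounded_state A_sub_extension)

lemma bounded_chan: "bounded_channel P (chan Q)"
proof -
  obtain C where C: "\<And>v a. v \<in> carrier H \<Longrightarrow> minus_norm P (func Q v a) \<le> hnorm H v + cmod a * C"
    using func_norm by metis
  have "minus_norm P (chan Q c) \<le> C * cmod c" for c
    using C[of \<zero> c] by (simp add: chan_def mult.commute)
  then show ?thesis
    unfolding bounded_channel_def using func_minus_space
    by (auto simp: chan_def func_def dom_carrier algebra_simps)
qed

lemma channel_adj_chan: "f \<in> D \<Longrightarrow> channel_adj (chan Q) f = chi Q f"
  by (simp add: channel_adj_def chan_def func_def dom_carrier)

text \<open>The right-hand side has vector part 0 and coefficient 1, so comparing components splits
  the equation in \<open>H_-\<close> into the defect equation and a normalisation.\<close>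

lemma solves_at_iff:
  "solves_at H A (state Q) (chan Q) z f \<longleftrightarrow> f \<in> D \<and> ast f = z \<odot> f \<and> \<gamma> f = 1"
proof -
  have "(\<lambda>g \<in> D. Re_pm P (state Q) f g - z * embed_minus H P f g) = func Q (ast f \<ominus> z \<odot> f) (\<gamma> f)"
    if "f \<in> D" for f
    using that by (auto simp: Re_state embed_minus_def func_def ip_simps dom_carrier)
  then show ?thesis
    unfolding solves_at_def Let_def chan_def
    by (auto simp: func_eq_iff dom_carrier minus_eq_zero_iff)
qed

lemma admissible_main_main:
  assumes "resolvent_set H (main Q) \<noteq> {}"
  shows "admissible_main H A (main Q)"
  unfolding admissible_main_def
proof (intro conjI)
  \<comment> \<open>With these values the condition of \<open>main Q\<close> holds, while that of
    its adjoint evaluates to 2.\<close>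
  obtain f where f: "f \<in> D" "\<gamma> f = 1" "\<delta> f = \<i> - of_real Q"
    using surjD by blast
  then have "(f, ast f) \<in> main Q" "(f, ast f) \<notin> adjoint_op H (main Q)"
    by (auto simp: extension_iff adjoint_main f(2,3) algebra_simps)
  then show "\<not> symmetric_op H (main Q)"
    by (auto simp: symmetric_op_def)
  have "\<gamma> f = 0 \<and> \<delta> f = 0" if "(1 + \<i> * of_real Q) * \<gamma> f + \<i> * \<delta> f = 0" "(1 - \<i> * of_real Q) * \<gamma> f + (- \<i>) * \<delta> f = 0" for f
  proof -
    \<comment> \<open>Adding the two conditions eliminates \<open>Q\<close> and
      \<open>\<delta>\<close>; once \<open>\<gamma> f = 0\<close>, either of them gives
      \<open>\<delta> f = 0\<close>.\<close>
    have "2 * \<gamma> f = ((1 + \<i> * of_real Q) * \<gamma> f + \<i> * \<delta> f) + ((1 - \<i> * of_real Q) * \<gamma> f + (- \<i>) * \<delta> f)"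
      by (simp add: algebra_simps)
    then show ?thesis using that by simp
  qed
  then show "Domain A = Domain (main Q) \<inter> Domain (adjoint_op H (main Q))"
    unfolding adjoint_main by (auto simp: dom_A extension_iff Domain_iff)
qed (use assms linear_extension A_sub_extension extension_sub in auto)

lemma L_system_main:
  assumes "deficiency_indices_1_1 H A" "resolvent_set H (main Q) \<noteq> {}"
  shows "L_system H A (main Q) (state Q) (chan Q)"
proof
  have "closed_operator H (adjoint_op H Amax)"
    by (rule closed_adjoint) (auto dest: Amax_carrier)
  then show "admissible_symmetric H A"
    unfolding admissible_symmetric_def symmetric_op_def
    using assms linear dense A_sub A_eq_adjoint by simp
  show "\<forall>f\<in>carrier P. Im_pm P (state Q) f = chan Q (channel_adj (chan Q) f)"
    by (simp add: Im_state channel_adj_chan chan_def)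
  have "\<exists>f \<in> D. chan Q c = Im_pm P (state Q) f" for c
    using chi_surj[of _ Q c] by (auto simp: Im_state chan_def)
  then show "range (chan Q) = Im_pm P (state Q) ` carrier P"
    by (auto simp: Im_state chan_def)
qed (use assms admissible_main_main star_extension_state bounded_chan in auto)

end

text \<open>The extension \<open>\<gamma> = 0\<close> is the reference operator, for which every
  nonreal point is regular. As \<open>e z\<close> is the defect vector normalised by
  \<open>\<gamma> = 1\<close>, the number \<open>\<delta> (e z)\<close> is the Weyl function of the
  triple.\<close>

locale weyl_triple = boundary_triple +
  fixes e :: "complex \<Rightarrow> 'a"
  assumes resolvent: "Im z \<noteq> 0 \<Longrightarrow> z \<in> resolvent_set H {(f, f') \<in> adjoint_op H A. \<gamma> f = 0}"
    and e_defect: "Im z \<noteq> 0 \<Longrightarrow> e z \<in> defect_space H A z"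
    and \<gamma>_e: "Im z \<noteq> 0 \<Longrightarrow> \<gamma> (e z) = 1"
begin

lemma resolvent_ext: "Im z \<noteq> 0 \<Longrightarrow> z \<in> resolvent_set H (extension 1 0)"
  using resolvent by (simp add: extension_def)

lemma e_dom: "Im z \<noteq> 0 \<Longrightarrow> e z \<in> D" and ast_e: "Im z \<noteq> 0 \<Longrightarrow> ast (e z) = z \<odot> e z"
  using e_defect by (auto simp: defect_space_def Amax_iff)

lemma e_unique:
  assumes z: "Im z \<noteq> 0" and f: "f \<in> D" "ast f = z \<odot> f" "\<gamma> f = 0"
  shows "f = \<zero>"
proof -
  have "\<exists>!f. \<exists>g. (f, g) \<in> extension 1 0 \<and> g \<ominus> z \<odot> f = \<zero>"
    using resolvent_ext[OF z] by (simp add: resolvent_set_def)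
  moreover have "\<exists>g. (f, g) \<in> extension 1 0 \<and> g \<ominus> z \<odot> f = \<zero>"
    using f by (simp add: extension_iff dom_carrier minus_eq_zero_iff)
  moreover have "\<exists>g. (\<zero>, g) \<in> extension 1 0 \<and> g \<ominus> z \<odot> \<zero> = \<zero>"
    by (simp add: extension_iff ast_zero minus_eq_zero_iff)
  ultimately show ?thesis by blast
qed

text \<open>Subtracting \<open>\<gamma> f\<close> times \<open>e z\<close> from a defect vector
  \<open>f\<close> leaves a solution of the eigenvalue equation of the reference operator at a
  regular point, hence 0.\<close>

lemma defect_space_eq:
  assumes z: "Im z \<noteq> 0"
  shows "defect_space H A z = range (\<lambda>c. c \<odot> e z)"
proof (intro equalityI subsetI)
  fix f assume "f \<in> defect_space H A z"
  then have f: "f \<in> D" "ast f = z \<odot> f"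
    by (auto simp: defect_space_def Amax_iff)
  have "ast (f \<ominus> \<gamma> f \<odot> e z) = z \<odot> (f \<ominus> \<gamma> f \<odot> e z)"
    using f z by (intro ip_ext) (simp_all add: e_dom ast_diff ast_smult ast_e dom_carrier ip_simps algebra_simps)
  then have "f \<ominus> \<gamma> f \<odot> e z = \<zero>"
    using f z by (intro e_unique[OF z]) (simp_all add: e_dom \<gamma>_diff \<gamma>smult \<gamma>_e)
  then show "f \<in> range (\<lambda>c. c \<odot> e z)"
    using f z by (auto simp: minus_eq_zero_iff dom_carrier e_dom)
next
  fix f assume "f \<in> range (\<lambda>c. c \<odot> e z)"
  then obtain c where f: "f = c \<odot> e z" by blast
  have "c \<odot> (z \<odot> e z) = z \<odot> (c \<odot> e z)"
    using z by (intro ip_ext) (simp_all add: e_dom dom_carrier ip_simps)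
  then show "f \<in> defect_space H A z"
    using f z by (auto simp: defect_space_def Amax_iff e_dom ast_smult ast_e)
qed

lemma deficiency_1_1: "deficiency_indices_1_1 H A"
proof -
  have "e z \<noteq> \<zero>" if "Im z \<noteq> 0" for z
    using \<gamma>_e[OF that] by force
  then have "one_dimensional H (defect_space H A z)" if "Im z \<noteq> 0" for z
    using that defect_space_eq[OF that] e_dom[OF that] dom_carrier unfolding one_dimensional_def by blast
  then show ?thesis
    by (simp add: deficiency_indices_1_1_def)
qed

text \<open>A Krein-type argument: solve with the reference operator and correct by a multiple of
  \<open>e z\<close>, which does not change \<open>(A* - z) f\<close>. The hypothesis says that
  \<open>e z\<close> violates the boundary condition, so the right multiple exists and is
  unique.\<close>

lemma resolvent_extension:
  assumes z: "Im z \<noteq> 0" and reg: "p + q * \<delta> (e z) \<noteq> 0"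
  shows "z \<in> resolvent_set H (extension p q)"
  unfolding resolvent_set_def
proof (intro CollectI conjI ballI)
  define r where "r = p + q * \<delta> (e z)"
  note [simp] = e_dom[OF z] ast_e[OF z] \<gamma>_e[OF z]
  have ec [simp]: "e z \<in> carrier H" by (simp add: dom_carrier)
  \<comment> \<open>Removing \<open>\<gamma> f\<close> times \<open>e z\<close> leads into the
    reference operator, and the last identity recovers \<open>\<gamma> f\<close> from what is
    left.\<close>
  have decomp: "f \<ominus> \<gamma> f \<odot> e z \<in> D" "\<gamma> (f \<ominus> \<gamma> f \<odot> e z) = 0"
    "ast (f \<ominus> \<gamma> f \<odot> e z) \<ominus> z \<odot> (f \<ominus> \<gamma> f \<odot> e z) = ast f \<ominus> z \<odot> f"
    "q * \<delta> (f \<ominus> \<gamma> f \<odot> e z) = - \<gamma> f * r" if "f \<in> D" "p * \<gamma> f + q * \<delta> f = 0" for f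
  proof -
    show "f \<ominus> \<gamma> f \<odot> e z \<in> D" "\<gamma> (f \<ominus> \<gamma> f \<odot> e z) = 0"
      using that by (simp_all add: \<gamma>_diff \<gamma>smult)
    show "ast (f \<ominus> \<gamma> f \<odot> e z) \<ominus> z \<odot> (f \<ominus> \<gamma> f \<odot> e z) = ast f \<ominus> z \<odot> f"
      using that by (intro ip_ext) (simp_all add: ast_diff ast_smult dom_carrier ip_simps algebra_simps)
    have "q * \<delta> (f \<ominus> \<gamma> f \<odot> e z) = (p * \<gamma> f + q * \<delta> f) - \<gamma> f * r"
      using that(1) by (simp add: \<delta>_diff \<delta>smult r_def algebra_simps)
    then show "q * \<delta> (f \<ominus> \<gamma> f \<odot> e z) = - \<gamma> f * r"
      using that(2) by simp
  qed
  {
    fix h assume h: "h \<in> carrier H"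
    have ex1: "\<exists>!f. \<exists>g. (f, g) \<in> extension 1 0 \<and> g \<ominus> z \<odot> f = h"
      using resolvent_ext[OF z] h by (simp add: resolvent_set_def)
    then obtain f0 where f0: "f0 \<in> D" "\<gamma> f0 = 0" "ast f0 \<ominus> z \<odot> f0 = h"
      by (auto simp: extension_iff)
    have f0_eq: "f = f0" if "f \<in> D" "\<gamma> f = 0" "ast f \<ominus> z \<odot> f = h" for f
      using ex1 that f0 by (auto simp: extension_iff)
    \<comment> \<open>Solves \<open>q * \<delta> f0 + c * r = 0\<close>, the boundary condition for
      \<open>f0\<close> plus \<open>c\<close> times \<open>e z\<close>.\<close>
    define c where "c = - q * \<delta> f0 / r"
    define f where "f = f0 \<oplus> c \<odot> e z"
    show "\<exists>!f. \<exists>g. (f, g) \<in> extension p q \<and> g \<ominus> z \<odot> f = h"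
    proof (rule ex1I[of _ f])
      have "p * \<gamma> f + q * \<delta> f = q * \<delta> f0 + c * r"
        using f0 by (simp add: f_def \<gamma>add \<delta>add \<gamma>smult \<delta>smult r_def algebra_simps)
      also have "\<dots> = 0"
        using reg by (simp add: c_def r_def)
      finally have "(f, ast f) \<in> extension p q"
        using f0 by (simp add: extension_iff f_def)
      moreover have "ast f \<ominus> z \<odot> f = ast f0 \<ominus> z \<odot> f0"
        unfolding f_def using f0(1)
        by (intro ip_ext) (simp_all add: ast_add ast_smult dom_carrier ip_simps algebra_simps)
      ultimately show "\<exists>g. (f, g) \<in> extension p q \<and> g \<ominus> z \<odot> f = h"
        using f0(3) by blast
    next
      fix g assume "\<exists>g'. (g, g') \<in> extension p q \<and> g' \<ominus> z \<odot> g = h"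
      then have g: "g \<in> D" "p * \<gamma> g + q * \<delta> g = 0" "ast g \<ominus> z \<odot> g = h"
        by (auto simp: extension_iff)
      have eq: "g \<ominus> \<gamma> g \<odot> e z = f0"
        using decomp[OF g(1,2)] g(3) by (intro f0_eq) auto
      then have "\<gamma> g = c"
        using decomp(4)[OF g(1,2)] reg by (simp add: c_def flip: r_def)
      then have "f0 \<oplus> c \<odot> e z = (g \<ominus> \<gamma> g \<odot> e z) \<oplus> \<gamma> g \<odot> e z"
        unfolding eq by simp
      also have "\<dots> = g"
        using g(1) by (intro ip_ext) (simp_all add: dom_carrier ip_simps)
      finally show "g = f" by (simp add: f_def)
    qed
  }
  obtain C where C: "\<And>f g. (f, g) \<in> extension 1 0 \<Longrightarrow> hnorm H f \<le> C * hnorm H (g \<ominus> z \<odot> f)"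
    using resolvent_ext[OF z] unfolding resolvent_set_def by blast
  obtain C' where C': "C' \<ge> 0" "\<And>f. f \<in> D \<Longrightarrow> cmod (\<delta> f) \<le> C' * hnorm P f"
    using boundary_bounded[of 0] by metis
  define R where "R = cmod q / cmod r * C'"
  have R: "R \<ge> 0" using C' by (simp add: R_def)
  \<comment> \<open>Bounds the graph norm of the reference solution: \<open>C\<close> for the
    vector, \<open>1 + cmod z * C\<close> for its image under \<open>A*\<close>.\<close>
  define S where "S = C + cmod z * C + 1"
  show "\<exists>C. \<forall>(f, g)\<in>extension p q. hnorm H f \<le> C * hnorm H (g \<ominus> z \<odot> f)"
  proof (intro exI ballI, clarify)
    fix f g assume "(f, g) \<in> extension p q"
    then have f: "f \<in> D" "p * \<gamma> f + q * \<delta> f = 0" "g = ast f"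
      by (auto simp: extension_iff)
    define f0 where "f0 = f \<ominus> \<gamma> f \<odot> e z"
    define n where "n = hnorm H (ast f \<ominus> z \<odot> f)"
    note dec = decomp[OF f(1,2), folded f0_def]
    have n0: "hnorm H f0 \<le> C * n"
      using C[of f0 "ast f0"] dec by (simp add: extension_iff n_def)
    have "ast f0 = (ast f \<ominus> z \<odot> f) \<oplus> z \<odot> f0"
      unfolding dec(3)[symmetric] using dec(1) by (intro ip_ext) (simp_all add: dom_carrier ip_simps)
    then have "hnorm H (ast f0) \<le> n + cmod z * hnorm H f0"
      using hnorm_triangle[of "ast f \<ominus> z \<odot> f" "z \<odot> f0"] f dec by (simp add: n_def hnorm_smult dom_carrier)
    also have "\<dots> \<le> n + cmod z * (C * n)"
      using n0 by (intro add_left_mono mult_left_mono) auto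
    finally have n1: "hnorm H (ast f0) \<le> n + cmod z * (C * n)" .
    have "hnorm P f0 \<le> hnorm H f0 + hnorm H (ast f0)"
      unfolding P_norm using dec(1) by (simp add: hnorm_def sqrt_add_le_add_sqrt ip_nonneg dom_carrier)
    then have nP: "hnorm P f0 \<le> S * n"
      using n0 n1 by (simp add: S_def algebra_simps)
    have "\<gamma> f = - q * \<delta> f0 / r"
      using dec(4) reg by (simp flip: r_def)
    then have "cmod (\<gamma> f) = cmod q / cmod r * cmod (\<delta> f0)"
      by (simp add: norm_mult norm_divide)
    also have "\<dots> \<le> cmod q / cmod r * (C' * hnorm P f0)"
      using C'(2)[OF dec(1)] by (intro mult_left_mono) auto
    also have "\<dots> \<le> R * (S * n)"
      using nP R unfolding R_def mult.assoc[symmetric] by (metis mult.assoc mult_left_mono)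
    finally have g: "cmod (\<gamma> f) \<le> R * (S * n)" .
    have "f = f0 \<oplus> \<gamma> f \<odot> e z"
      using f by (intro ip_ext) (simp_all add: f0_def dom_carrier ip_simps)
    then have "hnorm H f \<le> hnorm H f0 + cmod (\<gamma> f) * hnorm H (e z)"
      using hnorm_triangle[of f0 "\<gamma> f \<odot> e z"] dec by (simp add: hnorm_smult dom_carrier)
    also have "\<dots> \<le> C * n + R * (S * n) * hnorm H (e z)"
      using n0 g by (intro add_mono mult_right_mono) auto
    finally show "hnorm H f \<le> (C + R * S * hnorm H (e z)) * hnorm H (g \<ominus> z \<odot> f)"
      by (simp add: f n_def algebra_simps)
  qed
qed

lemma realized:
  assumes V: "\<And>z. Im z \<noteq> 0 \<Longrightarrow> V z = of_real Q + \<delta> (e z)"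
  shows "realized_by V H A (state Q) (chan Q)"
  unfolding realized_by_def
proof (intro allI impI conjI)
  fix z :: complex assume z: "Im z \<noteq> 0"
  show "z \<in> resolvent_set H (quasi_kernel H P (state Q))"
    using resolvent_ext[OF z] by (simp add: quasi_kernel_state)
  have e: "solves_at H A (state Q) (chan Q) z (e z)"
    using z by (simp add: solves_at_iff e_dom ast_e \<gamma>_e)
  have uniq: "f = e z" if "solves_at H A (state Q) (chan Q) z f" for f
  proof -
    have f: "f \<in> D" "ast f = z \<odot> f" "\<gamma> f = 1"
      using that by (auto simp: solves_at_iff)
    have "ast (f \<ominus> e z) = z \<odot> (f \<ominus> e z)"
      using f z by (intro ip_ext) (simp_all add: e_dom ast_diff ast_e dom_carrier ip_simps algebra_simps)
    then have "f \<ominus> e z = \<zero>"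
      using f z by (intro e_unique[OF z]) (simp_all add: e_dom \<gamma>_diff \<gamma>_e)
    then show ?thesis
      using f z by (simp add: minus_eq_zero_iff dom_carrier e_dom)
  qed
  then show "\<exists>!f. solves_at H A (state Q) (chan Q) z f"
    using e by blast
  have "(THE f. solves_at H A (state Q) (chan Q) z f) = e z"
    using e uniq by blast
  then show "V z = impedance H A (state Q) (chan Q) z"
    using V[OF z] z by (simp add: impedance_def channel_adj_chan e_dom chi_def \<gamma>_e)
qed

text \<open>Green's identity for the pair \<open>e z\<close>, \<open>e z\<close>; it expresses the
  positivity of the Weyl function's imaginary part.\<close>

lemma norm_e:
  assumes z: "Im z \<noteq> 0"
  shows "(hnorm H (e z))\<^sup>2 = Im (\<delta> (e z)) / Im z"
proof -
  have ip: "ip H (e z) (e z) = of_real ((hnorm H (e z))\<^sup>2)"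
    using z by (intro ip_self) (simp add: dom_carrier e_dom)
  have "(z - cnj z) * of_real ((hnorm H (e z))\<^sup>2) = \<delta> (e z) - cnj (\<delta> (e z))"
    using green'[of "e z" "e z"] z e_dom[OF z] ip
    by (simp add: ast_e \<gamma>_e ip_simps dom_carrier left_diff_distrib)
  then have "2 * Im z * (hnorm H (e z))\<^sup>2 = 2 * Im (\<delta> (e z))"
    by (simp add: complex_diff_cnj complex_eq_iff)
  then show ?thesis using z by (simp add: field_simps)
qed

text \<open>The boundary form \<open>(1 + \<i> Q) \<gamma> + \<i> \<delta>\<close> takes the values
  \<open>1 + \<i> Q - a\<close> at \<open>e \<i>\<close> and \<open>1 + \<i> Q + a\<close> at
  \<open>e (- \<i>)\<close>, which dictates \<open>u\<close>. Both vectors have norm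
  \<open>sqrt a\<close> by \<open>norm_e\<close>, and the unimodular factor
  \<open>u / \<kappa>\<close> moves the phase of \<open>u\<close> into \<open>gm\<close>.\<close>

lemma parameters:
  fixes a Q \<kappa> :: real and u U :: complex
  assumes a: "a > 0" and e: "\<delta> (e \<i>) = \<i> * of_real a" "\<delta> (e (- \<i>)) = - \<i> * of_real a"
    and u: "u = (1 + \<i> * of_real Q - of_real a) / (1 + \<i> * of_real Q + of_real a)"
    and \<kappa>: "\<kappa> = cmod u" "0 < \<kappa>" "\<kappa> < 1" and U: "U = - of_real \<kappa> / u"
  defines "gp \<equiv> of_real (1 / sqrt a) \<odot> e \<i>"
    and "gm \<equiv> (of_real (1 / sqrt a) * u / of_real \<kappa>) \<odot> e (- \<i>)"
  shows "deficiency_vectors H A gp gm" "main_parameter H (main Q) gp gm (of_real \<kappa>)"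
    "selfadjoint_parameter H A (quasi_kernel H P (state Q)) gp gm U"
proof -
  have I: "Im \<i> \<noteq> 0" "Im (- \<i>) \<noteq> 0" by auto
  note [simp] = e_dom[OF I(1)] e_dom[OF I(2)] \<gamma>_e[OF I(1)] \<gamma>_e[OF I(2)]
  have u0: "u \<noteq> 0" using \<kappa> by auto
  have cu: "cmod u = \<kappa>" using \<kappa> by simp
  have "(hnorm H (e \<i>))\<^sup>2 = a" "(hnorm H (e (- \<i>)))\<^sup>2 = a"
    using norm_e[OF I(1)] norm_e[OF I(2)] e by simp_all
  then have n: "hnorm H (e \<i>) = sqrt a" "hnorm H (e (- \<i>)) = sqrt a"
    by (metis dom_carrier e_dom I hnorm_nonneg real_sqrt_abs abs_of_nonneg)+
  have gD [simp]: "gp \<in> D" "gm \<in> D"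
    by (simp_all add: gp_def gm_def)
  have gc [simp]: "gp \<in> carrier H" "gm \<in> carrier H"
    by (simp_all add: dom_carrier)
  show "deficiency_vectors H A gp gm"
    using a u0 \<kappa> unfolding deficiency_vectors_def defect_space_eq[OF I(1)] defect_space_eq[OF I(2)]
    by (auto simp: gp_def gm_def hnorm_smult n dom_carrier norm_mult norm_divide cu)
  have s: "complex_of_real (1 / sqrt a) \<noteq> 0" using a by simp
  define s where "s = complex_of_real (1 / sqrt a)"
  have g\<gamma>: "\<gamma> gp = s" "\<gamma> gm = s * u / \<kappa>" "\<delta> gp = s * \<i> * a" "\<delta> gm = - s * u / \<kappa> * \<i> * a"
    using e by (simp_all add: gp_def gm_def \<gamma>smult \<delta>smult s_def)
  have den: "1 + \<i> * of_real Q + of_real a \<noteq> 0"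
    using a by (auto simp: complex_eq_iff)
  have ueq: "u * (1 + \<i> * of_real Q + of_real a) = 1 + \<i> * of_real Q - of_real a"
    using den by (simp add: u)
  define x where "x = gp \<ominus> of_real \<kappa> \<odot> gm"
  have xD: "x \<in> D" by (simp add: x_def)
  have x: "\<gamma> x = s * (1 - u)" "\<delta> x = s * \<i> * a * (1 + u)"
    using \<kappa> by (simp_all add: x_def \<gamma>_diff \<delta>_diff \<gamma>smult \<delta>smult g\<gamma> field_simps)
  \<comment> \<open>The phase in \<open>gm\<close> cancels: \<open>x\<close> is a multiple of
    \<open>e \<i>\<close> minus \<open>u\<close> times \<open>e (- \<i>)\<close>.\<close>
  have "(1 + \<i> * of_real Q) * \<gamma> x + \<i> * \<delta> x = s * ((1 + \<i> * of_real Q - of_real a) - u * (1 + \<i> * of_real Q + of_real a))"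
    unfolding x by (simp add: algebra_simps)
  then have "(x, ast x) \<in> main Q"
    using ueq xD by (simp add: extension_iff)
  then show "main_parameter H (main Q) gp gm (of_real \<kappa>)"
    using \<kappa> by (auto simp: main_parameter_def x_def)
  define w where "w = gp \<oplus> U \<odot> gm"
  have wD: "w \<in> D" by (simp add: w_def)
  \<comment> \<open>\<open>U\<close> is the one coefficient for which the two values of
    \<open>\<gamma>\<close> cancel.\<close>
  have w\<gamma>: "\<gamma> w = 0" "\<delta> w = 2 * s * \<i> * a"
    using \<kappa> u0 by (simp_all add: w_def \<gamma>add \<delta>add \<gamma>smult \<delta>smult g\<gamma> U field_simps)
  have w0: "\<delta> w \<noteq> 0"
    using s a w\<gamma> by (simp add: s_def)
  have "Domain (extension 1 0) = {f \<oplus> c \<odot> w | f c. f \<in> Domain A}"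
  proof (intro equalityI subsetI)
    fix g assume "g \<in> Domain (extension 1 0)"
    then have g: "g \<in> D" "\<gamma> g = 0"
      by (auto simp: extension_iff)
    \<comment> \<open>Since \<open>\<delta> w\<close> is nonzero, this multiple of \<open>w\<close>
      carries all of \<open>\<delta> g\<close> and the remainder lies in
      \<open>Domain A\<close>.\<close>
    define c where "c = \<delta> g / \<delta> w"
    have "g \<ominus> c \<odot> w \<in> Domain A"
      using g wD w0 w\<gamma>(1) by (simp add: dom_A \<gamma>_diff \<delta>_diff \<gamma>smult \<delta>smult c_def)
    moreover have "g = (g \<ominus> c \<odot> w) \<oplus> c \<odot> w"
      using g wD by (intro ip_ext) (simp_all add: dom_carrier ip_simps)
    ultimately show "g \<in> {f \<oplus> c \<odot> w | f c. f \<in> Domain A}"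
      by blast
  next
    fix g assume "g \<in> {f \<oplus> c \<odot> w | f c. f \<in> Domain A}"
    then obtain f c where g: "g = f \<oplus> c \<odot> w" "f \<in> D" "\<gamma> f = 0"
      by (auto simp: dom_A)
    then have "(g, ast g) \<in> extension 1 0"
      using wD w\<gamma> by (simp add: extension_iff \<gamma>add \<gamma>smult)
    then show "g \<in> Domain (extension 1 0)" by blast
  qed
  moreover have "cmod U = 1"
    using \<kappa> u0 by (simp add: U norm_divide cu)
  ultimately show "selfadjoint_parameter H A (quasi_kernel H P (state Q)) gp gm U"
    by (simp add: selfadjoint_parameter_def quasi_kernel_state w_def)
qed

end

section \<open>The space of square-integrable functions\<close>

definition L2 :: "'b measure \<Rightarrow> ('b \<Rightarrow> complex) set" where
  "L2 M = {f \<in> borel_measurable M. integrable M (\<lambda>x. (cmod (f x))\<^sup>2)}"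

definition cls :: "'b measure \<Rightarrow> ('b \<Rightarrow> complex) \<Rightarrow> ('b \<Rightarrow> complex) set" where
  "cls M f = {g \<in> borel_measurable M. AE x in M. g x = f x}"

text \<open>Representing sets that are not classes by \<open>0\<close> makes \<^const>\<open>hdist\<close> a metric on the whole type.\<close>

definition rep :: "'b measure \<Rightarrow> ('b \<Rightarrow> complex) set \<Rightarrow> 'b \<Rightarrow> complex" where
  "rep M X = (if X \<in> cls M ` L2 M then SOME f. f \<in> L2 M \<and> cls M f = X else (\<lambda>_. 0))"

text \<open>Sum, multiples and inner product act on chosen representatives, hence are given by one
  formula on all sets, classes or not. Independence of the choice is the content of
  \<open>cls_add\<close>, \<open>cls_smult\<close> and \<open>cls_ip\<close>.\<close>

definition L2_space :: "'b measure \<Rightarrow> ('b \<Rightarrow> complex) set inner_space" where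
  "L2_space M = \<lparr>carrier = cls M ` L2 M, mult = (\<lambda>_ _. {}), one = {}, zero = cls M (\<lambda>_. 0),
     add = (\<lambda>X Y. cls M (\<lambda>x. rep M X x + rep M Y x)),
     smult = (\<lambda>c X. cls M (\<lambda>x. c * rep M X x)),
     ip = (\<lambda>X Y. \<integral>x. rep M X x * cnj (rep M Y x) \<partial>M)\<rparr>"

lemma borel_measurable_cnj [measurable (raw)]:
  "f \<in> borel_measurable M \<Longrightarrow> (\<lambda>x. cnj (f x)) \<in> borel_measurable M"
  by (rule measurable_compose[OF _ borel_measurable_continuous_onI]) (auto intro: continuous_intros)

lemma L2_measurable [measurable_dest]: "f \<in> L2 M \<Longrightarrow> f \<in> borel_measurable M"
  and L2_integrable: "f \<in> L2 M \<Longrightarrow> integrable M (\<lambda>x. (cmod (f x))\<^sup>2)"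
  by (simp_all add: L2_def)

lemma L2_dominated:
  assumes "g \<in> L2 M" "f \<in> borel_measurable M" "AE x in M. cmod (f x) \<le> cmod (g x)"
  shows "f \<in> L2 M"
proof -
  note [measurable] = assms(2)
  have "integrable M (\<lambda>x. (cmod (f x))\<^sup>2)"
    by (rule Bochner_Integration.integrable_bound[OF L2_integrable[OF assms(1)]])
      (use assms(3) in \<open>auto simp: power_mono elim!: eventually_mono\<close>)
  then show ?thesis using assms(2) by (simp add: L2_def)
qed

lemma L2_zero [simp]: "(\<lambda>_. 0) \<in> L2 M"
  by (simp add: L2_def)

lemma L2_smult [simp]: "f \<in> L2 M \<Longrightarrow> (\<lambda>x. c * f x) \<in> L2 M"
  by (auto simp: L2_def norm_mult power_mult_distrib)

lemma L2_uminus [simp]: "f \<in> L2 M \<Longrightarrow> (\<lambda>x. - f x) \<in> L2 M"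
  using L2_smult[of f M "-1"] by simp

lemma norm_add_sq_le: "(cmod (x + y))\<^sup>2 \<le> 2 * ((cmod x)\<^sup>2 + (cmod y)\<^sup>2)"
proof -
  have "(cmod (x + y))\<^sup>2 \<le> (cmod x + cmod y)\<^sup>2"
    by (intro power_mono norm_triangle_ineq) auto
  also have "\<dots> \<le> 2 * ((cmod x)\<^sup>2 + (cmod y)\<^sup>2)"
    using sum_squares_bound[of "cmod x" "cmod y"] by (simp add: power2_sum)
  finally show ?thesis .
qed

lemma L2_add [simp]:
  assumes "f \<in> L2 M" "g \<in> L2 M"
  shows "(\<lambda>x. f x + g x) \<in> L2 M"
proof -
  note [measurable] = assms[THEN L2_measurable]
  have "integrable M (\<lambda>x. (cmod (f x + g x))\<^sup>2)"
    by (rule Bochner_Integration.integrable_bound[where f = "\<lambda>x. 2 * ((cmod (f x))\<^sup>2 + (cmod (g x))\<^sup>2)"])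
      (use assms norm_add_sq_le in \<open>auto simp: L2_integrable\<close>)
  then show ?thesis by (simp add: L2_def)
qed

lemma L2_diff [simp]: "f \<in> L2 M \<Longrightarrow> g \<in> L2 M \<Longrightarrow> (\<lambda>x. f x - g x) \<in> L2 M"
  using L2_add[of f M "\<lambda>x. - g x"] by simp

lemma L2_bounded_mult:
  assumes "f \<in> L2 M" "g \<in> borel_measurable M" "\<And>x. cmod (g x) \<le> C"
  shows "(\<lambda>x. g x * f x) \<in> L2 M"
proof (rule L2_dominated[OF L2_smult[OF assms(1), of "of_real C"]])
  note [measurable] = L2_measurable[OF assms(1)] assms(2)
  show "(\<lambda>x. g x * f x) \<in> borel_measurable M" by simp
  have "cmod (g x * f x) \<le> cmod (of_real C * f x)" for x
    using assms(3)[of x] unfolding norm_mult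
    by (intro mult_right_mono) (auto intro: order_trans)
  then show "AE x in M. cmod (g x * f x) \<le> cmod (of_real C * f x)" by simp
qed

lemma L2_mult_integrable:
  assumes "f \<in> L2 M" "g \<in> L2 M"
  shows "integrable M (\<lambda>x. f x * g x)"
proof (rule Bochner_Integration.integrable_bound[where f = "\<lambda>x. (cmod (f x))\<^sup>2 + (cmod (g x))\<^sup>2"])
  note [measurable] = assms[THEN L2_measurable]
  show "(\<lambda>x. f x * g x) \<in> borel_measurable M" by simp
  have "cmod (f x * g x) \<le> (cmod (f x))\<^sup>2 + (cmod (g x))\<^sup>2" for x
  proof -
    have "2 * (cmod (f x) * cmod (g x)) \<le> (cmod (f x))\<^sup>2 + (cmod (g x))\<^sup>2"
      using sum_squares_bound[of "cmod (f x)" "cmod (g x)"] by (simp add: mult.assoc)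
    moreover have "0 \<le> cmod (f x) * cmod (g x)" by simp
    ultimately show ?thesis unfolding norm_mult by linarith
  qed
  then show "AE x in M. norm (f x * g x) \<le> norm ((cmod (f x))\<^sup>2 + (cmod (g x))\<^sup>2)"
    unfolding real_norm_def by (intro always_eventually allI order_trans[OF _ abs_ge_self])
qed (use assms in \<open>simp add: L2_integrable\<close>)

lemma L2_cnj [simp]: "f \<in> L2 M \<Longrightarrow> (\<lambda>x. cnj (f x)) \<in> L2 M"
  by (auto simp: L2_def)

lemma L2_ip_integrable:
  "f \<in> L2 M \<Longrightarrow> g \<in> L2 M \<Longrightarrow> integrable M (\<lambda>x. f x * cnj (g x))"
  using L2_mult_integrable[of f M "\<lambda>x. cnj (g x)"] by simp

lemma cls_eq_iff:
  assumes "f \<in> L2 M" "g \<in> L2 M"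
  shows "cls M f = cls M g \<longleftrightarrow> (AE x in M. f x = g x)"
proof
  assume "cls M f = cls M g"
  moreover have "f \<in> cls M f" using assms by (simp add: cls_def L2_measurable)
  ultimately show "AE x in M. f x = g x" by (simp add: cls_def)
next
  assume eq: "AE x in M. f x = g x"
  have "(AE x in M. h x = f x) \<longleftrightarrow> (AE x in M. h x = g x)" for h
  proof
    show "AE x in M. h x = g x" if "AE x in M. h x = f x"
      using that eq by eventually_elim simp
    show "AE x in M. h x = f x" if "AE x in M. h x = g x"
      using that eq by eventually_elim simp
  qed
  then show "cls M f = cls M g" by (simp add: cls_def)
qed

lemma rep_L2 [simp]: "rep M X \<in> L2 M"
proof (cases "X \<in> cls M ` L2 M")
  case True
  then have "\<exists>f. f \<in> L2 M \<and> cls M f = X" by auto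
  then have "(SOME f. f \<in> L2 M \<and> cls M f = X) \<in> L2 M"
    by (rule someI2_ex) simp
  then show ?thesis using True by (simp add: rep_def)
qed (simp add: rep_def)

lemma cls_rep: "X \<in> cls M ` L2 M \<Longrightarrow> cls M (rep M X) = X"
proof -
  assume X: "X \<in> cls M ` L2 M"
  then have "\<exists>f. f \<in> L2 M \<and> cls M f = X" by auto
  then have "cls M (SOME f. f \<in> L2 M \<and> cls M f = X) = X"
    by (rule someI2_ex) simp
  then show ?thesis using X by (simp add: rep_def)
qed

lemma rep_cls: "f \<in> L2 M \<Longrightarrow> AE x in M. rep M (cls M f) x = f x"
  using cls_rep[of "cls M f" M] by (simp add: cls_eq_iff)

lemma L2_carrier: "carrier (L2_space M) = cls M ` L2 M"
  by (simp add: L2_space_def)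

lemma cls_carrier [simp]: "f \<in> L2 M \<Longrightarrow> cls M f \<in> carrier (L2_space M)"
  by (simp add: L2_carrier)

lemma carrier_cases:
  assumes "X \<in> carrier (L2_space M)"
  obtains f where "f \<in> L2 M" "X = cls M f"
  using assms by (auto simp: L2_carrier)

lemma cls_zero: "\<zero>\<^bsub>L2_space M\<^esub> = cls M (\<lambda>_. 0)"
  by (simp add: L2_space_def)

lemma cls_add:
  assumes "f \<in> L2 M" "g \<in> L2 M"
  shows "cls M f \<oplus>\<^bsub>L2_space M\<^esub> cls M g = cls M (\<lambda>x. f x + g x)"
proof -
  have "AE x in M. rep M (cls M f) x + rep M (cls M g) x = f x + g x"
    using rep_cls[OF assms(1)] rep_cls[OF assms(2)] by eventually_elim simp
  then show ?thesis
    using assms by (simp add: L2_space_def cls_eq_iff)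
qed

lemma cls_smult:
  assumes "f \<in> L2 M"
  shows "c \<odot>\<^bsub>L2_space M\<^esub> cls M f = cls M (\<lambda>x. c * f x)"
proof -
  have "AE x in M. c * rep M (cls M f) x = c * f x"
    using rep_cls[OF assms(1)] by eventually_elim simp
  then show ?thesis
    using assms by (simp add: L2_space_def cls_eq_iff)
qed

lemma cls_ip:
  assumes "f \<in> L2 M" "g \<in> L2 M"
  shows "ip (L2_space M) (cls M f) (cls M g) = (\<integral>x. f x * cnj (g x) \<partial>M)"
proof -
  note [measurable] = assms[THEN L2_measurable] rep_L2[THEN L2_measurable]
  have "AE x in M. rep M (cls M f) x * cnj (rep M (cls M g) x) = f x * cnj (g x)"
    using rep_cls[OF assms(1)] rep_cls[OF assms(2)] by eventually_elim simp
  then have "(\<integral>x. rep M (cls M f) x * cnj (rep M (cls M g) x) \<partial>M) = (\<integral>x. f x * cnj (g x) \<partial>M)"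
    by (intro integral_cong_AE) measurable
  then show ?thesis by (simp add: L2_space_def)
qed

lemma abelian_group_L2: "abelian_group (L2_space M)"
proof (rule abelian_groupI)
  fix X assume "X \<in> carrier (L2_space M)"
  then obtain f where f: "f \<in> L2 M" "X = cls M f" by (rule carrier_cases)
  then show "\<exists>Y\<in>carrier (L2_space M). Y \<oplus>\<^bsub>L2_space M\<^esub> X = \<zero>\<^bsub>L2_space M\<^esub>"
    by (intro bexI[of _ "cls M (\<lambda>x. - f x)"]) (simp_all add: cls_add cls_zero)
qed (auto elim!: carrier_cases simp: cls_add cls_zero add_ac)

lemma cls_minus:
  assumes "f \<in> L2 M"
  shows "\<ominus>\<^bsub>L2_space M\<^esub> cls M f = cls M (\<lambda>x. - f x)"
proof -
  interpret abelian_group "L2_space M" by (rule abelian_group_L2)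
  show ?thesis
    using assms by (intro minus_equality) (simp_all add: cls_add cls_zero)
qed

lemma cls_diff:
  assumes "f \<in> L2 M" "g \<in> L2 M"
  shows "cls M f \<ominus>\<^bsub>L2_space M\<^esub> cls M g = cls M (\<lambda>x. f x - g x)"
  using assms by (simp add: a_minus_def cls_minus cls_add)

lemma module_L2: "module complex_field (L2_space M)"
  by (rule moduleI) (auto elim!: carrier_cases
      simp: cring_complex_field abelian_group_L2 cls_add cls_smult algebra_simps)

lemma hnorm_cls: "f \<in> L2 M \<Longrightarrow> hnorm (L2_space M) (cls M f) = sqrt (\<integral>x. (cmod (f x))\<^sup>2 \<partial>M)"
proof -
  assume f: "f \<in> L2 M"
  have "(\<integral>x. f x * cnj (f x) \<partial>M) = complex_of_real (\<integral>x. (cmod (f x))\<^sup>2 \<partial>M)"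
    by (simp add: complex_norm_square[symmetric] flip: integral_complex_of_real)
  then show ?thesis
    using f by (simp add: hnorm_def cls_ip)
qed

lemma hnorm_cls_sq: "f \<in> L2 M \<Longrightarrow> (hnorm (L2_space M) (cls M f))\<^sup>2 = (\<integral>x. (cmod (f x))\<^sup>2 \<partial>M)"
  by (simp add: hnorm_cls)

lemma nn_integral_hnorm:
  "f \<in> L2 M \<Longrightarrow> (\<integral>\<^sup>+x. ennreal ((cmod (f x))\<^sup>2) \<partial>M) = ennreal ((hnorm (L2_space M) (cls M f))\<^sup>2)"
  by (subst nn_integral_eq_integral) (auto simp: L2_integrable hnorm_cls_sq)

lemma pre_hilbert_L2: "pre_hilbert_space (L2_space M)"
proof (intro pre_hilbert_space.intro pre_hilbert_space_axioms.intro module_L2)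
  fix X Y Z c
  assume "X \<in> carrier (L2_space M)" "Y \<in> carrier (L2_space M)" "Z \<in> carrier (L2_space M)"
  then obtain f g h where *: "X = cls M f" "Y = cls M g" "Z = cls M h" "f \<in> L2 M" "g \<in> L2 M" "h \<in> L2 M"
    by (meson carrier_cases)
  show "ip (L2_space M) (X \<oplus>\<^bsub>L2_space M\<^esub> Y) Z = ip (L2_space M) X Z + ip (L2_space M) Y Z"
    using * by (simp add: cls_add cls_ip distrib_right L2_ip_integrable)
next
  fix X Y c
  assume "X \<in> carrier (L2_space M)" "Y \<in> carrier (L2_space M)"
  then obtain f g where *: "X = cls M f" "Y = cls M g" "f \<in> L2 M" "g \<in> L2 M"
    by (meson carrier_cases)
  show "ip (L2_space M) (c \<odot>\<^bsub>L2_space M\<^esub> X) Y = c * ip (L2_space M) X Y"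
    using * by (simp add: cls_smult cls_ip mult.assoc L2_ip_integrable)
  show "ip (L2_space M) Y X = cnj (ip (L2_space M) X Y)"
    using * by (simp add: cls_ip mult.commute flip: Bochner_Integration.integral_cnj)
next
  fix X assume "X \<in> carrier (L2_space M)"
  then obtain f where *: "X = cls M f" "f \<in> L2 M"
    by (meson carrier_cases)
  note [measurable] = L2_measurable[OF *(2)]
  have ip: "ip (L2_space M) X X = complex_of_real (\<integral>x. (cmod (f x))\<^sup>2 \<partial>M)"
    using * by (simp add: cls_ip complex_norm_square[symmetric] flip: integral_complex_of_real)
  then show "0 \<le> Re (ip (L2_space M) X X)" by simp
  assume "ip (L2_space M) X X = 0"
  then have "(\<integral>x. (cmod (f x))\<^sup>2 \<partial>M) = 0"
    by (simp only: ip of_real_eq_0_iff)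
  then have "AE x in M. (cmod (f x))\<^sup>2 = 0"
    using * L2_integrable[of f M] by (subst (asm) integral_nonneg_eq_0_iff_AE) auto
  then show "X = \<zero>\<^bsub>L2_space M\<^esub>"
    using * by (simp add: cls_zero cls_eq_iff)
qed

text \<open>Symmetry and nonnegativity are needed for all sets, so even the difference of sets that
  are not classes has to be computed. It is always the class of the difference of the
  representatives, and \<open>hdist\<close> is then an integral formula.\<close>

lemma L2_Metric_space: "Metric_space (carrier (L2_space M)) (hdist (L2_space M))"
proof -
  let ?H = "L2_space M"
  interpret pre_hilbert_space ?H by (rule pre_hilbert_L2)
  define r where "r X = rep M X" for X
  have add_rep: "X \<oplus>\<^bsub>?H\<^esub> Y = cls M (\<lambda>x. r X x + r Y x)" for X Y
    by (simp add: L2_space_def r_def)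
  have neg: "\<ominus>\<^bsub>?H\<^esub> Y = cls M (\<lambda>x. - r Y x)" for Y
  proof (cases "Y \<in> carrier ?H")
    case True
    then show ?thesis using cls_minus[of "rep M Y" M] cls_rep[of Y M] by (simp add: L2_carrier r_def)
  next
    case False
    then have r0: "r Y = (\<lambda>_. 0)" by (auto simp: r_def rep_def L2_carrier)
    \<comment> \<open>A set outside the carrier is represented by 0, so it acts as a neutral element
      and its formal inverse is the zero class.\<close>
    have "Z \<oplus>\<^bsub>?H\<^esub> Y = Z \<and> Y \<oplus>\<^bsub>?H\<^esub> Z = Z" if "Z \<in> carrier ?H" for Z
      using that cls_rep[of Z M] by (simp add: add_rep r0 L2_carrier) (simp add: r_def)
    then have "(THE Z. Z \<in> carrier ?H \<and> Y \<oplus>\<^bsub>?H\<^esub> Z = \<zero>\<^bsub>?H\<^esub> \<and> Z \<oplus>\<^bsub>?H\<^esub> Y = \<zero>\<^bsub>?H\<^esub>) = \<zero>\<^bsub>?H\<^esub>"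
      by (intro the_equality) auto
    then show ?thesis by (simp add: a_inv_def m_inv_def r0 cls_zero)
  qed
  have d: "X \<ominus>\<^bsub>?H\<^esub> Y = cls M (\<lambda>x. r X x - r Y x)" for X Y
  proof -
    have "AE x in M. r X x + r (cls M (\<lambda>x. - r Y x)) x = r X x - r Y x"
      using rep_cls[of "\<lambda>x. - r Y x" M] by (auto simp: r_def elim!: eventually_mono)
    then show ?thesis
      by (simp add: a_minus_def neg add_rep cls_eq_iff r_def)
  qed
  have hd: "hdist ?H X Y = sqrt (\<integral>x. (cmod (r X x - r Y x))\<^sup>2 \<partial>M)" for X Y
    by (simp add: hdist_def d hnorm_cls r_def)
  show ?thesis
  proof unfold_locales
    fix X Y
    show "0 \<le> hdist ?H X Y"
      by (simp add: hd)
    show "hdist ?H X Y = hdist ?H Y X"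
      by (simp add: hd norm_minus_commute)
  qed (simp_all add: hdist_triangle hdist_eq_0_iff)
qed

text \<open>Along a subsequence with summable increments the pointwise limit exists, and Fatou's lemma
  makes it the limit in norm.\<close>

lemma L2_complete: "Metric_space.mcomplete (carrier (L2_space M)) (hdist (L2_space M))"
proof -
  let ?H = "L2_space M"
  interpret pre_hilbert_space ?H by (rule pre_hilbert_L2)
  interpret Metric_space "carrier ?H" "hdist ?H" by (rule L2_Metric_space)
  have nn: "(\<integral>\<^sup>+x. ennreal ((cmod (f x - g x))\<^sup>2) \<partial>M) = ennreal ((hdist ?H (cls M f) (cls M g))\<^sup>2)"
    if "f \<in> L2 M" "g \<in> L2 M" for f g
    using that by (simp add: hdist_def cls_diff nn_integral_hnorm)
  show ?thesis
    unfolding mcomplete_def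
  proof (intro allI impI)
    fix \<sigma> assume C: "MCauchy \<sigma>"
    have "\<sigma> n \<in> carrier ?H" for n
      using C unfolding MCauchy_def by blast
    then have "\<forall>n. \<exists>f. f \<in> L2 M \<and> \<sigma> n = cls M f"
      by (meson carrier_cases)
    then obtain F where F: "\<And>n. F n \<in> L2 M" "\<And>n. \<sigma> n = cls M (F n)" by metis
    have "\<forall>k. \<exists>N. \<forall>n n'. N \<le> n \<longrightarrow> N \<le> n' \<longrightarrow> hdist ?H (\<sigma> n) (\<sigma> n') < (1/3) ^ k"
      using C unfolding MCauchy_def by simp
    then obtain N where N: "\<And>k n n'. N k \<le> n \<Longrightarrow> N k \<le> n' \<Longrightarrow> hdist ?H (\<sigma> n) (\<sigma> n') < (1/3) ^ k"
      by metis
    \<comment> \<open>Partial sums give an index that is at least each of \<open>N 0\<close>, ...,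
      \<open>N k\<close>.\<close>
    define r where "r k = (\<Sum>i\<le>k. N i)" for k
    have Nr: "N k \<le> r l" if "k \<le> l" for k l
      unfolding r_def using that by (intro member_le_sum) auto
    define G where "G k = F (r k)" for k
    have G: "G k \<in> L2 M" for k by (simp add: G_def F)
    note [measurable] = G[THEN L2_measurable] F(1)[THEN L2_measurable]
    define D where "D k x = G (Suc k) x - G k x" for k x
    have [measurable]: "D k \<in> borel_measurable M" for k
      unfolding D_def by measurable
    have D: "(\<integral>\<^sup>+x. ennreal ((cmod (D k x))\<^sup>2) \<partial>M) \<le> ennreal ((1/9) ^ k)" for k
    proof -
      have "(hdist ?H (cls M (G (Suc k))) (cls M (G k)))\<^sup>2 \<le> ((1/3) ^ k)\<^sup>2"
        using N[of k "r (Suc k)" "r k"] Nr[of k] by (intro power_mono) (auto simp: G_def F(2)[symmetric])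
      also have "\<dots> = (1/9) ^ k"
        by (simp add: power2_eq_square flip: power_mult_distrib)
      finally show ?thesis
        unfolding D_def nn[OF G G] by (rule ennreal_leI)
    qed
    \<comment> \<open>The weights \<open>2 ^ k\<close> are beaten by the bound
      \<open>(1/9) ^ k\<close>, so the weighted sum is finite almost everywhere. This forces
      \<open>cmod (D k x)\<close> below a geometric sequence of ratio \<open>sqrt (1/2)\<close>
      without any triangle inequality for infinite sums of norms.\<close>
    have "(\<integral>\<^sup>+x. (\<Sum>k. ennreal (2 ^ k * (cmod (D k x))\<^sup>2)) \<partial>M) = (\<Sum>k. \<integral>\<^sup>+x. ennreal (2 ^ k * (cmod (D k x))\<^sup>2) \<partial>M)"
      by (intro nn_integral_suminf) simp
    also have "\<dots> = (\<Sum>k. ennreal (2 ^ k) * (\<integral>\<^sup>+x. ennreal ((cmod (D k x))\<^sup>2) \<partial>M))"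
      by (simp add: ennreal_mult nn_integral_cmult)
    also have "\<dots> \<le> (\<Sum>k. ennreal (2 ^ k) * ennreal ((1/9) ^ k))"
      by (intro suminf_le mult_left_mono D) auto
    also have "\<dots> = (\<Sum>k. ennreal ((2/9) ^ k))"
      by (simp add: ennreal_mult[symmetric] power_mult_distrib[symmetric])
    also have "\<dots> = ennreal (\<Sum>k. (2/9) ^ k)"
      by (intro suminf_ennreal2) (auto intro: summable_geometric)
    finally have "(\<integral>\<^sup>+x. (\<Sum>k. ennreal (2 ^ k * (cmod (D k x))\<^sup>2)) \<partial>M) \<noteq> \<infinity>"
      by (auto simp: top_unique)
    then have AE1: "AE x in M. (\<Sum>k. ennreal (2 ^ k * (cmod (D k x))\<^sup>2)) \<noteq> \<infinity>"
      by (intro nn_integral_PInf_AE) auto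
    define f where "f = (\<lambda>x. lim (\<lambda>k. G k x))"
    have fm: "f \<in> borel_measurable M"
      unfolding f_def by (rule borel_measurable_lim_metric) (rule G[THEN L2_measurable])
    note [measurable] = fm
    have lim: "AE x in M. (\<lambda>k. G k x) \<longlonglongrightarrow> f x"
    proof (rule eventually_mono[OF AE1])
      fix x assume elim: "(\<Sum>k. ennreal (2 ^ k * (cmod (D k x))\<^sup>2)) \<noteq> \<infinity>"
      define u where "u = (\<lambda>k. ennreal (2 ^ k * (cmod (D k x))\<^sup>2))"
      have "suminf u \<noteq> \<infinity>" using elim unfolding u_def .
      then obtain S where S: "S \<ge> 0" "suminf u = ennreal S"
        by (cases "suminf u") auto
      have b: "cmod (D k x) \<le> sqrt S * (sqrt (1/2)) ^ k" for k
      proof -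
        have "u k \<le> ennreal S"
          using sum_le_suminf[of u "{k}"] S(2) by simp
        then have "ennreal (2 ^ k * (cmod (D k x))\<^sup>2) \<le> ennreal S"
          by (simp only: u_def)
        then have "2 ^ k * (cmod (D k x))\<^sup>2 \<le> S"
          using S(1) by simp
        then have "(cmod (D k x))\<^sup>2 \<le> S * (1/2) ^ k"
          by (simp add: field_simps power_one_over)
        then have "cmod (D k x) \<le> sqrt (S * (1/2) ^ k)"
          by (rule real_le_rsqrt)
        then show ?thesis by (simp add: real_sqrt_mult real_sqrt_power)
      qed
      have "sqrt (1/2) < (1::real)" by (simp add: real_sqrt_lt_1_iff)
      then have "summable (\<lambda>k. D k x)"
        by (intro summable_comparison_test'[OF summable_mult[OF summable_geometric], of _ 0 _ "sqrt S"]) (use b in auto)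
      then have "convergent (\<lambda>n. \<Sum>k<n. D k x)"
        by (simp add: summable_iff_convergent)
      moreover have "(\<Sum>k<n. D k x) = G n x - G 0 x" for n
        unfolding D_def by (rule sum_lessThan_telescope)
      ultimately have "convergent (\<lambda>n. G n x - G 0 x)" by simp
      then have "convergent (\<lambda>n. G n x)"
        using convergent_add[OF _ convergent_const[of "G 0 x"]] by fastforce
      then show "(\<lambda>k. G k x) \<longlonglongrightarrow> f x"
        unfolding f_def by (simp add: convergent_LIMSEQ_iff)
    qed
    have Fatou: "(\<integral>\<^sup>+x. ennreal ((cmod (f x - F n x))\<^sup>2) \<partial>M) \<le> ennreal (((1/3) ^ k)\<^sup>2)" if n: "n \<ge> N k" for n k
    proof -
      have "AE x in M. ennreal ((cmod (f x - F n x))\<^sup>2) = liminf (\<lambda>j. ennreal ((cmod (G j x - F n x))\<^sup>2))"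
        using lim
      proof eventually_elim
        case (elim x)
        then have "(\<lambda>j. ennreal ((cmod (G j x - F n x))\<^sup>2)) \<longlonglongrightarrow> ennreal ((cmod (f x - F n x))\<^sup>2)"
          by (intro tendsto_ennrealI tendsto_intros)
        then show ?case using lim_imp_Liminf[OF sequentially_bot] by metis
      qed
      then have "(\<integral>\<^sup>+x. ennreal ((cmod (f x - F n x))\<^sup>2) \<partial>M) = (\<integral>\<^sup>+x. liminf (\<lambda>j. ennreal ((cmod (G j x - F n x))\<^sup>2)) \<partial>M)"
        by (rule nn_integral_cong_AE)
      also have "\<dots> \<le> liminf (\<lambda>j. \<integral>\<^sup>+x. ennreal ((cmod (G j x - F n x))\<^sup>2) \<partial>M)"
        by (intro nn_integral_liminf) simp
      also have "\<dots> \<le> ennreal (((1/3) ^ k)\<^sup>2)"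
      proof (rule Liminf_le)
        have "(\<integral>\<^sup>+x. ennreal ((cmod (G j x - F n x))\<^sup>2) \<partial>M) \<le> ennreal (((1/3) ^ k)\<^sup>2)" if "j \<ge> k" for j
          unfolding nn[OF G F(1)] using N[of k "r j" n] n Nr[OF that]
          by (intro ennreal_leI power_mono) (auto simp: G_def F(2)[symmetric])
        then show "\<forall>\<^sub>F j in sequentially. (\<integral>\<^sup>+x. ennreal ((cmod (G j x - F n x))\<^sup>2) \<partial>M) \<le> ennreal (((1/3) ^ k)\<^sup>2)"
          unfolding eventually_sequentially by blast
      qed simp
      finally show ?thesis .
    qed
    have "integrable M (\<lambda>x. (cmod (f x - F (N 0) x))\<^sup>2)"
      using Fatou[of 0 "N 0"] by (intro integrableI_bounded) (auto intro: le_less_trans)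
    then have "(\<lambda>x. f x - F (N 0) x) \<in> L2 M"
      by (simp add: L2_def)
    from L2_add[OF this F(1)[of "N 0"]] have f: "f \<in> L2 M" by simp
    have dist: "hdist ?H (\<sigma> n) (cls M f) \<le> (1/3) ^ k" if "n \<ge> N k" for n k
    proof -
      have "ennreal ((hdist ?H (cls M f) (cls M (F n)))\<^sup>2) \<le> ennreal (((1/3) ^ k)\<^sup>2)"
        using Fatou[OF that] nn[OF f F(1)] by simp
      then have "(hdist ?H (cls M f) (cls M (F n)))\<^sup>2 \<le> ((1/3) ^ k)\<^sup>2"
        by (subst (asm) ennreal_le_iff) simp_all
      then have "hdist ?H (cls M f) (cls M (F n)) \<le> (1/3) ^ k"
        by (rule power2_le_imp_le) simp
      then show ?thesis by (simp add: F(2) commute)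
    qed
    show "\<exists>x. limitin mtopology \<sigma> x sequentially"
      unfolding limit_metric_sequentially
    proof (rule exI[of _ "cls M f"], intro conjI allI impI)
      show "cls M f \<in> carrier ?H" using f by simp
      fix e :: real assume "e > 0"
      then obtain k where "(1/3) ^ k < e"
        using real_arch_pow_inv[of e "1/3"] by auto
      then have "\<sigma> n \<in> carrier ?H \<and> hdist ?H (\<sigma> n) (cls M f) < e" if "n \<ge> N k" for n
        using dist[OF that] F(1) by (simp add: F(2))
      then show "\<exists>N. \<forall>n\<ge>N. \<sigma> n \<in> carrier ?H \<and> hdist ?H (\<sigma> n) (cls M f) < e"
        by blast
    qed
  qed
qed

lemma hilbert_L2: "hilbert_metric_space (L2_space M)"
proof -
  interpret pre_hilbert_space "L2_space M" by (rule pre_hilbert_L2)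
  have "complex_hilbert_space (L2_space M)"
    by unfold_locales (fact ip_add ip_smult ip_cnj ip_nonneg ip_definite L2_complete)+
  then show ?thesis
    by (rule hilbert_metric_space.intro) (rule L2_Metric_space)
qed

section \<open>Multiplication by the variable\<close>

locale herglotz_measure =
  fixes M :: "real measure" and a :: real
  assumes sets_M [measurable_cong]: "sets M = sets borel"
    and infinite_M: "emeasure M UNIV = \<infinity>"
    and weight: "has_bochner_integral M (\<lambda>t. 1 / (1 + t\<^sup>2)) a"
    and a_pos: "0 < a"
begin

sublocale hilbert_metric_space "L2_space M"
  by (rule hilbert_L2)

abbreviation H where "H \<equiv> L2_space M"

lemma space_M [simp]: "space M = UNIV"
  using sets_eq_imp_space_eq[OF sets_M] by simp

lemma one_plus_sq [simp]: "1 + t\<^sup>2 \<noteq> 0" "0 < 1 + t\<^sup>2" for t :: real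
  by (simp_all add: add_pos_nonneg less_imp_neq[symmetric])

lemma one_plus_sq_complex [simp]: "1 + (complex_of_real t)\<^sup>2 \<noteq> 0"
proof -
  have "1 + (complex_of_real t)\<^sup>2 = of_real (1 + t\<^sup>2)" by simp
  then show ?thesis by (metis of_real_eq_0_iff one_plus_sq(1))
qed

lemma resolvent_denom: "Im z \<noteq> 0 \<Longrightarrow> complex_of_real t - z \<noteq> 0"
  by (auto simp: complex_eq_iff)

lemma resolvent_bound: "Im z \<noteq> 0 \<Longrightarrow> cmod (1 / (complex_of_real t - z)) \<le> 1 / \<bar>Im z\<bar>"
  using abs_Im_le_cmod[of "complex_of_real t - z"] by (simp add: norm_divide frac_le)

lemma L2_resolvent: "Im z \<noteq> 0 \<Longrightarrow> f \<in> L2 M \<Longrightarrow> (\<lambda>t. f t / (complex_of_real t - z)) \<in> L2 M"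
  using L2_bounded_mult[of f M "\<lambda>t. 1 / (complex_of_real t - z)" "1 / \<bar>Im z\<bar>"] resolvent_bound[of z]
  by simp

text \<open>\<open>w0\<close> and \<open>w1\<close> are the imaginary and real parts of
  \<open>1 / (t - \<i>)\<close>. The relations \<open>t w0 = w1\<close> and
  \<open>w0 + t w1 = 1\<close> allow both boundary maps to be written as inner products with
  them.\<close>

definition w0 :: "real \<Rightarrow> complex" where "w0 t = of_real (1 / (1 + t\<^sup>2))"

definition w1 :: "real \<Rightarrow> complex" where "w1 t = of_real (t / (1 + t\<^sup>2))"

definition kern :: "complex \<Rightarrow> real \<Rightarrow> complex" where "kern z t = 1 / (of_real t - z)"

lemma measurable_w [measurable]: "w0 \<in> borel_measurable M" "w1 \<in> borel_measurable M" "kern z \<in> borel_measurable M"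
  unfolding w0_def[abs_def] w1_def[abs_def] kern_def[abs_def] by measurable

lemma weight_integrable: "integrable M (\<lambda>t. 1 / (1 + t\<^sup>2))" and weight_integral: "(\<integral>t. 1 / (1 + t\<^sup>2) \<partial>M) = a"
  using weight by (simp_all add: has_bochner_integral_iff)

lemma w0_integral: "(\<integral>t. w0 t \<partial>M) = of_real a"
  using weight_integral unfolding w0_def by (simp only: integral_complex_of_real)

lemma kern_norm_sq: "(cmod (kern \<i> t))\<^sup>2 = 1 / (1 + t\<^sup>2)"
  by (simp add: kern_def norm_divide power_divide cmod_power2 add.commute)

lemma kern_i_L2: "kern \<i> \<in> L2 M"
  using weight_integrable by (simp add: L2_def kern_norm_sq)

lemma w_L2 [simp]: "w0 \<in> L2 M" "w1 \<in> L2 M"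
proof -
  have 1: "(cmod (w0 t))\<^sup>2 \<le> (cmod (kern \<i> t))\<^sup>2" "(cmod (w1 t))\<^sup>2 \<le> (cmod (kern \<i> t))\<^sup>2" for t
  proof -
    define x where "x = 1 / (1 + t\<^sup>2)"
    have x: "0 \<le> x" "x \<le> 1" "t\<^sup>2 * x \<le> 1"
      by (simp_all add: x_def divide_le_eq add_pos_nonneg)
    have "(1 / (1 + t\<^sup>2))\<^sup>2 = x * x" "(t / (1 + t\<^sup>2))\<^sup>2 = (t\<^sup>2 * x) * x"
      by (simp_all add: x_def power2_eq_square)
    then have "(1 / (1 + t\<^sup>2))\<^sup>2 \<le> 1 / (1 + t\<^sup>2)" "(t / (1 + t\<^sup>2))\<^sup>2 \<le> 1 / (1 + t\<^sup>2)"
      using mult_right_mono[OF x(2,1)] mult_right_mono[OF x(3,1)] by (simp_all add: x_def)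
    then show "(cmod (w0 t))\<^sup>2 \<le> (cmod (kern \<i> t))\<^sup>2" "(cmod (w1 t))\<^sup>2 \<le> (cmod (kern \<i> t))\<^sup>2"
      by (simp_all only: kern_norm_sq w0_def w1_def norm_of_real power2_abs)
  qed
  show "w0 \<in> L2 M" "w1 \<in> L2 M"
    using 1 by (auto intro!: L2_dominated[OF kern_i_L2] intro: power2_le_imp_le)
qed

lemma kern_L2 [simp]: "Im z \<noteq> 0 \<Longrightarrow> kern z \<in> L2 M"
proof -
  assume z: "Im z \<noteq> 0"
  \<comment> \<open>The resolvent identity reduces a general \<open>z\<close> to the point
    \<open>\<i>\<close>, where the squared modulus is the weight itself.\<close>
  have "(\<lambda>t. kern \<i> t + (z - \<i>) * (kern \<i> t / (of_real t - z))) \<in> L2 M"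
    using z kern_i_L2 by (intro L2_add L2_smult L2_resolvent)
  moreover have "kern \<i> t + (z - \<i>) * (kern \<i> t / (of_real t - z)) = kern z t" for t
  proof -
    have *: "1 / p + (p - q) * (1 / p / q) = 1 / q" if "p \<noteq> 0" "q \<noteq> 0" for p q :: complex
      using that by (simp add: field_simps)
    show ?thesis
      using *[of "of_real t - \<i>" "of_real t - z"] resolvent_denom[OF z, of t] resolvent_denom[of \<i> t]
      by (simp add: kern_def)
  qed
  ultimately show ?thesis by simp
qed

lemma const_not_L2: "(\<lambda>_. c) \<in> L2 M \<Longrightarrow> c = 0"
proof (rule ccontr)
  assume c: "(\<lambda>_. c) \<in> L2 M" "c \<noteq> 0"
  then have "integrable M (\<lambda>_. (cmod c)\<^sup>2)"
    using L2_integrable by blast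
  then have "(\<integral>\<^sup>+x. ennreal (norm ((cmod c)\<^sup>2)) \<partial>M) < \<infinity>"
    by (simp only: integrable_iff_bounded)
  then show False
    using c infinite_M by (simp add: ennreal_mult_top)
qed

text \<open>The relation "\<open>g\<close> is \<open>A* f\<close> and \<open>c\<close> is
  \<open>\<gamma> f\<close>" at the level of functions rather than classes.\<close>

definition tri :: "(real \<Rightarrow> complex) \<Rightarrow> (real \<Rightarrow> complex) \<Rightarrow> complex \<Rightarrow> bool" where
  "tri f g c \<longleftrightarrow> f \<in> L2 M \<and> g \<in> L2 M \<and> (AE t in M. g t = of_real t * f t - c)"

text \<open>The regularised integral of \<open>f - c w1\<close>, rewritten as a sum of products of
  square-integrable functions: convergence is then clear and the constant no longer appears.\<close>

definition dl :: "(real \<Rightarrow> complex) \<Rightarrow> (real \<Rightarrow> complex) \<Rightarrow> complex" where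
  "dl f g = (\<integral>t. f t * w0 t + g t * w1 t \<partial>M)"

definition A0 :: "(real \<Rightarrow> complex) set operator" where
  "A0 = {(cls M f, cls M g) | f g. tri f g 0 \<and> dl f g = 0}"

definition A1 :: "(real \<Rightarrow> complex) set operator" where
  "A1 = {(cls M f, cls M g) | f g c. tri f g c}"

lemma triD: "tri f g c \<Longrightarrow> f \<in> L2 M" "tri f g c \<Longrightarrow> g \<in> L2 M" "tri f g c \<Longrightarrow> AE t in M. g t = of_real t * f t - c"
  by (simp_all add: tri_def)

lemma tri_add:
  assumes "tri f g c" "tri f' g' c'"
  shows "tri (\<lambda>t. f t + f' t) (\<lambda>t. g t + g' t) (c + c')"
proof -
  have "AE t in M. g t + g' t = of_real t * (f t + f' t) - (c + c')"
    using triD(3)[OF assms(1)] triD(3)[OF assms(2)] by eventually_elim (simp add: algebra_simps)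
  then show ?thesis using assms by (simp add: tri_def)
qed

lemma tri_smult:
  assumes "tri f g c"
  shows "tri (\<lambda>t. b * f t) (\<lambda>t. b * g t) (b * c)"
proof -
  have "AE t in M. b * g t = of_real t * (b * f t) - b * c"
    using triD(3)[OF assms] by eventually_elim (simp only: right_diff_distrib mult.left_commute)
  then show ?thesis using assms by (simp add: tri_def)
qed

lemma tri_kern: "Im z \<noteq> 0 \<Longrightarrow> tri (kern z) (\<lambda>t. z * kern z t) 1"
proof -
  assume z: "Im z \<noteq> 0"
  have "z * kern z t = of_real t * kern z t - 1" for t
    using resolvent_denom[OF z, of t] by (simp add: kern_def field_simps)
  then show ?thesis
    unfolding tri_def using kern_L2[OF z] L2_smult[OF kern_L2[OF z]] by blast
qed

lemma tri_resolvent: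
  assumes z: "Im z \<noteq> 0" and h: "h \<in> L2 M"
  shows "tri (\<lambda>t. h t / (of_real t - z)) (\<lambda>t. h t + z * (h t / (of_real t - z))) 0"
proof -
  have "h t + z * (h t / (of_real t - z)) = of_real t * (h t / (of_real t - z)) - 0" for t
    using resolvent_denom[OF z, of t] by (simp add: field_simps)
  then show ?thesis
    unfolding tri_def using L2_resolvent[OF z h] L2_add[OF h L2_smult[OF L2_resolvent[OF z h]]] by blast
qed

lemma tri_unique:
  assumes "tri f g c" "tri f' g' c'" "AE t in M. f t = f' t"
  shows "(AE t in M. g t = g' t) \<and> c = c'"
proof -
  have *: "AE t in M. c' - c = g t - g' t"
    using triD(3)[OF assms(1)] triD(3)[OF assms(2)] assms(3) by eventually_elim (simp add: algebra_simps)
  have "(\<lambda>t. g t - g' t) \<in> L2 M"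
    using assms triD by auto
  then have "(\<lambda>_. c' - c) \<in> L2 M"
    by (rule L2_dominated) (use * in \<open>auto elim!: eventually_mono\<close>)
  then have "c' - c = 0" by (rule const_not_L2)
  then show ?thesis using * by (auto elim!: eventually_mono)
qed

lemma dl_integrable: "f \<in> L2 M \<Longrightarrow> g \<in> L2 M \<Longrightarrow> integrable M (\<lambda>t. f t * w0 t + g t * w1 t)"
  by (intro Bochner_Integration.integrable_add L2_mult_integrable) simp_all

lemma w_id: "of_real t * w0 t = w1 t" "w0 t + of_real t * w1 t = 1"
  using one_plus_sq_complex[of t]
  by (simp_all add: w0_def w1_def power2_eq_square add_divide_distrib[symmetric] flip: of_real_mult)

lemma dl_pointwise: "AE t in M. f t * w0 t + g t * w1 t = f t - c * w1 t" if "tri f g c"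
  using triD(3)[OF that]
proof eventually_elim
  case (elim t)
  have "f t * w0 t + g t * w1 t = f t * (w0 t + of_real t * w1 t) - c * w1 t"
    by (simp add: elim algebra_simps)
  then show ?case by (simp add: w_id)
qed

text \<open>Pointwise the left integrand is \<open>f cnj d - c cnj g\<close>, whose terms need not
  be integrable separately. Subtracting \<open>c cnj d w1\<close> from both makes them the
  integrands of the two \<open>dl\<close> terms.\<close>

lemma green_tri:
  assumes f: "tri f f' c" and g: "tri g g' d"
  shows "(\<integral>t. f' t * cnj (g t) \<partial>M) - (\<integral>t. f t * cnj (g' t) \<partial>M) = dl f f' * cnj d - c * cnj (dl g g')"
proof -
  note [simp] = triD(1,2)[OF f] triD(1,2)[OF g]
  note [measurable] = L2_measurable[OF triD(1)[OF f]] L2_measurable[OF triD(2)[OF f]]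
    L2_measurable[OF triD(1)[OF g]] L2_measurable[OF triD(2)[OF g]]
  have "(\<integral>t. f' t * cnj (g t) \<partial>M) - (\<integral>t. f t * cnj (g' t) \<partial>M) = (\<integral>t. f' t * cnj (g t) - f t * cnj (g' t) \<partial>M)"
    by (simp add: L2_ip_integrable)
  also have "\<dots> = (\<integral>t. (f t * w0 t + f' t * w1 t) * cnj d - c * cnj (g t * w0 t + g' t * w1 t) \<partial>M)"
  proof (rule integral_cong_AE)
    show "AE t in M. f' t * cnj (g t) - f t * cnj (g' t) = (f t * w0 t + f' t * w1 t) * cnj d - c * cnj (g t * w0 t + g' t * w1 t)"
      using dl_pointwise[OF f] dl_pointwise[OF g] triD(3)[OF f] triD(3)[OF g]
    proof eventually_elim
      case (elim t)
      have "cnj (w1 t) = w1 t" by (simp add: w1_def)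
      then show ?case
        unfolding elim(1,2) by (simp add: elim(3,4) algebra_simps)
    qed
  qed measurable
  also have "\<dots> = dl f f' * cnj d - c * cnj (dl g g')"
  proof -
    have i: "integrable M (\<lambda>t. (f t * w0 t + f' t * w1 t) * cnj d)" "integrable M (\<lambda>t. c * cnj (g t * w0 t + g' t * w1 t))"
      by (intro integrable_mult_left integrable_mult_right integrable_cnj dl_integrable; simp)+
    have "(\<integral>t. c * cnj (g t * w0 t + g' t * w1 t) \<partial>M) = c * cnj (dl g g')"
      unfolding dl_def by (simp only: integral_mult_right_zero Bochner_Integration.integral_cnj)
    then show ?thesis
      using i by (simp only: Bochner_Integration.integral_diff dl_def integral_mult_left_zero)
  qed
  finally show ?thesis .
qed

text \<open>Because \<open>t w0 = w1\<close>, the combination on the left eliminates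
  \<open>f\<close> and leaves \<open>c w0\<close>. This gives a formula for the boundary constant
  that is bounded in the graph norm.\<close>

lemma gm_tri:
  assumes f: "tri f g c"
  shows "(\<integral>t. f t * w1 t - g t * w0 t \<partial>M) = c * of_real a"
proof -
  note [measurable] = L2_measurable[OF triD(1)[OF f]] L2_measurable[OF triD(2)[OF f]]
  have "(\<integral>t. f t * w1 t - g t * w0 t \<partial>M) = (\<integral>t. c * w0 t \<partial>M)"
  proof (rule integral_cong_AE)
    show "AE t in M. f t * w1 t - g t * w0 t = c * w0 t"
      using triD(3)[OF f]
    proof eventually_elim
      case (elim t)
      show ?case unfolding elim w_id(1)[symmetric] by (simp add: algebra_simps)
    qed
  qed measurable
  then show ?thesis by (simp add: w0_integral)
qed

lemma kern_i_cnj: "cnj (kern \<i> t) = 1 / (of_real t + \<i>)"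
  by (simp add: kern_def)

lemma kern_i_norm: "(\<integral>t. kern \<i> t * cnj (kern \<i> t) \<partial>M) = of_real a"
proof -
  have "kern \<i> t * cnj (kern \<i> t) = w0 t" for t
    by (simp only: complex_norm_square[symmetric] kern_norm_sq w0_def)
  then show ?thesis by (simp only: w0_integral)
qed

text \<open>One inclusion is Green's identity. For the other, the resolvent of multiplication by
  \<open>t\<close> at \<open>\<i>\<close> is subtracted from an element of the adjoint; the
  remainder is orthogonal to the range of \<open>A0 + \<i>\<close>, which contains every vector
  orthogonal to \<open>kern \<i>\<close>, so it is a multiple of \<open>kern \<i>\<close>.\<close>

lemma adjoint_A0: "adjoint_op H A0 = A1"
proof (intro equalityI subrelI)
  fix X Y assume "(X, Y) \<in> A1"
  then obtain g g' d where g: "X = cls M g" "Y = cls M g'" "tri g g' d"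
    by (auto simp: A1_def)
  show "(X, Y) \<in> adjoint_op H A0"
  proof (rule adjoint_opI)
    fix F F' assume "(F, F') \<in> A0"
    then obtain f f' where f: "F = cls M f" "F' = cls M f'" "tri f f' 0" "dl f f' = 0"
      by (auto simp: A0_def)
    show "ip H F' X = ip H F Y"
      using green_tri[OF f(3) g(3)] f g triD by (simp add: cls_ip)
  qed (use g triD in auto)
next
  fix X Y assume XY: "(X, Y) \<in> adjoint_op H A0"
  then obtain g h where g: "X = cls M g" "g \<in> L2 M" and h: "Y = cls M h" "h \<in> L2 M"
    by (meson adjoint_op_carrier carrier_cases)
  \<comment> \<open>Solves \<open>(t - \<i>) w = h - \<i> g\<close>, so that
    \<open>n = g - w\<close> is formally a defect vector at \<open>\<i>\<close>.\<close>
  define w where "w t = (h t - \<i> * g t) / (of_real t - \<i>)" for t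
  have wL: "w \<in> L2 M"
    unfolding w_def[abs_def] using g h by (intro L2_resolvent) auto
  define n where "n t = g t - w t" for t
  have nL: "n \<in> L2 M" unfolding n_def[abs_def] using g wL by simp
  \<comment> \<open>The coefficient of the projection onto \<open>kern \<i>\<close>, whose squared
    norm is \<open>a\<close>.\<close>
  define c where "c = (\<integral>t. n t * cnj (kern \<i> t) \<partial>M) / of_real a"
  define m where "m t = n t - c * kern \<i> t" for t
  have mL: "m \<in> L2 M" unfolding m_def[abs_def] using nL by simp
  have mk: "(\<integral>t. m t * cnj (kern \<i> t) \<partial>M) = 0"
  proof -
    have "(\<integral>t. m t * cnj (kern \<i> t) \<partial>M) = (\<integral>t. n t * cnj (kern \<i> t) - c * (kern \<i> t * cnj (kern \<i> t)) \<partial>M)"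
      by (simp add: m_def algebra_simps)
    also have "\<dots> = (\<integral>t. n t * cnj (kern \<i> t) \<partial>M) - c * of_real a"
      using nL L2_ip_integrable[of n M "kern \<i>"] L2_ip_integrable[of "kern \<i>" M "kern \<i>"]
      by (subst Bochner_Integration.integral_diff) (simp_all add: kern_i_norm)
    finally show ?thesis using a_pos by (simp add: c_def)
  qed
  \<comment> \<open>Chosen so that \<open>(t + \<i>) f = m\<close>. Its \<open>dl\<close> value is
    the inner product of \<open>m\<close> with \<open>kern \<i>\<close>, which is 0, so
    \<open>f\<close> belongs to the domain of \<open>A0\<close>.\<close>
  define f where "f t = m t / (of_real t - (- \<i>))" for t
  define f' where "f' t = m t + (- \<i>) * f t" for t
  have f: "tri f f' 0"
    using tri_resolvent[of "- \<i>" m] mL unfolding f'_def[abs_def] f_def[abs_def] by simp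
  note fL = triD(1,2)[OF f]
  note [measurable] = mL[THEN L2_measurable] nL[THEN L2_measurable] fL[THEN L2_measurable]
    g(2)[THEN L2_measurable] h(2)[THEN L2_measurable] wL[THEN L2_measurable]
  have "dl f f' = (\<integral>t. m t * cnj (kern \<i> t) \<partial>M)"
    unfolding dl_def
  proof (rule integral_cong_AE)
    show "AE t in M. f t * w0 t + f' t * w1 t = m t * cnj (kern \<i> t)"
      using dl_pointwise[OF f] by eventually_elim (simp add: f_def kern_i_cnj)
  qed measurable
  then have "(cls M f, cls M f') \<in> A0"
    using f mk by (auto simp: A0_def)
  then have eq: "(\<integral>t. f' t * cnj (g t) \<partial>M) = (\<integral>t. f t * cnj (h t) \<partial>M)"
    using adjoint_opD[OF XY, of "cls M f" "cls M f'"] g h fL by (simp add: cls_ip)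
  \<comment> \<open>The defining relation of the adjoint, tested with \<open>f\<close>, thus says
    that \<open>m\<close> is orthogonal to \<open>n\<close>, and hence to itself.\<close>
  have pt: "f' t * cnj (g t) - f t * cnj (h t) = m t * cnj (n t)" for t
  proof -
    have nz: "complex_of_real t + \<i> \<noteq> 0" by (auto simp: complex_eq_iff)
    have m: "m t = f t * (of_real t + \<i>)" using nz by (simp add: f_def)
    have "cnj (w t) * (of_real t + \<i>) = cnj (h t) + \<i> * cnj (g t)"
      using nz by (simp add: w_def)
    then have "m t * cnj (w t) = f t * (cnj (h t) + \<i> * cnj (g t))"
      unfolding m by (simp add: mult.assoc mult.commute)
    then show ?thesis by (simp add: n_def f'_def algebra_simps)
  qed
  have "(\<integral>t. m t * cnj (n t) \<partial>M) = (\<integral>t. f' t * cnj (g t) \<partial>M) - (\<integral>t. f t * cnj (h t) \<partial>M)"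
    unfolding pt[symmetric] using fL g h by (intro Bochner_Integration.integral_diff L2_ip_integrable)
  then have mn: "(\<integral>t. m t * cnj (n t) \<partial>M) = 0"
    using eq by simp
  have "ip H (cls M m) (cls M m) = (\<integral>t. m t * cnj (n t) - cnj c * (m t * cnj (kern \<i> t)) \<partial>M)"
    using mL by (simp add: cls_ip m_def algebra_simps)
  also have "\<dots> = 0"
    using mL nL by (subst Bochner_Integration.integral_diff) (simp_all add: L2_ip_integrable mn mk)
  finally have "cls M m = cls M (\<lambda>_. 0)"
    using mL ip_definite[of "cls M m"] by (simp add: cls_zero)
  then have "AE t in M. m t = 0"
    using mL by (simp add: cls_eq_iff)
  then have "AE t in M. h t = of_real t * g t - c"
  proof eventually_elim
    case (elim t)
    have nz: "complex_of_real t - \<i> \<noteq> 0" by (auto simp: complex_eq_iff)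
    have "g t - w t = c * kern \<i> t"
      using elim by (simp add: m_def n_def)
    then have "(g t - w t) * (of_real t - \<i>) = c"
      using nz by (simp add: kern_def)
    moreover have "w t * (of_real t - \<i>) = h t - \<i> * g t"
      using nz by (simp add: w_def)
    ultimately show ?case by (simp add: algebra_simps)
  qed
  then show "(X, Y) \<in> A1"
    using g h unfolding A1_def tri_def by blast
qed

text \<open>The formula of \<open>gm_tri\<close> solved for \<open>c\<close>; inner products make it
  independent of representatives.\<close>

definition gamma :: "(real \<Rightarrow> complex) set \<Rightarrow> complex" where
  "gamma X = (ip H X (cls M w1) - ip H (op_apply (adjoint_op H A0) X) (cls M w0)) / of_real a"

definition delta :: "(real \<Rightarrow> complex) set \<Rightarrow> complex" where
  "delta X = ip H X (cls M w0) + ip H (op_apply (adjoint_op H A0) X) (cls M w1)"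

lemma A1_apply: "tri f g c \<Longrightarrow> op_apply (adjoint_op H A0) (cls M f) = cls M g"
  unfolding adjoint_A0 op_apply_def
proof (rule the_equality)
  assume f: "tri f g c"
  show "(cls M f, cls M g) \<in> A1" using f by (auto simp: A1_def)
  fix Y assume "(cls M f, Y) \<in> A1"
  then obtain f' g' c' where *: "cls M f' = cls M f" "Y = cls M g'" "tri f' g' c'"
    by (auto simp: A1_def)
  then have "AE t in M. f' t = f t"
    using f triD(1) by (simp add: cls_eq_iff)
  then have "AE t in M. g' t = g t"
    using tri_unique[OF *(3) f] by blast
  then show "Y = cls M g"
    using f * triD(2) by (simp add: cls_eq_iff)
qed

lemma gamma_tri: "tri f g c \<Longrightarrow> gamma (cls M f) = c"
proof -
  assume f: "tri f g c"
  note L = triD(1,2)[OF f]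
  have "cnj (w0 t) = w0 t" "cnj (w1 t) = w1 t" for t by (simp_all add: w0_def w1_def)
  then have "gamma (cls M f) = ((\<integral>t. f t * w1 t \<partial>M) - (\<integral>t. g t * w0 t \<partial>M)) / of_real a"
    using L by (simp add: gamma_def A1_apply[OF f] cls_ip)
  also have "\<dots> = (\<integral>t. f t * w1 t - g t * w0 t \<partial>M) / of_real a"
    using L by (simp add: L2_mult_integrable)
  finally show ?thesis using gm_tri[OF f] a_pos by simp
qed

lemma delta_tri: "tri f g c \<Longrightarrow> delta (cls M f) = dl f g"
proof -
  assume f: "tri f g c"
  note L = triD(1,2)[OF f]
  have "cnj (w0 t) = w0 t" "cnj (w1 t) = w1 t" for t by (simp_all add: w0_def w1_def)
  then show ?thesis
    using L by (simp add: delta_def A1_apply[OF f] cls_ip dl_def L2_mult_integrable)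
qed

lemma A1_cases:
  assumes "(X, Y) \<in> adjoint_op H A0"
  obtains f g c where "tri f g c" "X = cls M f" "Y = cls M g"
  using assms unfolding adjoint_A0 A1_def by blast

lemma dl_add: "\<lbrakk>f \<in> L2 M; g \<in> L2 M; f' \<in> L2 M; g' \<in> L2 M\<rbrakk> \<Longrightarrow>
    dl (\<lambda>t. f t + f' t) (\<lambda>t. g t + g' t) = dl f g + dl f' g'"
  using dl_integrable[of f g] dl_integrable[of f' g']
  unfolding dl_def by (subst Bochner_Integration.integral_add[symmetric]) (simp_all add: algebra_simps)

lemma dl_smult: "dl (\<lambda>t. b * f t) (\<lambda>t. b * g t) = b * dl f g"
  unfolding dl_def by (simp add: mult.assoc distrib_left[symmetric])

text \<open>Identifies the Weyl function with the integral in the representation of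
  \<open>V\<close>, that is \<open>V\<close> without the constant \<open>Q\<close>.\<close>

lemma dl_kern: "Im z \<noteq> 0 \<Longrightarrow> dl (kern z) (\<lambda>t. z * kern z t) = (\<integral>t. kern z t - w1 t \<partial>M)"
proof -
  assume z: "Im z \<noteq> 0"
  note [measurable] = measurable_w
  show ?thesis
    unfolding dl_def
    using dl_pointwise[OF tri_kern[OF z]] by (intro integral_cong_AE) (auto elim!: eventually_mono)
qed

lemma dl_kern_i: "dl (kern \<i>) (\<lambda>t. \<i> * kern \<i> t) = \<i> * of_real a"
  "dl (kern (- \<i>)) (\<lambda>t. (- \<i>) * kern (- \<i>) t) = - \<i> * of_real a"
proof -
  have *: "kern \<i> t - w1 t = \<i> * w0 t" "kern (- \<i>) t - w1 t = - \<i> * w0 t" for t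
  proof -
    have f: "1 + (complex_of_real t)\<^sup>2 = (of_real t - \<i>) * (of_real t + \<i>)"
      by (simp add: algebra_simps power2_eq_square)
    have "complex_of_real t - \<i> \<noteq> 0" "complex_of_real t + \<i> \<noteq> 0"
      by (auto simp: complex_eq_iff)
    then show "kern \<i> t - w1 t = \<i> * w0 t" "kern (- \<i>) t - w1 t = - \<i> * w0 t"
      by (simp_all add: kern_def w0_def w1_def f divide_simps)
  qed
  have "dl (kern \<i>) (\<lambda>t. \<i> * kern \<i> t) = (\<integral>t. \<i> * w0 t \<partial>M)"
    "dl (kern (- \<i>)) (\<lambda>t. (- \<i>) * kern (- \<i>) t) = (\<integral>t. - \<i> * w0 t \<partial>M)"
    using dl_kern[of \<i>] dl_kern[of "- \<i>"] by (simp_all only: *) simp_all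
  then show "dl (kern \<i>) (\<lambda>t. \<i> * kern \<i> t) = \<i> * of_real a"
    "dl (kern (- \<i>)) (\<lambda>t. (- \<i>) * kern (- \<i>) t) = - \<i> * of_real a"
    by (simp_all only: integral_mult_right_zero w0_integral)
qed

lemma A0_cases:
  assumes "(X, Y) \<in> A0"
  obtains f g where "X = cls M f" "Y = cls M g" "tri f g 0" "dl f g = 0"
  using assms unfolding A0_def by blast

lemma A0_I: "tri f g 0 \<Longrightarrow> dl f g = 0 \<Longrightarrow> (cls M f, cls M g) \<in> A0"
  unfolding A0_def by blast

lemma A0_apply: "(X, Y) \<in> A0 \<Longrightarrow> op_apply (adjoint_op H A0) X = Y"
  by (erule A0_cases) (simp add: A1_apply)

section \<open>Linearity and density of the symmetric operator\<close>

lemma linear_A0: "linear_operator H A0"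
  unfolding linear_operator_def
proof (intro conjI)
  show "A0 \<subseteq> carrier H \<times> carrier H"
  proof (rule subrelI)
    fix X Y assume "(X, Y) \<in> A0"
    then obtain f g where *: "X = cls M f" "Y = cls M g" "tri f g 0" by (rule A0_cases)
    show "(X, Y) \<in> carrier H \<times> carrier H"
      using * triD(1,2)[OF *(3)] by simp
  qed
  show "single_valued A0"
    using A0_apply by (metis single_valuedI)
  have "tri (\<lambda>_. 0) (\<lambda>_. 0) 0" "dl (\<lambda>_. 0) (\<lambda>_. 0) = 0"
    by (simp_all add: tri_def dl_def)
  then show "(\<zero>\<^bsub>H\<^esub>, \<zero>\<^bsub>H\<^esub>) \<in> A0"
    unfolding cls_zero by (rule A0_I)
  show "\<forall>(X, X')\<in>A0. \<forall>(Y, Y')\<in>A0. (X \<oplus>\<^bsub>H\<^esub> Y, X' \<oplus>\<^bsub>H\<^esub> Y') \<in> A0"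
  proof clarify
    fix X X' Y Y' assume X: "(X, X') \<in> A0" and Y: "(Y, Y') \<in> A0"
    obtain f f' where f: "X = cls M f" "X' = cls M f'" "tri f f' 0" "dl f f' = 0"
      using X by (rule A0_cases)
    obtain g g' where g: "Y = cls M g" "Y' = cls M g'" "tri g g' 0" "dl g g' = 0"
      using Y by (rule A0_cases)
    note L = triD(1,2)[OF f(3)] triD(1,2)[OF g(3)]
    have "tri (\<lambda>t. f t + g t) (\<lambda>t. f' t + g' t) 0" "dl (\<lambda>t. f t + g t) (\<lambda>t. f' t + g' t) = 0"
      using tri_add[OF f(3) g(3)] f g L by (simp_all add: dl_add)
    then show "(X \<oplus>\<^bsub>H\<^esub> Y, X' \<oplus>\<^bsub>H\<^esub> Y') \<in> A0"
      using L by (simp add: f g cls_add A0_I)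
  qed
  show "\<forall>c. \<forall>(X, X')\<in>A0. (c \<odot>\<^bsub>H\<^esub> X, c \<odot>\<^bsub>H\<^esub> X') \<in> A0"
  proof clarify
    fix c X X' assume X: "(X, X') \<in> A0"
    obtain f f' where f: "X = cls M f" "X' = cls M f'" "tri f f' 0" "dl f f' = 0"
      using X by (rule A0_cases)
    have "tri (\<lambda>t. c * f t) (\<lambda>t. c * f' t) 0" "dl (\<lambda>t. c * f t) (\<lambda>t. c * f' t) = 0"
      using tri_smult[OF f(3), of c] f by (simp_all add: dl_smult)
    then show "(c \<odot>\<^bsub>H\<^esub> X, c \<odot>\<^bsub>H\<^esub> X') \<in> A0"
      using triD(1,2)[OF f(3)] by (simp add: f cls_smult A0_I)
  qed
qed

text \<open>The weight is at least \<open>1 / (1 + n^2)\<close> on the interval.\<close>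

lemma interval_finite: "emeasure M {-n..n} < \<infinity>" for n :: real
proof -
  have "integrable M (\<lambda>t. indicator {-n..n} t :: real)"
  proof (rule Bochner_Integration.integrable_bound)
    show "integrable M (\<lambda>t. (1 + n\<^sup>2) * (1 / (1 + t\<^sup>2)))"
      using weight_integrable by (rule integrable_mult_right)
    have "indicator {-n..n} t \<le> (1 + n\<^sup>2) * (1 / (1 + t\<^sup>2))" for t
    proof (cases "t \<in> {-n..n}")
      case True
      then have "\<bar>t\<bar> \<le> \<bar>n\<bar>" by auto
      then have "t\<^sup>2 \<le> n\<^sup>2" by (simp add: abs_le_square_iff)
      then show ?thesis using True by (simp add: divide_simps add_pos_nonneg)
    qed simp
    then show "AE t in M. norm (indicator {-n..n} t :: real) \<le> norm ((1 + n\<^sup>2) * (1 / (1 + t\<^sup>2)))"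
      by (intro always_eventually allI) (simp add: abs_of_nonneg)
  qed measurable
  then show ?thesis
    by (subst (asm) integrable_indicator_iff) (auto simp: sets_M)
qed

lemma indicator_L2 [simp]: "(\<lambda>t. indicator {-n..n} t) \<in> L2 M" for n :: real
proof -
  have "(cmod (indicator {-n..n} t))\<^sup>2 = indicator {-n..n} t" for t
    by (simp add: indicator_def)
  moreover have "integrable M (\<lambda>t. indicator {-n..n} t :: real)"
    using interval_finite by (intro integrable_real_indicator) (simp_all add: sets_M)
  moreover have "(\<lambda>t. indicator {-n..n} t :: complex) \<in> borel_measurable M"
    by measurable
  ultimately show ?thesis by (simp add: L2_def)
qed

lemma interval_unbounded: "\<exists>m::nat. C < measure M {-real m..real m}"
proof (rule ccontr)
  assume "\<nexists>m::nat. C < measure M {-real m..real m}"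
  then have "emeasure M {-real m..real m} \<le> ennreal C" for m
    using interval_finite[of "real m"] by (subst emeasure_eq_ennreal_measure) (auto simp: not_less ennreal_leI)
  then have "(SUP m. emeasure M {-real m..real m}) \<le> ennreal C"
    by (intro SUP_least)
  also have "(SUP m. emeasure M {-real m..real m}) = emeasure M (\<Union>m. {-real m..real m})"
    by (intro SUP_emeasure_incseq) (auto simp: sets_M incseq_def)
  also have "(\<Union>m. {-real m..real m}) = UNIV"
  proof -
    have "\<exists>m. x \<in> {-real m..real m}" for x
    proof -
      obtain m where "\<bar>x\<bar> \<le> real m" using real_arch_simple by blast
      then show ?thesis by (intro exI[of _ m]) (auto simp: abs_le_iff)
    qed
    then show ?thesis by blast
  qed
  finally show False using infinite_M by (simp add: top_unique)
qed

lemma truncation: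
  assumes w: "w \<in> L2 M"
  shows "(\<lambda>n. hnorm H (cls M (\<lambda>t. w t - indicator {-real n..real n} t * w t))) \<longlonglongrightarrow> 0"
proof -
  note [measurable] = w[THEN L2_measurable]
  have wn: "(\<lambda>t. indicator {-real n..real n} t * w t) \<in> L2 M" for n
    using w by (intro L2_bounded_mult[where C = 1]) (auto simp: indicator_def)
  have "(\<lambda>n. \<integral>t. (cmod (w t - indicator {-real n..real n} t * w t))\<^sup>2 \<partial>M) \<longlonglongrightarrow> (\<integral>t. 0 \<partial>M)"
  proof (rule integral_dominated_convergence[where w = "\<lambda>t. (cmod (w t))\<^sup>2"])
    show "AE t in M. (\<lambda>n. (cmod (w t - indicator {-real n..real n} t * w t))\<^sup>2) \<longlonglongrightarrow> 0"
    proof (rule AE_I2, rule tendsto_eventually)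
      fix t :: real
      obtain N where "\<bar>t\<bar> \<le> real N" using real_arch_simple by blast
      then have "(cmod (w t - indicator {-real n..real n} t * w t))\<^sup>2 = 0" if "n \<ge> N" for n
        using that by (auto simp: indicator_def)
      then show "\<forall>\<^sub>F n in sequentially. (cmod (w t - indicator {-real n..real n} t * w t))\<^sup>2 = 0"
        unfolding eventually_sequentially by blast
    qed
    show "AE t in M. norm ((cmod (w t - indicator {-real n..real n} t * w t))\<^sup>2) \<le> (cmod (w t))\<^sup>2" for n
      by (auto simp: indicator_def)
  qed (use w in \<open>auto simp: L2_integrable\<close>)
  then have "(\<lambda>n. sqrt (\<integral>t. (cmod (w t - indicator {-real n..real n} t * w t))\<^sup>2 \<partial>M)) \<longlonglongrightarrow> sqrt 0"
    by (intro tendsto_real_sqrt) simp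
  then show ?thesis
    using w wn by (simp add: hnorm_cls)
qed

text \<open>Truncating \<open>w\<close> changes its norm by little, and the integral can then be corrected by a
  multiple of the normalised indicator of \<open>[-m, m]\<close>, whose norm tends to \<open>0\<close> since \<open>M\<close> is infinite.\<close>

lemma dense_A0: "densely_defined H A0"
proof -
  have "\<exists>Y \<in> Domain A0. Y \<in> mball X r" if X: "X \<in> carrier H" and r: "r > 0" for X r
  proof -
    obtain w where w: "w \<in> L2 M" "X = cls M w" using X by (rule carrier_cases)
    have "\<forall>\<^sub>F n in sequentially. hnorm H (cls M (\<lambda>t. w t - indicator {-real n..real n} t * w t)) < r / 2"
      using order_tendstoD(2)[OF truncation[OF w(1)], of "r / 2"] r by simp
    then obtain n where n: "hnorm H (cls M (\<lambda>t. w t - indicator {-real n..real n} t * w t)) < r / 2"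
      by (auto simp: eventually_sequentially)
    define v where "v t = indicator {-real n..real n} t * w t" for t
    have vL: "v \<in> L2 M"
      unfolding v_def[abs_def] using w by (intro L2_bounded_mult[where C = 1]) (auto simp: indicator_def)
    have tvL: "(\<lambda>t. of_real t * v t) \<in> L2 M"
    proof -
      have "(\<lambda>t. (indicator {-real n..real n} t * of_real t) * w t) \<in> L2 M"
        using w by (intro L2_bounded_mult[where C = "real n"]) (auto simp: indicator_def)
      then show ?thesis by (simp add: v_def[abs_def] mult_ac)
    qed
    define s where "s = (\<integral>t. v t \<partial>M)"
    \<comment> \<open>The correction \<open>q\<close> will have integral \<open>s\<close> and
      squared norm \<open>(cmod s)^2 / \<mu>\<close>; this \<open>m\<close> makes its norm less than
      \<open>r / 2\<close>.\<close>
    obtain m :: nat where m: "4 * (cmod s)\<^sup>2 / r\<^sup>2 < measure M {-real m..real m}"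
      using interval_unbounded by blast
    define \<mu> where "\<mu> = measure M {-real m..real m}"
    have \<mu>: "\<mu> > 0"
      using m unfolding \<mu>_def by (rule le_less_trans[rotated]) simp
    define b where "b = s / of_real \<mu>"
    define q where "q t = b * indicator {-real m..real m} t" for t
    have qL: "q \<in> L2 M" unfolding q_def[abs_def] by (intro L2_smult indicator_L2)
    have tqL: "(\<lambda>t. of_real t * q t) \<in> L2 M"
    proof -
      have "(\<lambda>t. (b * indicator {-real m..real m} t * of_real t) * indicator {-real m..real m} t) \<in> L2 M"
        by (intro L2_bounded_mult[where C = "cmod b * real m"] indicator_L2)
          (auto simp: indicator_def norm_mult intro!: mult_left_mono)
      moreover have "(b * indicator {-real m..real m} t * of_real t) * indicator {-real m..real m} t = of_real t * q t" for t
        by (simp add: q_def indicator_def)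
      ultimately show ?thesis by simp
    qed
    have "integrable M (\<lambda>t. indicator {-real m..real m} t :: complex)"
      using L2_mult_integrable[OF indicator_L2[of "real m"] indicator_L2[of "real m"]]
      by (simp add: indicator_inter_arith[symmetric])
    moreover have "(\<integral>t. (indicator {-real m..real m} t :: complex) \<partial>M) = of_real \<mu>"
    proof -
      have "(\<integral>t. (indicator {-real m..real m} t :: complex) \<partial>M)
          = (\<integral>t. complex_of_real (indicator {-real m..real m} t) \<partial>M)"
        by (intro Bochner_Integration.integral_cong) (auto simp: indicator_def)
      also have "\<dots> = of_real (\<integral>t. indicator {-real m..real m} t \<partial>M)"
        by (rule integral_complex_of_real)
      finally show ?thesis by (simp add: \<mu>_def sets_M)
    qed
    ultimately have ind: "integrable M (\<lambda>t. indicator {-real m..real m} t :: complex)"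
      "(\<integral>t. (indicator {-real m..real m} t :: complex) \<partial>M) = of_real \<mu>" by simp_all
    have vI: "integrable M v"
      using L2_mult_integrable[OF indicator_L2[of "real n"] w(1)] by (simp add: v_def[abs_def])
    have qI: "integrable M q" "(\<integral>t. q t \<partial>M) = s"
      unfolding q_def[abs_def] using ind \<mu> by (simp_all add: b_def)
    define f where "f t = v t - q t" for t
    have f: "tri f (\<lambda>t. of_real t * f t) 0"
    proof -
      have "(\<lambda>t. of_real t * v t - of_real t * q t) \<in> L2 M" "(\<lambda>t. v t - q t) \<in> L2 M"
        using vL tvL qL tqL by auto
      then show ?thesis by (simp add: tri_def f_def[abs_def] right_diff_distrib)
    qed
    have "dl f (\<lambda>t. of_real t * f t) = (\<integral>t. v t - q t \<partial>M)"
    proof -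
      have "f t * w0 t + of_real t * f t * w1 t = v t - q t" for t
      proof -
        have "f t * w0 t + of_real t * f t * w1 t = f t * (w0 t + of_real t * w1 t)"
          by (simp add: algebra_simps)
        then show ?thesis by (simp add: w_id f_def)
      qed
      then show ?thesis by (simp add: dl_def)
    qed
    also have "\<dots> = 0" using vI qI by (simp add: s_def)
    finally have fA: "(cls M f, cls M (\<lambda>t. of_real t * f t)) \<in> A0"
      using f by (intro A0_I)
    have hq: "hnorm H (cls M q) < r / 2"
    proof -
      have "(hnorm H (cls M q))\<^sup>2 = (\<integral>t. (cmod b)\<^sup>2 * indicator {-real m..real m} t \<partial>M)"
        unfolding hnorm_cls_sq[OF qL]
        by (intro Bochner_Integration.integral_cong) (auto simp: q_def indicator_def)
      also have "\<dots> = (cmod b)\<^sup>2 * \<mu>"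
        by (simp add: \<mu>_def sets_M)
      also have "\<dots> = (cmod s)\<^sup>2 / \<mu>"
        using \<mu> by (simp add: b_def norm_divide power_divide power2_eq_square)
      also have "\<dots> < (r / 2)\<^sup>2"
        using m \<mu> r unfolding \<mu>_def[symmetric] by (simp add: field_simps power2_eq_square)
      finally show ?thesis
        by (rule power_less_imp_less_base) (use r in simp)
    qed
    have "cls M w \<ominus>\<^bsub>H\<^esub> cls M f = cls M (\<lambda>t. w t - v t) \<oplus>\<^bsub>H\<^esub> cls M q"
      using w vL qL triD(1)[OF f] by (simp add: cls_diff cls_add f_def diff_diff_eq2 diff_add_eq)
    then have "hdist H X (cls M f) \<le> hnorm H (cls M (\<lambda>t. w t - v t)) + hnorm H (cls M q)"
      unfolding hdist_def w(2) using w vL qL by (simp add: hnorm_triangle)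
    also have "\<dots> < r"
      using n hq by (simp add: v_def)
    finally have "cls M f \<in> mball X r"
      using X triD(1)[OF f] by (simp add: in_mball)
    then show ?thesis using fA by blast
  qed
  then have "mtopology closure_of Domain A0 = carrier H"
    unfolding metric_closure_of by blast
  then show ?thesis by (simp add: densely_defined_def htop_eq)
qed

sublocale weyl_triple H A0 gamma delta "\<lambda>z. cls M (kern z)"
proof (intro weyl_triple.intro weyl_triple_axioms.intro boundary_triple.intro boundary_triple_axioms.intro
    hilbert_L2 linear_A0 dense_A0)
  fix X Y c assume "X \<in> Domain (adjoint_op H A0)" "Y \<in> Domain (adjoint_op H A0)"
  then obtain X' Y' where X: "(X, X') \<in> adjoint_op H A0" and Y: "(Y, Y') \<in> adjoint_op H A0" by blast
  obtain f f' d where f: "tri f f' d" "X = cls M f" using X by (rule A1_cases)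
  obtain g g' e where g: "tri g g' e" "Y = cls M g" using Y by (rule A1_cases)
  note L = triD(1,2)[OF f(1)] triD(1,2)[OF g(1)]
  show "gamma (X \<oplus>\<^bsub>H\<^esub> Y) = gamma X + gamma Y" "delta (X \<oplus>\<^bsub>H\<^esub> Y) = delta X + delta Y"
    using L by (simp_all add: f(2) g(2) cls_add gamma_tri[OF tri_add[OF f(1) g(1)]]
        delta_tri[OF tri_add[OF f(1) g(1)]] gamma_tri[OF f(1)] gamma_tri[OF g(1)]
        delta_tri[OF f(1)] delta_tri[OF g(1)] dl_add)
next
  fix X c assume "X \<in> Domain (adjoint_op H A0)"
  then obtain X' where X: "(X, X') \<in> adjoint_op H A0" by blast
  obtain f f' d where f: "tri f f' d" "X = cls M f" using X by (rule A1_cases)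
  show "gamma (c \<odot>\<^bsub>H\<^esub> X) = c * gamma X" "delta (c \<odot>\<^bsub>H\<^esub> X) = c * delta X"
    using triD(1,2)[OF f(1)] by (simp_all add: f(2) cls_smult gamma_tri[OF tri_smult[OF f(1)]]
        delta_tri[OF tri_smult[OF f(1)]] gamma_tri[OF f(1)] delta_tri[OF f(1)] dl_smult)
next
  fix X X' Y Y' assume X: "(X, X') \<in> adjoint_op H A0" and Y: "(Y, Y') \<in> adjoint_op H A0"
  obtain f f' d where f: "tri f f' d" "X = cls M f" "X' = cls M f'" using X by (rule A1_cases)
  obtain g g' e where g: "tri g g' e" "Y = cls M g" "Y' = cls M g'" using Y by (rule A1_cases)
  show "ip H X' Y - ip H X Y' = delta X * cnj (gamma Y) - gamma X * cnj (delta Y)"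
    using green_tri[OF f(1) g(1)] triD(1,2)[OF f(1)] triD(1,2)[OF g(1)]
    by (simp add: f g cls_ip gamma_tri[OF f(1)] gamma_tri[OF g(1)] delta_tri[OF f(1)] delta_tri[OF g(1)])
next
  fix p q :: complex
  \<comment> \<open>\<open>\<alpha>\<close> and \<open>\<beta>\<close> solve
    \<open>\<alpha> + \<beta> = p\<close> and \<open>\<i> a (\<alpha> - \<beta>) = q\<close>, the
    boundary values of the combination of \<open>kern \<i>\<close> and
    \<open>kern (- \<i>)\<close>.\<close>
  define \<alpha> where "\<alpha> = (p + q / (\<i> * of_real a)) / 2"
  define \<beta> where "\<beta> = (p - q / (\<i> * of_real a)) / 2"
  have t: "tri (\<lambda>t. \<alpha> * kern \<i> t + \<beta> * kern (- \<i>) t)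
      (\<lambda>t. \<alpha> * (\<i> * kern \<i> t) + \<beta> * ((- \<i>) * kern (- \<i>) t)) (\<alpha> * 1 + \<beta> * 1)"
    by (intro tri_add tri_smult tri_kern) simp_all
  have "dl (\<lambda>t. \<alpha> * kern \<i> t + \<beta> * kern (- \<i>) t) (\<lambda>t. \<alpha> * (\<i> * kern \<i> t) + \<beta> * ((- \<i>) * kern (- \<i>) t))
      = \<alpha> * dl (kern \<i>) (\<lambda>t. \<i> * kern \<i> t) + \<beta> * dl (kern (- \<i>)) (\<lambda>t. (- \<i>) * kern (- \<i>) t)"
    by (subst dl_add) (simp_all only: dl_smult L2_smult kern_L2, simp_all)
  also have "\<dots> = q"
    unfolding dl_kern_i using a_pos by (simp add: \<alpha>_def \<beta>_def field_simps)
  finally have "delta (cls M (\<lambda>t. \<alpha> * kern \<i> t + \<beta> * kern (- \<i>) t)) = q"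
    by (simp only: delta_tri[OF t])
  moreover have "gamma (cls M (\<lambda>t. \<alpha> * kern \<i> t + \<beta> * kern (- \<i>) t)) = p"
    unfolding gamma_tri[OF t] by (simp add: \<alpha>_def \<beta>_def field_simps)
  moreover have "cls M (\<lambda>t. \<alpha> * kern \<i> t + \<beta> * kern (- \<i>) t) \<in> Domain (adjoint_op H A0)"
    using t unfolding adjoint_A0 A1_def by blast
  ultimately show "\<exists>X\<in>Domain (adjoint_op H A0). gamma X = p \<and> delta X = q"
    by blast
next
  show "A0 = {(X, Y) \<in> adjoint_op H A0. gamma X = 0 \<and> delta X = 0}"
  proof (intro equalityI subrelI)
    fix X Y assume "(X, Y) \<in> A0"
    then obtain f g where f: "X = cls M f" "Y = cls M g" "tri f g 0" "dl f g = 0"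
      by (rule A0_cases)
    then have "(X, Y) \<in> adjoint_op H A0"
      unfolding adjoint_A0 A1_def by blast
    then show "(X, Y) \<in> {(X, Y) \<in> adjoint_op H A0. gamma X = 0 \<and> delta X = 0}"
      using f by (simp add: gamma_tri delta_tri)
  next
    fix X Y assume "(X, Y) \<in> {(X, Y) \<in> adjoint_op H A0. gamma X = 0 \<and> delta X = 0}"
    then have X: "(X, Y) \<in> adjoint_op H A0" and 0: "gamma X = 0" "delta X = 0" by auto
    obtain f g c where f: "tri f g c" "X = cls M f" "Y = cls M g" using X by (rule A1_cases)
    show "(X, Y) \<in> A0"
      using 0 f gamma_tri[OF f(1)] delta_tri[OF f(1)] by (simp add: A0_I)
  qed
next
  define C where "C = hnorm H (cls M w0) + hnorm H (cls M w1)"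
  have b: "cmod (ip H X (cls M u)) \<le> hnorm (plus_space H A0) X * hnorm H (cls M u)"
    "cmod (ip H (op_apply (adjoint_op H A0) X) (cls M u)) \<le> hnorm (plus_space H A0) X * hnorm H (cls M u)"
    if X: "X \<in> Domain (adjoint_op H A0)" and u: "u \<in> L2 M" for X u
  proof -
    obtain X' where X': "(X, X') \<in> adjoint_op H A0" using X by blast
    obtain f g c where f: "tri f g c" "X = cls M f" "X' = cls M g" using X' by (rule A1_cases)
    have ap: "op_apply (adjoint_op H A0) X = X'" using A1_apply[OF f(1)] f by simp
    have c: "X \<in> carrier H" "X' \<in> carrier H" using f triD(1,2)[OF f(1)] by simp_all
    have "hnorm H X \<le> hnorm (plus_space H A0) X" "hnorm H X' \<le> hnorm (plus_space H A0) X"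
      using c by (simp_all add: hnorm_def plus_space_def ap ip_nonneg)
    then show "cmod (ip H X (cls M u)) \<le> hnorm (plus_space H A0) X * hnorm H (cls M u)"
      "cmod (ip H (op_apply (adjoint_op H A0) X) (cls M u)) \<le> hnorm (plus_space H A0) X * hnorm H (cls M u)"
      unfolding ap using c u by (auto intro!: order_trans[OF Cauchy_Schwarz] mult_right_mono)
  qed
  have d: "cmod (ip H X (cls M w0) + ip H (op_apply (adjoint_op H A0) X) (cls M w1)) \<le> C * hnorm (plus_space H A0) X"
    "cmod (ip H X (cls M w1) - ip H (op_apply (adjoint_op H A0) X) (cls M w0)) \<le> C * hnorm (plus_space H A0) X"
    if X: "X \<in> Domain (adjoint_op H A0)" for X
    using b[OF X, of w0] b[OF X, of w1] norm_triangle_ineq[of "ip H X (cls M w0)" "ip H (op_apply (adjoint_op H A0) X) (cls M w1)"]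
      norm_triangle_ineq4[of "ip H X (cls M w1)" "ip H (op_apply (adjoint_op H A0) X) (cls M w0)"]
    by (simp_all add: C_def algebra_simps)
  show "\<exists>C. \<forall>X \<in> Domain (adjoint_op H A0). cmod (delta X) \<le> C * hnorm (plus_space H A0) X"
    unfolding delta_def using d(1) by blast
  have "cmod (gamma X) \<le> C / a * hnorm (plus_space H A0) X" if X: "X \<in> Domain (adjoint_op H A0)" for X
    unfolding gamma_def norm_divide using d(2)[OF X] a_pos by (simp add: divide_right_mono)
  then show "\<exists>C. \<forall>X \<in> Domain (adjoint_op H A0). cmod (gamma X) \<le> C * hnorm (plus_space H A0) X"
    by blast
next
  fix z :: complex assume z: "Im z \<noteq> 0"
  show "gamma (cls M (kern z)) = 1" by (rule gamma_tri[OF tri_kern[OF z]])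
  show "cls M (kern z) \<in> defect_space H A0 z"
    unfolding defect_space_def adjoint_A0 A1_def using tri_kern[OF z] kern_L2[OF z] cls_smult[OF kern_L2[OF z]]
    by blast
  let ?B = "{(X, Y) \<in> adjoint_op H A0. gamma X = 0}"
  have B_cases: "\<exists>f g. tri f g 0 \<and> X = cls M f \<and> Y = cls M g" if "(X, Y) \<in> ?B" for X Y
  proof -
    have X: "(X, Y) \<in> adjoint_op H A0" and 0: "gamma X = 0" using that by auto
    obtain f g c where f: "tri f g c" "X = cls M f" "Y = cls M g" using X by (rule A1_cases)
    then show ?thesis using gamma_tri[OF f(1)] 0 by auto
  qed
  have B_I: "(cls M f, cls M g) \<in> ?B" if "tri f g 0" for f g
  proof -
    have "(cls M f, cls M g) \<in> adjoint_op H A0" unfolding adjoint_A0 A1_def using that by blast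
    then show ?thesis using gamma_tri[OF that] by simp
  qed
  have sub: "cls M g \<ominus>\<^bsub>H\<^esub> z \<odot>\<^bsub>H\<^esub> cls M f = cls M (\<lambda>t. g t - z * f t)" if "tri f g 0" for f g
    using triD(1,2)[OF that] by (simp add: cls_smult cls_diff)
  show "z \<in> resolvent_set H ?B"
    unfolding resolvent_set_def
  proof (intro CollectI conjI ballI)
    fix h assume "h \<in> carrier H"
    then obtain k where k: "k \<in> L2 M" "h = cls M k" by (rule carrier_cases)
    \<comment> \<open>The reference operator is multiplication by \<open>t\<close>, so its resolvent
      is division by \<open>t - z\<close>.\<close>
    define f where "f t = k t / (of_real t - z)" for t
    define g where "g t = k t + z * f t" for t
    have f: "tri f g 0"
      using tri_resolvent[OF z k(1)] by (simp add: f_def[abs_def] g_def[abs_def])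
    show "\<exists>!X. \<exists>Y. (X, Y) \<in> ?B \<and> Y \<ominus>\<^bsub>H\<^esub> z \<odot>\<^bsub>H\<^esub> X = h"
    proof (rule ex1I[of _ "cls M f"])
      show "\<exists>Y. (cls M f, Y) \<in> ?B \<and> Y \<ominus>\<^bsub>H\<^esub> z \<odot>\<^bsub>H\<^esub> cls M f = h"
        using B_I[OF f] sub[OF f] k by (intro exI[of _ "cls M g"]) (simp add: g_def)
      fix X assume "\<exists>Y. (X, Y) \<in> ?B \<and> Y \<ominus>\<^bsub>H\<^esub> z \<odot>\<^bsub>H\<^esub> X = h"
      then obtain Y where Y: "(X, Y) \<in> ?B" "Y \<ominus>\<^bsub>H\<^esub> z \<odot>\<^bsub>H\<^esub> X = h" by blast
      obtain p q where p: "tri p q 0" "X = cls M p" "Y = cls M q" using B_cases[OF Y(1)] by blast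
      note L = triD(1,2)[OF p(1)]
      have "cls M (\<lambda>t. q t - z * p t) = cls M k"
        using Y(2) sub[OF p(1)] p k by simp
      then have "AE t in M. q t - z * p t = k t"
        using L k by (simp add: cls_eq_iff)
      then have "AE t in M. p t = f t"
        using triD(3)[OF p(1)]
      proof eventually_elim
        case (elim t)
        then have "k t = (of_real t - z) * p t" by (simp add: algebra_simps)
        then show ?case using resolvent_denom[OF z, of t] by (simp add: f_def)
      qed
      then show "X = cls M f"
        using L triD(1)[OF f] p by (simp add: cls_eq_iff)
    qed
  next
    have "hnorm H X \<le> 1 / \<bar>Im z\<bar> * hnorm H (Y \<ominus>\<^bsub>H\<^esub> z \<odot>\<^bsub>H\<^esub> X)" if XY: "(X, Y) \<in> ?B" for X Y
    proof -
      obtain p q where p: "tri p q 0" "X = cls M p" "Y = cls M q" using B_cases[OF XY] by blast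
      note L = triD(1,2)[OF p(1)]
      define h where "h t = q t - z * p t" for t
      have hL: "h \<in> L2 M" unfolding h_def[abs_def] using L by simp
      have "(\<integral>t. (cmod (p t))\<^sup>2 \<partial>M) \<le> (\<integral>t. (1 / \<bar>Im z\<bar>)\<^sup>2 * (cmod (h t))\<^sup>2 \<partial>M)"
      proof (rule integral_mono_AE)
        show "AE t in M. (cmod (p t))\<^sup>2 \<le> (1 / \<bar>Im z\<bar>)\<^sup>2 * (cmod (h t))\<^sup>2"
          using triD(3)[OF p(1)]
        proof eventually_elim
          case (elim t)
          then have "h t = (of_real t - z) * p t" by (simp add: h_def algebra_simps)
          then have "p t = 1 / (of_real t - z) * h t" using resolvent_denom[OF z, of t] by simp
          then have "cmod (p t) \<le> 1 / \<bar>Im z\<bar> * cmod (h t)"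
            using mult_right_mono[OF resolvent_bound[OF z, of t], of "cmod (h t)"] by (metis norm_ge_zero norm_mult)
          then show ?case
            unfolding power_mult_distrib[symmetric] by (intro power_mono) auto
        qed
      qed (use L hL in \<open>auto simp: L2_integrable\<close>)
      also have "\<dots> = (1 / \<bar>Im z\<bar>)\<^sup>2 * (\<integral>t. (cmod (h t))\<^sup>2 \<partial>M)"
        by (rule integral_mult_right_zero)
      finally have "sqrt (\<integral>t. (cmod (p t))\<^sup>2 \<partial>M) \<le> 1 / \<bar>Im z\<bar> * sqrt (\<integral>t. (cmod (h t))\<^sup>2 \<partial>M)"
        by (drule_tac real_sqrt_le_mono) (simp only: real_sqrt_mult real_sqrt_abs abs_divide abs_one abs_abs)
      then show ?thesis
        using L hL sub[OF p(1), folded h_def] by (simp only: p hnorm_cls)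
    qed
    then show "\<exists>C. \<forall>(X, Y)\<in>?B. hnorm H X \<le> C * hnorm H (Y \<ominus>\<^bsub>H\<^esub> z \<odot>\<^bsub>H\<^esub> X)"
      by (intro exI[of _ "1 / \<bar>Im z\<bar>"]) blast
  qed
qed

end

section \<open>Primeness\<close>

context weyl_triple
begin

text \<open>\<open>w\<close> is the reference resolvent applied to \<open>v\<close>. Its projection
  \<open>u\<close> onto \<open>N\<close> lies in the domain of the adjoint of the part of
  \<open>A\<close> in \<open>N\<close>, hence of \<open>A\<close> itself by self-adjointness. The
  rest \<open>w - u\<close> solves the reference eigenvalue equation at a nonreal point and
  vanishes. So the reference resolvent preserves \<open>N\<close> and maps it into the kernel of
  \<open>\<delta>\<close>.\<close>

lemma reducing_resolvent:
  assumes red: "reducing_subspace H A N" and sa: "self_adjoint_op (H\<lparr>carrier := N\<rparr>) (A \<inter> N \<times> N)"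
    and z: "Im z \<noteq> 0" and v: "v \<in> N" and w: "w \<in> D" "\<gamma> w = 0" "ast w = v \<oplus> z \<odot> w"
  shows "w \<in> N \<and> \<delta> w = 0"
proof -
  have N: "closed_subspace H N" using red by (simp add: reducing_subspace_def)
  note ND = closed_subspaceD[OF N]
  have wc: "w \<in> carrier H" and vc: "v \<in> carrier H" using w v ND(1) dom_carrier by auto
  have split: "\<exists>u\<in>N. \<exists>v\<in>orth_compl H N. f = u \<oplus> v" if "f \<in> Domain A" for f
    using that red unfolding reducing_subspace_def by blast
  obtain u where u: "u \<in> N" "w \<ominus> u \<in> orth_compl H N"
    using orthogonal_decomposition[OF N _ split wc] dense unfolding densely_defined_def by metis
  have uc: "u \<in> carrier H" using u ND(1) by blast
  have orth: "ip H f w = ip H f u" if "f \<in> N" for f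
  proof -
    have fc: "f \<in> carrier H" using that ND(1) by blast
    have "ip H (w \<ominus> u) f = 0" using u(2) that by (simp add: orth_compl_def)
    then have "ip H f (w \<ominus> u) = 0"
      using ip_cnj[of "w \<ominus> u" f] fc wc uc by simp
    then show ?thesis using fc wc uc by (simp add: ip_simps)
  qed
  \<comment> \<open>Against vectors of \<open>N\<close>, \<open>u\<close> and \<open>w\<close> have
    the same inner products, so the relation for \<open>w\<close> passes to
    \<open>u\<close>.\<close>
  have "(u, v \<oplus> z \<odot> u) \<in> adjoint_op (H\<lparr>carrier := N\<rparr>) (A \<inter> N \<times> N)"
  proof (rule adjoint_opI)
    show "u \<in> carrier (H\<lparr>carrier := N\<rparr>)" "v \<oplus> z \<odot> u \<in> carrier (H\<lparr>carrier := N\<rparr>)"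
      using u v ND by simp_all
    fix f f' assume f: "(f, f') \<in> A \<inter> N \<times> N"
    then have fc: "f \<in> carrier H" "f' \<in> carrier H" using ND(1) by auto
    have "ip H f' u = ip H f' w" using f orth by auto
    also have "\<dots> = ip H f (v \<oplus> z \<odot> w)"
      using adjoint_opD[OF ast_Amax[OF w(1)], of f f'] f w(3) by simp
    also have "\<dots> = ip H f (v \<oplus> z \<odot> u)"
      using f orth[of f] fc uc wc vc by (simp add: ip_simps)
    finally show "ip (H\<lparr>carrier := N\<rparr>) f' u = ip (H\<lparr>carrier := N\<rparr>) f (v \<oplus> z \<odot> u)" by simp
  qed
  then have "(u, v \<oplus> z \<odot> u) \<in> A"
    using sa unfolding self_adjoint_op_def by blast
  then have uA: "u \<in> D" "ast u = v \<oplus> z \<odot> u" "\<gamma> u = 0" "\<delta> u = 0"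
    unfolding A_iff by auto
  have "ast (w \<ominus> u) = z \<odot> (w \<ominus> u)"
    using uA w uc wc vc by (intro ip_ext) (simp_all add: ast_diff ip_simps algebra_simps)
  then have "w \<ominus> u = \<zero>"
    using uA w by (intro e_unique[OF z]) (simp_all add: \<gamma>_diff)
  then have "w = u" using wc uc minus_eq_zero_iff by blast
  then show ?thesis using u uA by simp
qed

end

section \<open>Functions determined by their integrals over sets\<close>

lemma AE_zero_real:
  fixes f :: "'b \<Rightarrow> real"
  assumes f: "integrable M f" and 0: "\<And>E. E \<in> sets M \<Longrightarrow> (\<integral>x. indicator E x * f x \<partial>M) = 0"
  shows "AE x in M. f x = 0"
proof -
  have *: "AE x in M. g x \<le> 0" if g: "integrable M g" and g0: "\<And>E. E \<in> sets M \<Longrightarrow> (\<integral>x. indicator E x * g x \<partial>M) = 0"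
    for g :: "'b \<Rightarrow> real"
  proof -
    \<comment> \<open>On the set where \<open>g\<close> is positive the integrand is nonnegative, so
      a zero integral forces it to vanish.\<close>
    define E where "E = {x \<in> space M. g x > 0}"
    have E: "E \<in> sets M" using g unfolding E_def by measurable
    have i: "integrable M (\<lambda>x. indicator E x * g x)"
      using integrable_mult_indicator[OF E g] by simp
    have "AE x in M. 0 \<le> indicator E x * g x"
      by (intro AE_I2) (auto simp: E_def indicator_def)
    then have "AE x in M. indicator E x * g x = 0"
      using g0[OF E] integral_nonneg_eq_0_iff_AE[OF i] by simp
    then show ?thesis
      using AE_space by eventually_elim (auto simp: E_def indicator_def split: if_splits)
  qed
  have "AE x in M. f x \<le> 0" using f 0 by (rule *)
  moreover have "AE x in M. - f x \<le> 0" using f 0 by (intro *) simp_all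
  ultimately show ?thesis by eventually_elim simp
qed

lemma AE_zero_complex:
  fixes f :: "'b \<Rightarrow> complex"
  assumes f: "integrable M f" and 0: "\<And>E. E \<in> sets M \<Longrightarrow> (\<integral>x. indicator E x * f x \<partial>M) = 0"
  shows "AE x in M. f x = 0"
proof -
  have i: "integrable M (\<lambda>x. indicator E x * f x)" if "E \<in> sets M" for E
  proof -
    have "indicator E x *\<^sub>R f x = indicator E x * f x" for x by (simp add: indicator_def)
    then show ?thesis using integrable_mult_indicator[OF that f] by simp
  qed
  have "AE x in M. Re (f x) = 0"
  proof (rule AE_zero_real)
    show "(\<integral>x. indicator E x * Re (f x) \<partial>M) = 0" if "E \<in> sets M" for E
    proof -
      have "(\<integral>x. indicator E x * Re (f x) \<partial>M) = (\<integral>x. Re (indicator E x * f x) \<partial>M)"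
        by (intro Bochner_Integration.integral_cong) (auto simp: indicator_def)
      then show ?thesis using integral_Re[OF i[OF that]] 0[OF that] by simp
    qed
  qed (use f in simp)
  moreover have "AE x in M. Im (f x) = 0"
  proof (rule AE_zero_real)
    show "(\<integral>x. indicator E x * Im (f x) \<partial>M) = 0" if "E \<in> sets M" for E
    proof -
      have "(\<integral>x. indicator E x * Im (f x) \<partial>M) = (\<integral>x. Im (indicator E x * f x) \<partial>M)"
        by (intro Bochner_Integration.integral_cong) (auto simp: indicator_def)
      then show ?thesis using integral_Im[OF i[OF that]] 0[OF that] by simp
    qed
  qed (use f in simp)
  ultimately show ?thesis by eventually_elim (simp add: complex_eq_iff)
qed

context herglotz_measure
begin

text \<open>The sum of the open and the closed indicator is twice the limit function met in the
  primeness proof, which takes the value 1/2 at the endpoints. Slightly larger intervals remove this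
  ambiguity, and closed intervals generate the Borel sets.\<close>

lemma interval_integrals_zero:
  assumes h: "integrable M (h :: real \<Rightarrow> complex)" and tot: "(\<integral>t. h t \<partial>M) = 0"
    and int: "\<And>p q. p < q \<Longrightarrow> (\<integral>t. (indicator {p<..<q} t + indicator {p..q} t) * h t \<partial>M) = 0"
  shows "AE t in M. h t = 0"
proof (rule AE_zero_complex[OF h])
  note [measurable] = borel_measurable_integrable[OF h]
  have hE: "integrable M (\<lambda>t. indicator E t * h t)" if "E \<in> sets M" for E
  proof -
    have "indicator E t *\<^sub>R h t = indicator E t * h t" for t by (simp add: indicator_def)
    then show ?thesis using integrable_mult_indicator[OF that h] by simp
  qed
  have closed: "(\<integral>t. indicator {p..q} t * h t \<partial>M) = 0" for p q
  proof (cases "p \<le> q")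
    case True
    \<comment> \<open>The enlarged intervals shrink to \<open>[p, q]\<close>; for each
      \<open>t\<close> both indicators eventually agree with that of \<open>[p, q]\<close>.\<close>
    define u where "u n t = (indicator {p - 1 / Suc n<..<q + 1 / Suc n} t + indicator {p - 1 / Suc n..q + 1 / Suc n} t) * h t" for n t
    have "(\<lambda>n. \<integral>t. u n t \<partial>M) \<longlonglongrightarrow> (\<integral>t. 2 * (indicator {p..q} t * h t) \<partial>M)"
    proof (rule integral_dominated_convergence[where w = "\<lambda>t. 2 * cmod (h t)"])
      show "AE t in M. (\<lambda>n. u n t) \<longlonglongrightarrow> 2 * (indicator {p..q} t * h t)"
      proof (rule AE_I2, rule tendsto_eventually)
        fix t :: real
        show "\<forall>\<^sub>F n in sequentially. u n t = 2 * (indicator {p..q} t * h t)"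
        proof (cases "t \<in> {p..q}")
          case True
          have "u n t = 2 * (indicator {p..q} t * h t)" for n
          proof -
            have "1 / real (Suc n) > 0" by simp
            then have "p - 1 / Suc n < t" "t < q + 1 / Suc n" using True unfolding atLeastAtMost_iff by linarith+
            then show ?thesis using True by (simp add: u_def)
          qed
          then show ?thesis by simp
        next
          case False
          then have "max (p - t) (t - q) > 0" by auto
          then obtain N where N: "1 / real (Suc N) < max (p - t) (t - q)"
            using reals_Archimedean by (metis inverse_eq_divide)
          have "u n t = 2 * (indicator {p..q} t * h t)" if "n \<ge> N" for n
          proof -
            have "1 / real (Suc n) \<le> 1 / real (Suc N)" using that by (simp add: frac_le)
            then have "1 / real (Suc n) < max (p - t) (t - q)" using N by linarith
            then have "t < p - 1 / Suc n \<or> q + 1 / Suc n < t" by (auto simp: max_def split: if_splits)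
            then have "t \<notin> {p - 1 / Suc n<..<q + 1 / Suc n}" "t \<notin> {p - 1 / Suc n..q + 1 / Suc n}"
              by (auto simp del: of_nat_Suc)
            then show ?thesis using False by (simp add: u_def del: of_nat_Suc)
          qed
          then show ?thesis unfolding eventually_sequentially by blast
        qed
      qed
      show "AE t in M. norm (u n t) \<le> 2 * cmod (h t)" for n
        by (auto simp: u_def indicator_def norm_mult)
      show "u n \<in> borel_measurable M" for n
        unfolding u_def[abs_def] by measurable
    qed (use h hE[of "{p..q}"] in \<open>auto simp: sets_M\<close>)
    moreover have "(\<integral>t. u n t \<partial>M) = 0" for n
    proof -
      have "0 < 1 / real (Suc n)" by simp
      then have "p - 1 / Suc n < q + 1 / Suc n" using True by linarith
      then show ?thesis unfolding u_def by (rule int)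
    qed
    ultimately have "(\<integral>t. 2 * (indicator {p..q} t * h t) \<partial>M) = 0"
      using LIMSEQ_unique[OF tendsto_const] by fastforce
    then show ?thesis by simp
  qed simp
  have gen: "sets M = sigma_sets UNIV (range (\<lambda>(p, q). {p..q::real}))"
    by (simp add: sets_M borel_eq_atLeastAtMost)
  have int_stable: "Int_stable (range (\<lambda>(p, q). {p..q::real}))"
    unfolding Int_stable_def by (auto simp: Int_atLeastAtMost)
  fix E assume "E \<in> sets M"
  then have E: "E \<in> sigma_sets UNIV (range (\<lambda>(p, q). {p..q::real}))"
    by (simp only: gen)
  have "range (\<lambda>(p, q). {p..q::real}) \<subseteq> Pow UNIV" by simp
  \<comment> \<open>Dynkin's argument: closed intervals are stable under intersection, complements
    use the vanishing total integral, and disjoint unions use countable additivity.\<close>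
  from int_stable this E show "(\<integral>t. indicator E t * h t \<partial>M) = 0"
  proof (induction rule: sigma_sets_induct_disjoint)
    case (basic S)
    then show ?case using closed by auto
  next
    case (compl S)
    have "(\<integral>t. indicator (UNIV - S) t * h t \<partial>M) = (\<integral>t. h t - indicator S t * h t \<partial>M)"
      by (intro Bochner_Integration.integral_cong) (auto simp: indicator_def)
    also have "\<dots> = 0"
      using compl h hE[of S] compl(1)[folded gen] tot by simp
    finally show ?case .
  next
    case (union S)
    have SM: "S i \<in> sets M" for i using union(2) unfolding gen by auto
    have e: "indicator X t *\<^sub>R h t = indicator X t * h t" for X t by (simp add: indicator_def)
    have "(LINT t:(\<Union>i. S i)|M. h t) = (\<Sum>i. LINT t:(S i)|M. h t)"
    proof (rule lebesgue_integral_countable_add)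
      show "S i \<inter> S j = {}" if "i \<noteq> j" for i j
        using union(1) that by (auto simp: disjoint_family_on_def)
      show "set_integrable M (\<Union>i. S i) h"
        unfolding set_integrable_def e using SM by (intro hE) auto
    qed (use SM in auto)
    then show ?case
      using union(3) by (simp add: set_lebesgue_integral_def e)
  qed simp
qed

text \<open>\<open>N\<close> is invariant under multiplication by the resolvent functions, hence by
  \<open>1 / (1 + s ^ 2 ^ k)\<close> with \<open>s = (t - m) / c\<close>, since \<open>s ^ 2 ^ k - \<zeta>\<close> splits into factors of the same
  kind. For \<open>k \<rightarrow> \<infinity>\<close> these functions tend to the indicator of \<open>[m - c, m + c]\<close>, up to the endpoints.\<close>

lemma prime_A0: "prime_op H A0"
  unfolding prime_op_def
proof (intro notI, elim exE conjE)
  fix N assume red: "reducing_subspace H A0 N" and nz: "N \<noteq> {\<zero>\<^bsub>H\<^esub>}"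
    and sa: "self_adjoint_op (H\<lparr>carrier := N\<rparr>) (A0 \<inter> N \<times> N)"
  have N: "closed_subspace H N" using red by (simp add: reducing_subspace_def)
  note ND = closed_subspaceD[OF N]
  define inN where "inN u \<longleftrightarrow> u \<in> L2 M \<and> cls M u \<in> N" for u
  \<comment> \<open>Invariance of \<open>N\<close> under the resolvent, together with
    \<open>\<delta> = 0\<close>. As \<open>\<gamma> = 0\<close> for the quotient, its
    \<open>\<delta>\<close> is the plain integral.\<close>
  have res: "inN (\<lambda>t. u t / (of_real t - z)) \<and> (\<integral>t. u t / (of_real t - z) \<partial>M) = 0" if u: "inN u" and z: "Im z \<noteq> 0" for u z
  proof -
    have uL: "u \<in> L2 M" and uN: "cls M u \<in> N" using u by (auto simp: inN_def)
    define f where "f t = u t / (of_real t - z)" for t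
    define g where "g t = u t + z * f t" for t
    have f: "tri f g 0"
      using tri_resolvent[OF z uL] by (simp add: f_def[abs_def] g_def[abs_def])
    note L = triD(1,2)[OF f]
    have fA: "(cls M f, cls M g) \<in> adjoint_op H A0"
      unfolding adjoint_A0 A1_def using f by blast
    then have "cls M f \<in> D" "op_apply (adjoint_op H A0) (cls M f) = cls M g"
      unfolding Amax_iff by auto
    moreover have "cls M g = cls M u \<oplus>\<^bsub>H\<^esub> z \<odot>\<^bsub>H\<^esub> cls M f"
      using L uL by (simp add: cls_smult cls_add g_def[abs_def])
    ultimately have "cls M f \<in> N \<and> delta (cls M f) = 0"
      using reducing_resolvent[OF red sa z uN, of "cls M f"] gamma_tri[OF f] by simp
    moreover have "dl f g = (\<integral>t. f t \<partial>M)"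
    proof -
      note [measurable] = L2_measurable[OF L(1)] L2_measurable[OF L(2)]
      show ?thesis
        unfolding dl_def using dl_pointwise[OF f] by (intro integral_cong_AE) auto
    qed
    ultimately show ?thesis
      using L delta_tri[OF f] by (simp add: inN_def f_def[abs_def])
  qed
  have scale: "inN (\<lambda>t. b * u t)" if "inN u" for b u
  proof -
    have "cls M (\<lambda>t. b * u t) = b \<odot>\<^bsub>H\<^esub> cls M u" using that by (simp add: inN_def cls_smult)
    then show ?thesis using that ND(4) by (simp add: inN_def)
  qed
  have pow: "inN (\<lambda>t. u t / (of_real ((t - m) / c) ^ 2 ^ k - \<zeta>))" if "inN u" "Im \<zeta> \<noteq> 0" "c > 0" for u \<zeta> m c k
    using that
  proof (induction k arbitrary: u \<zeta>)
    case 0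
    have z: "Im (of_real m + of_real c * \<zeta>) \<noteq> 0" using 0 by simp
    have pt: "u t / (of_real ((t - m) / c) ^ 2 ^ 0 - \<zeta>) = of_real c * (u t / (of_real t - (of_real m + of_real c * \<zeta>)))" for t
    proof -
      have e: "complex_of_real t - (of_real m + of_real c * \<zeta>) = of_real c * (of_real ((t - m) / c) - \<zeta>)"
        using \<open>c > 0\<close> by (simp add: field_simps)
      show ?thesis unfolding e using \<open>c > 0\<close> by simp
    qed
    show ?case
      unfolding pt by (rule scale[OF conjunct1[OF res[OF 0(1) z]]])
  next
    case (Suc k)
    \<comment> \<open>The square root of a nonreal number is nonreal, so the induction hypothesis
      applies to both factors \<open>x - r\<close> and \<open>x + r\<close>.\<close>
    define r where "r = csqrt \<zeta>"
    have r2: "r\<^sup>2 = \<zeta>" by (simp add: r_def)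
    have r: "Im r \<noteq> 0"
    proof
      assume "Im r = 0"
      then have "Im (r\<^sup>2) = 0" by (simp add: power2_eq_square)
      then show False using r2 Suc.prems by simp
    qed
    have "inN (\<lambda>t. u t / (of_real ((t - m) / c) ^ 2 ^ k - r) / (of_real ((t - m) / c) ^ 2 ^ k - (- r)))"
      using Suc.IH[OF Suc.IH[OF Suc.prems(1) r Suc.prems(3)], of "- r"] r Suc.prems(3) by simp
    moreover have "u t / (of_real ((t - m) / c) ^ 2 ^ k - r) / (of_real ((t - m) / c) ^ 2 ^ k - (- r))
        = u t / (of_real ((t - m) / c) ^ 2 ^ Suc k - \<zeta>)" for t
    proof -
      have "x - \<zeta> = (y - r) * (y - (- r))" if "x = y\<^sup>2" for x y
        unfolding that r2[symmetric] by (simp add: power2_eq_square algebra_simps)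
      moreover have "complex_of_real ((t - m) / c) ^ 2 ^ Suc k = (of_real ((t - m) / c) ^ 2 ^ k)\<^sup>2"
        by (simp only: power_mult[symmetric] power_Suc mult.commute)
      ultimately show ?thesis by (simp only: divide_divide_eq_left)
    qed
    ultimately show ?case by (simp only:)
  qed
  have vz: "AE t in M. v t = 0" if v: "inN v" for v
  proof -
    \<comment> \<open>\<open>v\<close> itself need not be integrable; the product with
      \<open>kern \<i>\<close> is, and it has the same zeros.\<close>
    define h where "h t = v t / (of_real t - \<i>)" for t
    have h: "integrable M h"
      using L2_mult_integrable[of v M "kern \<i>"] v by (simp add: inN_def h_def[abs_def] kern_def)
    note [measurable] = borel_measurable_integrable[OF h]
    have "AE t in M. h t = 0"
    proof (rule interval_integrals_zero[OF h])
      show "(\<integral>t. h t \<partial>M) = 0" using res[OF v, of \<i>] by (simp add: h_def)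
      fix p q :: real assume pq: "p < q"
      define m where "m = (p + q) / 2"
      define c where "c = (q - p) / 2"
      have c: "c > 0" using pq by (simp add: c_def)
      define s where "s t = (t - m) / c" for t
      \<comment> \<open>With \<open>y = s t ^ 2 ^ k\<close> the denominator is
        \<open>(y - \<i>) (y + \<i>)\<close>, so \<open>r k\<close> is a product of two functions
        covered by \<open>pow\<close>. The even exponent keeps the denominator at least 1, which
        gives domination by \<open>h\<close>.\<close>
      define r where "r k t = complex_of_real (1 / (1 + s t ^ 2 ^ Suc k))" for k t
      have ev: "0 \<le> x ^ 2 ^ Suc k" for x :: real and k
        by (simp add: power_mult)
      have r_zero: "(\<integral>t. r k t * h t \<partial>M) = 0" for k
      proof -
        have "inN (\<lambda>t. v t / (of_real (s t) ^ 2 ^ k - \<i>) / (of_real (s t) ^ 2 ^ k - (- \<i>)))"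
          unfolding s_def by (intro pow v c) simp_all
        from res[OF this, of \<i>]
        have "(\<integral>t. v t / (of_real (s t) ^ 2 ^ k - \<i>) / (of_real (s t) ^ 2 ^ k - (- \<i>)) / (of_real t - \<i>) \<partial>M) = 0"
          by simp
        moreover have "v t / (of_real (s t) ^ 2 ^ k - \<i>) / (of_real (s t) ^ 2 ^ k - (- \<i>)) / (of_real t - \<i>) = r k t * h t" for t
        proof -
          have "(y - \<i>) * (y - (- \<i>)) = 1 + y\<^sup>2" for y
            by (simp add: power2_eq_square algebra_simps)
          moreover have "(complex_of_real (s t) ^ 2 ^ k)\<^sup>2 = of_real (s t) ^ 2 ^ Suc k"
            by (simp only: power_mult[symmetric] power_Suc mult.commute)
          ultimately have "(complex_of_real (s t) ^ 2 ^ k - \<i>) * (of_real (s t) ^ 2 ^ k - (- \<i>)) = of_real (1 + s t ^ 2 ^ Suc k)"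
            by (simp del: power_Suc)
          then show ?thesis
            by (simp only: divide_divide_eq_left r_def h_def of_real_divide of_real_1 times_divide_times_eq mult_1 mult.assoc mult.commute)
        qed
        ultimately show ?thesis by simp
      qed
      have "(\<lambda>k. \<integral>t. r k t * h t \<partial>M) \<longlonglongrightarrow> (\<integral>t. (indicator {p<..<q} t + indicator {p..q} t) * h t / 2 \<partial>M)"
      proof (rule integral_dominated_convergence[where w = "\<lambda>t. cmod (h t)"])
        show "AE t in M. (\<lambda>k. r k t * h t) \<longlonglongrightarrow> (indicator {p<..<q} t + indicator {p..q} t) * h t / 2"
        proof (rule AE_I2)
          fix t :: real
          have sub: "strict_mono (\<lambda>k::nat. 2 ^ Suc k :: nat)"
            by (rule strict_monoI) (rule power_strict_increasing, auto)
          have st: "t \<in> {p<..<q} \<longleftrightarrow> \<bar>s t\<bar> < 1" "t \<in> {p..q} \<longleftrightarrow> \<bar>s t\<bar> \<le> 1"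
            using c unfolding s_def abs_divide
            by (simp_all add: divide_le_eq divide_less_eq m_def c_def abs_less_iff abs_le_iff field_simps) (auto simp: field_simps)
          have lim: "(\<lambda>k. 1 / (1 + s t ^ 2 ^ Suc k)) \<longlonglongrightarrow> (indicator {p<..<q} t + indicator {p..q} t) / 2"
          proof -
            consider "\<bar>s t\<bar> < 1" | "\<bar>s t\<bar> = 1" | "\<bar>s t\<bar> > 1" by linarith
            then show ?thesis
            proof cases
              case 1
              have "(\<lambda>k. s t ^ 2 ^ Suc k) \<longlonglongrightarrow> 0"
                using LIMSEQ_subseq_LIMSEQ[OF LIMSEQ_power_zero[of "s t"] sub] 1 by (simp add: o_def)
              then have "(\<lambda>k. 1 / (1 + s t ^ 2 ^ Suc k)) \<longlonglongrightarrow> 1 / (1 + 0)"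
                by (intro tendsto_intros) auto
              then show ?thesis using 1 st by (simp add: indicator_def)
            next
              case 2
              \<comment> \<open>At the endpoints the sequence is constantly 1/2, in accordance with
                half the sum of the two indicators.\<close>
              have "s t ^ 2 ^ Suc k = 1" for k
                using 2 power_even_abs[of "2 ^ Suc k" "s t"] by simp
              moreover have "t \<notin> {p<..<q}" "t \<in> {p..q}" using 2 st by simp_all
              ultimately show ?thesis by (simp del: power_Suc)
            next
              case 3
              have "(\<lambda>k. 1 / (1 + s t ^ 2 ^ Suc k)) \<longlonglongrightarrow> 0"
              proof (rule tendsto_sandwich[OF _ _ tendsto_const])
                show "\<forall>\<^sub>F k in sequentially. 0 \<le> 1 / (1 + s t ^ 2 ^ Suc k)"
                  using ev by (intro always_eventually allI divide_nonneg_nonneg add_nonneg_nonneg) auto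
                have "1 / (1 + s t ^ 2 ^ Suc k) \<le> inverse (\<bar>s t\<bar> ^ 2 ^ Suc k)" for k
                proof -
                  have "\<bar>s t\<bar> ^ 2 ^ Suc k = s t ^ 2 ^ Suc k"
                    by (rule power_even_abs) simp
                  moreover have "0 < \<bar>s t\<bar> ^ 2 ^ Suc k" using 3 by (intro zero_less_power) linarith
                  ultimately show ?thesis
                    by (simp add: inverse_eq_divide frac_le del: power_Suc)
                qed
                then show "\<forall>\<^sub>F k in sequentially. 1 / (1 + s t ^ 2 ^ Suc k) \<le> inverse (\<bar>s t\<bar> ^ 2 ^ Suc k)"
                  by (intro always_eventually allI)
                show "(\<lambda>k. inverse (\<bar>s t\<bar> ^ 2 ^ Suc k)) \<longlonglongrightarrow> 0"
                  using LIMSEQ_subseq_LIMSEQ[OF LIMSEQ_inverse_realpow_zero[OF 3] sub] by (simp only: o_def)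
              qed
              moreover have "t \<notin> {p<..<q}" "t \<notin> {p..q}" using 3 st by simp_all
              ultimately show ?thesis by (simp del: power_Suc)
            qed
          qed
          have ind: "complex_of_real ((indicator {p<..<q} t + indicator {p..q} t) / 2) * h t
              = (indicator {p<..<q} t + indicator {p..q} t) * h t / 2"
            by (auto simp: indicator_def)
          from tendsto_mult[OF tendsto_of_real[OF lim] tendsto_const[of "h t"]]
          show "(\<lambda>k. r k t * h t) \<longlonglongrightarrow> (indicator {p<..<q} t + indicator {p..q} t) * h t / 2"
            unfolding r_def ind .
        qed
        show "AE t in M. norm (r k t * h t) \<le> cmod (h t)" for k
        proof (rule AE_I2)
          fix t
          have "cmod (r k t) \<le> 1"
            using ev[of "s t" k] unfolding r_def norm_of_real by (simp add: divide_le_eq del: power_Suc)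
          then show "norm (r k t * h t) \<le> cmod (h t)"
            unfolding norm_mult using mult_right_mono[of _ 1 "cmod (h t)"] by simp
        qed
        show "(\<lambda>t. r k t * h t) \<in> borel_measurable M" for k
          unfolding r_def s_def by measurable
      qed (use h in simp_all)
      then have "(\<integral>t. (indicator {p<..<q} t + indicator {p..q} t) * h t / 2 \<partial>M) = 0"
        using r_zero LIMSEQ_unique[OF tendsto_const] by fastforce
      then show "(\<integral>t. (indicator {p<..<q} t + indicator {p..q} t) * h t \<partial>M) = 0" by simp
    qed
    then show ?thesis
    proof eventually_elim
      case (elim t)
      then show ?case using resolvent_denom[of \<i> t] by (simp add: h_def)
    qed
  qed
  have "X = \<zero>\<^bsub>H\<^esub>" if "X \<in> N" for X
  proof -
    have "X \<in> carrier H" using that ND(1) by blast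
    then obtain v where v: "v \<in> L2 M" "X = cls M v" by (rule carrier_cases)
    then have "AE t in M. v t = 0" using vz that by (simp add: inN_def)
    then show ?thesis using v by (simp add: cls_zero cls_eq_iff)
  qed
  then show False using nz ND(2) by blast
qed

end

section \<open>The parameters\<close>

text \<open>Modulo \<open>s^2 = b^2 + 4 Q^2\<close> numerator and denominator are linear in
  \<open>s\<close>, and the claim becomes a comparison of coefficients.\<close>

lemma kappa_eq:
  fixes Q a b s :: real
  assumes Q: "Q \<noteq> 0" and a: "0 < a" and b: "b = Q\<^sup>2 + a\<^sup>2 - 1" and s: "s = sqrt (b\<^sup>2 + 4 * Q\<^sup>2)"
  shows "((b - 2 * Q\<^sup>2 - s)\<^sup>2 - a * (b - s)\<^sup>2 + 4 * Q\<^sup>2 * a * (a - 1)) /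
      ((b - 2 * Q\<^sup>2 - s)\<^sup>2 + a * (b - s)\<^sup>2 + 4 * Q\<^sup>2 * a * (a + 1)) = s / ((1 + a)\<^sup>2 + Q\<^sup>2)"
proof -
  define n where "n = (b - 2 * Q\<^sup>2 - s)\<^sup>2 - a * (b - s)\<^sup>2 + 4 * Q\<^sup>2 * a * (a - 1)"
  define d where "d = (b - 2 * Q\<^sup>2 - s)\<^sup>2 + a * (b - s)\<^sup>2 + 4 * Q\<^sup>2 * a * (a + 1)"
  have s2: "s * s = b * b + 4 * (Q * Q)"
    using s by (simp add: power2_eq_square flip: real_sqrt_mult)
  have d: "d > 0"
    unfolding d_def using Q a by (intro add_nonneg_pos) auto
  have D: "(1 + a)\<^sup>2 + Q\<^sup>2 > 0"
    using a by (intro add_pos_nonneg) auto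
  define S where "S = b * b + 4 * (Q * Q)"
  define n0 where "n0 = (b - 2 * Q\<^sup>2)\<^sup>2 + S - a * (b\<^sup>2 + S) + 4 * Q\<^sup>2 * a * (a - 1)"
  define n1 where "n1 = 2 * a * b - 2 * (b - 2 * Q\<^sup>2)"
  define d0 where "d0 = (b - 2 * Q\<^sup>2)\<^sup>2 + S + a * (b\<^sup>2 + S) + 4 * Q\<^sup>2 * a * (a + 1)"
  define d1 where "d1 = - 2 * a * b - 2 * (b - 2 * Q\<^sup>2)"
  \<comment> \<open>The multiples of \<open>s * s - S\<close> collect all occurrences of the square
    of \<open>s\<close>, leaving coefficients free of \<open>s\<close>.\<close>
  have "n = n0 + n1 * s + (1 - a) * (s * s - S)" "d = d0 + d1 * s + (1 + a) * (s * s - S)"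
    unfolding n_def d_def n0_def n1_def d0_def d1_def by (simp_all add: power2_eq_square algebra_simps)
  then have nd: "n = n0 + n1 * s" "d = d0 + d1 * s"
    using s2 by (simp_all add: S_def)
  \<comment> \<open>Polynomial identities in \<open>Q\<close> and \<open>a\<close>: they say
    coefficientwise that \<open>n\<close> times \<open>(1 + a)^2 + Q^2\<close> equals
    \<open>s * d\<close>.\<close>
  have e: "n0 * ((1 + a)\<^sup>2 + Q\<^sup>2) = d1 * S" "n1 * ((1 + a)\<^sup>2 + Q\<^sup>2) = d0"
    unfolding n0_def n1_def d0_def d1_def S_def b by (simp_all add: power2_eq_square algebra_simps)
  have "n * ((1 + a)\<^sup>2 + Q\<^sup>2) = n0 * ((1 + a)\<^sup>2 + Q\<^sup>2) + n1 * ((1 + a)\<^sup>2 + Q\<^sup>2) * s"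
    unfolding nd by (simp add: algebra_simps)
  also have "\<dots> = s * d"
    unfolding e nd using s2 by (simp add: S_def algebra_simps)
  finally have "n * ((1 + a)\<^sup>2 + Q\<^sup>2) = s * d" .
  then show ?thesis
    using d D unfolding n_def[symmetric] d_def[symmetric] by (subst frac_eq_eq) auto
qed

text \<open>\<open>N\<close> and \<open>D\<close> are the squared moduli of numerator and
  denominator, and \<open>sqrt (N / D) = sqrt (N * D) / D\<close> with
  \<open>N * D = b^2 + 4 Q^2\<close>. The strict inequality comes from
  \<open>D - N = 4 a\<close>.\<close>

lemma kappa_modulus:
  fixes Q a b :: real
  assumes Q: "Q \<noteq> 0" and a: "0 < a" and b: "b = Q\<^sup>2 + a\<^sup>2 - 1"
  defines "u \<equiv> (1 + \<i> * of_real Q - of_real a) / (1 + \<i> * of_real Q + of_real a)"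
  shows "cmod u = sqrt (b\<^sup>2 + 4 * Q\<^sup>2) / ((1 + a)\<^sup>2 + Q\<^sup>2)" "0 < cmod u" "cmod u < 1"
proof -
  define N where "N = (1 - a)\<^sup>2 + Q\<^sup>2"
  define D where "D = (1 + a)\<^sup>2 + Q\<^sup>2"
  have N: "N > 0" unfolding N_def using Q by (intro add_nonneg_pos) auto
  have D: "D > 0" unfolding D_def using Q by (intro add_nonneg_pos) auto
  have "N < D" using a by (simp add: N_def D_def power2_eq_square algebra_simps)
  have u: "cmod u = sqrt N / sqrt D"
  proof -
    have "cmod (1 + \<i> * of_real Q - of_real a) = sqrt N" "cmod (1 + \<i> * of_real Q + of_real a) = sqrt D"
      by (simp_all add: cmod_def N_def D_def)
    then show ?thesis by (simp only: u_def norm_divide)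
  qed
  show "0 < cmod u" "cmod u < 1" using N D \<open>N < D\<close> by (simp_all add: u)
  have "b\<^sup>2 + 4 * Q\<^sup>2 = N * D"
    unfolding b N_def D_def power2_eq_square by (simp add: algebra_simps)
  then show "cmod u = sqrt (b\<^sup>2 + 4 * Q\<^sup>2) / ((1 + a)\<^sup>2 + Q\<^sup>2)"
    unfolding D_def[symmetric] u using N D by (simp add: real_sqrt_mult field_simps)
qed

text \<open>With \<open>u = p / q\<close> the square of \<open>\<kappa>\<close> is
  \<open>Y / X\<close>, the quotient of the squared moduli; multiplying the claim by
  \<open>u\<close> then makes it a consequence of one polynomial identity.\<close>

lemma U_eq:
  fixes Q a \<kappa> :: real
  assumes Q: "Q \<noteq> 0" and a: "0 < a"
    and u: "u = (1 + \<i> * of_real Q - of_real a) / (1 + \<i> * of_real Q + of_real a)" and \<kappa>: "\<kappa> = cmod u"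
    and k0: "0 < \<kappa>"
  shows "((of_real a + of_real Q * \<i>) * (1 - (of_real \<kappa>)\<^sup>2) - 1 - (of_real \<kappa>)\<^sup>2) / (2 * of_real \<kappa>) = - of_real \<kappa> / u"
proof -
  define p where "p = 1 + \<i> * of_real Q - complex_of_real a"
  define q where "q = 1 + \<i> * of_real Q + complex_of_real a"
  have nz: "p \<noteq> 0" "q \<noteq> 0" "cnj p \<noteq> 0" "cnj q \<noteq> 0"
    using Q by (auto simp: p_def q_def complex_eq_iff)
  define X where "X = q * cnj q"
  define Y where "Y = p * cnj p"
  have X: "X \<noteq> 0" using nz by (simp add: X_def)
  have k2: "(complex_of_real \<kappa>)\<^sup>2 = Y / X"
    using complex_norm_square[of u] unfolding \<kappa> u p_def[symmetric] q_def[symmetric] X_def Y_def by simp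
  have c: "cnj p = 1 - \<i> * of_real Q - of_real a" "cnj q = 1 - \<i> * of_real Q + of_real a"
    by (simp_all add: p_def q_def)
  \<comment> \<open>Here \<open>X - Y = 4 a\<close> and \<open>X + Y = 2 (1 + a^2 + Q^2)\<close>.
    The product form on the right makes \<open>u = p / q\<close> cancel \<open>q\<close> and
    complete \<open>cnj p\<close> to \<open>Y\<close>.\<close>
  have XY: "(of_real a + of_real Q * \<i>) * (X - Y) - X - Y = - 2 * (cnj p * q)"
    unfolding X_def Y_def c unfolding p_def q_def by (simp add: complex_eq_iff algebra_simps)
  have "(of_real a + of_real Q * \<i>) * (1 - (of_real \<kappa>)\<^sup>2) - 1 - (of_real \<kappa>)\<^sup>2
      = ((of_real a + of_real Q * \<i>) * (X - Y) - X - Y) / X"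
    unfolding k2 using X by (simp add: field_simps)
  also have "\<dots> * u = - 2 * (of_real \<kappa>)\<^sup>2"
    unfolding XY k2 unfolding u p_def[symmetric] q_def[symmetric] X_def Y_def using nz by (simp add: mult_ac)
  finally have "((of_real a + of_real Q * \<i>) * (1 - (of_real \<kappa>)\<^sup>2) - 1 - (of_real \<kappa>)\<^sup>2) * u = - 2 * (of_real \<kappa>)\<^sup>2"
    by simp
  moreover have "u \<noteq> 0" using nz by (simp add: u p_def q_def)
  ultimately show ?thesis
    using k0 by (simp add: field_simps power2_eq_square)
qed

section \<open>Assembly of the realizing L-system\<close>

context herglotz_measure
begin

lemma realization:
  fixes Q \<kappa> :: real and u U :: complex
  assumes Q: "Q \<noteq> 0"
    and u: "u = (1 + \<i> * of_real Q - of_real a) / (1 + \<i> * of_real Q + of_real a)"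
    and \<kappa>: "\<kappa> = cmod u" "0 < \<kappa>" "\<kappa> < 1" and U: "U = - of_real \<kappa> / u"
    and V: "\<And>z. Im z \<noteq> 0 \<Longrightarrow>
      V z = of_real Q + (\<integral>t. (1 / (of_real t - z) - of_real (t / (1 + t\<^sup>2))) \<partial>M)"
  shows "\<exists>A T S K gp gm.
      minimal_L_system H A T S K \<and> realized_by V H A S K \<and> deficiency_vectors H A gp gm \<and>
      main_parameter H T gp gm (of_real \<kappa>) \<and>
      selfadjoint_parameter H A (quasi_kernel H (plus_space H A) S) gp gm U"
proof -
  have e: "delta (cls M (kern \<i>)) = \<i> * of_real a" "delta (cls M (kern (- \<i>))) = - \<i> * of_real a"
    using delta_tri[OF tri_kern[of \<i>]] delta_tri[OF tri_kern[of "- \<i>"]] dl_kern_i by simp_all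
  \<comment> \<open>The value is \<open>1 + \<i> Q - a\<close>, whose imaginary part
    \<open>Q\<close> is nonzero; hence \<open>\<i>\<close> is a regular point of the main
    operator.\<close>
  have "1 + \<i> * of_real Q + \<i> * delta (cls M (kern \<i>)) \<noteq> 0"
    unfolding e using Q by (simp add: complex_eq_iff)
  then have "\<i> \<in> resolvent_set H (main Q)"
    by (intro resolvent_extension) simp_all
  then have "L_system H A0 (main Q) (state Q) (chan Q)"
    by (intro L_system_main deficiency_1_1) auto
  then have "minimal_L_system H A0 (main Q) (state Q) (chan Q)"
    by (intro minimal_L_system.intro minimal_L_system_axioms.intro prime_A0)
  moreover have "realized_by V H A0 (state Q) (chan Q)"
  proof (rule realized)
    fix z :: complex assume z: "Im z \<noteq> 0"
    show "V z = of_real Q + delta (cls M (kern z))"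
      unfolding V[OF z] delta_tri[OF tri_kern[OF z]] dl_kern[OF z] by (simp only: kern_def w1_def)
  qed
  ultimately show ?thesis
    using parameters[OF a_pos e u \<kappa> U] by blast
qed

end

theorem theorem19:
  fixes Q a \<kappa>0 b \<kappa> :: real and U :: complex and V :: "complex \<Rightarrow> complex"
  assumes "Q \<noteq> 0" and "0 < a" and "a < 1"
    and "a = (1 - \<kappa>0) / (1 + \<kappa>0)"
    and "V \<in> class_M Q \<kappa>0"
    and "b = Q\<^sup>2 + a\<^sup>2 - 1"
    and "\<kappa> = ((b - 2 * Q\<^sup>2 - sqrt (b\<^sup>2 + 4 * Q\<^sup>2))\<^sup>2 - a * (b - sqrt (b\<^sup>2 + 4 * Q\<^sup>2))\<^sup>2
                + 4 * Q\<^sup>2 * a * (a - 1)) /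
             ((b - 2 * Q\<^sup>2 - sqrt (b\<^sup>2 + 4 * Q\<^sup>2))\<^sup>2 + a * (b - sqrt (b\<^sup>2 + 4 * Q\<^sup>2))\<^sup>2
                + 4 * Q\<^sup>2 * a * (a + 1))"
    and "U = ((of_real a + of_real Q * \<i>) * (1 - (of_real \<kappa>)\<^sup>2) - 1 - (of_real \<kappa>)\<^sup>2) / (2 * of_real \<kappa>)"
  shows "0 < \<kappa> \<and> \<kappa> < 1 \<and> cmod U = 1 \<and>
    (\<exists>(H :: (real \<Rightarrow> complex) set inner_space) A T S K gp gm.
       minimal_L_system H A T S K \<and>
       realized_by V H A S K \<and>
       deficiency_vectors H A gp gm \<and>
       main_parameter H T gp gm (of_real \<kappa>) \<and>
       selfadjoint_parameter H A (quasi_kernel H (plus_space H A) S) gp gm U)"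
proof -
  \<comment> \<open>The von Neumann parameter of the main operator before the phase of
    \<open>g_-\<close> is adjusted.\<close>
  define u where "u = (1 + \<i> * of_real Q - of_real a) / (1 + \<i> * of_real Q + complex_of_real a)"
  note Q = assms(1) and a = assms(2) and b = assms(6)
  have \<kappa>: "\<kappa> = cmod u" "0 < \<kappa>" "\<kappa> < 1"
    unfolding assms(7) kappa_eq[OF Q a b refl] u_def using kappa_modulus[OF Q a b] by simp_all
  have U: "U = - of_real \<kappa> / u"
    unfolding assms(8) by (rule U_eq[OF Q a u_def \<kappa>(1,2)])
  have "u \<noteq> 0" using \<kappa> by auto
  then have "cmod U = 1"
    using \<kappa> by (simp add: U norm_divide)
  obtain \<mu> :: "real measure" where \<mu>: "sets \<mu> = sets borel" "emeasure \<mu> UNIV = \<infinity>"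
    "has_bochner_integral \<mu> (\<lambda>t. 1 / (1 + t\<^sup>2)) a"
    and V: "\<And>z. Im z \<noteq> 0 \<Longrightarrow>
      V z = of_real Q + (\<integral>t. (1 / (of_real t - z) - of_real (t / (1 + t\<^sup>2))) \<partial>\<mu>)"
    using assms(5) unfolding class_M_def assms(4)[symmetric] by blast
  interpret herglotz_measure \<mu> a
    using \<mu> a by unfold_locales
  show ?thesis
    using realization[OF Q u_def \<kappa> U V] \<kappa> \<open>cmod U = 1\<close> by blast
qed

end
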